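(* Let $m>n\ge 1$ be integers, $\nu>0$, let $\mathbf{T}_1\sim\mathcal{MT}_{m\times n}^\beta(\nu,\mathbf{0},\mathbf{I}_m,\mathbf{I}_n)$ and let $\widetilde{\mathbf{F}}_1=\mathbf{T}_1^{*}\mathbf{T}_1\in\mathfrak{P}_n^\beta$. Then $\widetilde{\mathbf{F}}_1$ has the density $$\frac{\Gamma_1^\beta[\beta(\nu+mn)/2]}{\Gamma_1^\beta[\beta\nu/2]\,\Gamma_n^\beta[\beta m/2]}\,|\widetilde{\mathbf{F}}_1|^{\beta(m-n+1)/2-1}\,(1+\operatorname{tr}\widetilde{\mathbf{F}}_1)^{-\beta(\nu+mn)/2},\qquad \widetilde{\mathbf{F}}_1\in\mathfrak{P}_n^\beta.$$
   Context: Let $\beta\in\{1,2,4\}$ and let $\mathfrak{F}$ be the real numbers ($\beta=1$), the complex numbers ($\beta=2$) or the quaternions ($\beta=4$). $\mathfrak{F}^{m\times n}$ is the set of $m\times n$ matrices over $\mathfrak{F}$, and $\mathbf{A}^{*}$ is the conjugate transpose. $\mathfrak{P}_p^\beta$ is the cone of $p\times p$ positive definite Hermitian ($\mathbf{A}=\mathbf{A}^*$) matrices over $\mathfrak{F}$; for $\mathbf{A}\in\mathfrak{P}_p^\beta$, $|\mathbf{A}|$ is the product of its $p$ (positive real) eigenvalues. Densities on $\mathfrak{F}^{m\times n}$ are with respect to Lebesgue measure in the $\beta mn$ real components of the entries. Densities on $\mathfrak{P}_p^\beta$ are with respect to the product of the Lebesgue measures of the $p$ real diagonal entries and of the $\beta$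 real components of each entry above the diagonal. $\Gamma_p^\beta[a]=\pi^{p(p-1)\beta/4}\prod_{i=1}^p\Gamma(a-(i-1)\beta/2)$ for $a>(p-1)\beta/2$; in particular $\Gamma_1^\beta[a]=\Gamma(a)$. $\mathbf{T}_1\sim\mathcal{MT}_{m\times n}^\beta(\nu,\mathbf{0},\mathbf{I}_m,\mathbf{I}_n)$ (standard matrix multivariate $T$ distribution, scale parameter $\rho=1$) means that $\mathbf{T}_1\in\mathfrak{F}^{m\times n}$ has density $$\frac{\Gamma_1^\beta[\beta(\nu+mn)/2]}{\pi^{\beta mn/2}\,\Gamma_1^\beta[\beta\nu/2]}\bigl[1+\operatorname{tr}\mathbf{T}_1\mathbf{T}_1^{*}\bigr]^{-\beta(\nu+mn)/2}.$$ The distribution of $\widetilde{\mathbf{F}}_1$ is also called a matrix multivariate beta type II distribution. *)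

theory Defs
  imports "HOL-Analysis.Analysis" "HOL-Probability.Probability"
begin

section \<open>The quaternions\<close>

datatype quat = Quat (qre: real) (qim1: real) (qim2: real) (qim3: real)

lemma quat_eq_iff:
  "x = y \<longleftrightarrow> qre x = qre y \<and> qim1 x = qim1 y \<and> qim2 x = qim2 y \<and> qim3 x = qim3 y"
  using quat.expand by auto

instantiation quat :: ab_group_add
begin

definition "0 = Quat 0 0 0 0"
definition "x + y = Quat (qre x + qre y) (qim1 x + qim1 y) (qim2 x + qim2 y) (qim3 x + qim3 y)"
definition "- x = Quat (- qre x) (- qim1 x) (- qim2 x) (- qim3 x)" for x :: quat
definition "x - y = Quat (qre x - qre y) (qim1 x - qim1 y) (qim2 x - qim2 y) (qim3 x - qim3 y)"

instance
  by standard
    (simp_all add: quat_eq_iff zero_quat_def plus_quat_def uminus_quat_def minus_quat_def)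

end

lemma quat_add_sel [simp]:
  "qre 0 = 0" "qim1 0 = 0" "qim2 0 = 0" "qim3 0 = 0"
  "qre (x + y) = qre x + qre y" "qim1 (x + y) = qim1 x + qim1 y"
  "qim2 (x + y) = qim2 x + qim2 y" "qim3 (x + y) = qim3 x + qim3 y"
  "qre (- x) = - qre x" "qim1 (- x) = - qim1 x" "qim2 (- x) = - qim2 x" "qim3 (- x) = - qim3 x"
  "qre (x - y) = qre x - qre y" "qim1 (x - y) = qim1 x - qim1 y"
  "qim2 (x - y) = qim2 x - qim2 y" "qim3 (x - y) = qim3 x - qim3 y"
  by (simp_all add: zero_quat_def plus_quat_def uminus_quat_def minus_quat_def)

instantiation quat :: real_vector
begin

definition "r *\<^sub>R x = Quat (r * qre x) (r * qim1 x) (r * qim2 x) (r * qim3 x)"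

instance
  by standard (simp_all add: quat_eq_iff scaleR_quat_def algebra_simps)

end

instantiation quat :: real_inner
begin

definition inner_quat_def:
  "inner x y = qre x * qre y + qim1 x * qim1 y + qim2 x * qim2 y + qim3 x * qim3 y"
definition norm_quat_def: "norm x = sqrt (inner x x)" for x :: quat
definition sgn_quat_def: "sgn x = x /\<^sub>R norm x" for x :: quat
definition dist_quat_def: "dist x y = norm (x - y)" for x y :: quat
definition uniformity_quat_def [code del]:
  "(uniformity :: (quat \<times> quat) filter) = (INF e\<in>{0 <..}. principal {(x, y). dist x y < e})"
definition open_quat_def [code del]:
  "open (U :: quat set) \<longleftrightarrow> (\<forall>x\<in>U. eventually (\<lambda>(x', y). x' = x \<longrightarrow> y \<in> U) uniformity)"

instance
proof
  fix x y z :: quat and r :: real and U :: "quat set"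
  show "inner x y = inner y x" "inner (x + y) z = inner x z + inner y z"
    "inner (r *\<^sub>R x) y = r * inner x y" "0 \<le> inner x x"
    by (simp_all add: inner_quat_def scaleR_quat_def algebra_simps)
  show "inner x x = 0 \<longleftrightarrow> x = 0"
    by (simp add: inner_quat_def quat_eq_iff add_nonneg_eq_0_iff)
qed (fact norm_quat_def sgn_quat_def dist_quat_def uniformity_quat_def open_quat_def)+

end

lemma quat_scaleR_sel [simp]:
  "qre (r *\<^sub>R x) = r * qre x" "qim1 (r *\<^sub>R x) = r * qim1 x"
  "qim2 (r *\<^sub>R x) = r * qim2 x" "qim3 (r *\<^sub>R x) = r * qim3 x"
  by (simp_all add: scaleR_quat_def)

instantiation quat :: real_algebra_1
begin

definition "1 = Quat 1 0 0 0"
definition "x * y = Quat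
  (qre x * qre y - qim1 x * qim1 y - qim2 x * qim2 y - qim3 x * qim3 y)
  (qre x * qim1 y + qim1 x * qre y + qim2 x * qim3 y - qim3 x * qim2 y)
  (qre x * qim2 y - qim1 x * qim3 y + qim2 x * qre y + qim3 x * qim1 y)
  (qre x * qim3 y + qim1 x * qim2 y - qim2 x * qim1 y + qim3 x * qre y)"

instance
  by standard (simp_all add: quat_eq_iff one_quat_def times_quat_def algebra_simps)

end

lemma quat_mult_sel [simp]:
  "qre 1 = 1" "qim1 1 = 0" "qim2 1 = 0" "qim3 1 = 0"
  "qre (x * y) = qre x * qre y - qim1 x * qim1 y - qim2 x * qim2 y - qim3 x * qim3 y"
  "qim1 (x * y) = qre x * qim1 y + qim1 x * qre y + qim2 x * qim3 y - qim3 x * qim2 y"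
  "qim2 (x * y) = qre x * qim2 y - qim1 x * qim3 y + qim2 x * qre y + qim3 x * qim1 y"
  "qim3 (x * y) = qre x * qim3 y + qim1 x * qim2 y - qim2 x * qim1 y + qim3 x * qre y"
  by (simp_all add: one_quat_def times_quat_def)

lemma quat_of_real_sel [simp]:
  "qre (of_real r) = r" "qim1 (of_real r) = 0" "qim2 (of_real r) = 0" "qim3 (of_real r) = 0"
  by (simp_all add: of_real_def)

instantiation quat :: real_normed_div_algebra
begin

definition "inverse x =
  Quat (qre x) (- qim1 x) (- qim2 x) (- qim3 x) /\<^sub>R inner x x" for x :: quat
definition "x div y = x * inverse y" for x y :: quat

instance
proof
  fix x y :: quat
  have *: "inner x x \<noteq> 0" if "x \<noteq> 0" using that by simp
  define c where "c = (\<lambda>z. Quat (qre z) (- qim1 z) (- qim2 z) (- qim3 z))"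
  have 1: "c z * z = inner z z *\<^sub>R 1" and 2: "z * c z = inner z z *\<^sub>R 1" for z
    by (simp_all add: c_def quat_eq_iff inner_quat_def)
  have 3: "c (x * y) = c y * c x"
    by (simp add: c_def quat_eq_iff)
  show "inverse x * x = 1" "x * inverse x = 1" if "x \<noteq> 0"
    using * [OF that] 1[of x] 2[of x] by (simp_all add: inverse_quat_def c_def)
  show "x div y = x * inverse y" by (fact divide_quat_def)
  show "inverse (0 :: quat) = 0" by (simp add: inverse_quat_def)
  have "inner (x * y) (x * y) *\<^sub>R 1 = x * (y * c y) * c x"
    by (metis 2 3 mult.assoc)
  also have "\<dots> = (inner x x * inner y y) *\<^sub>R 1"
    by (simp add: 2)
  finally have "inner (x * y) (x * y) = inner x x * inner y y"
    by (metis mult.right_neutral quat_mult_sel(1) quat_scaleR_sel(1))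
  then show "norm (x * y) = norm x * norm y"
    by (simp add: norm_quat_def real_sqrt_mult)
qed

end

instantiation quat :: euclidean_space
begin

definition Basis_quat_def:
  "Basis = {Quat 1 0 0 0, Quat 0 1 0 0, Quat 0 0 1 0, Quat 0 0 0 1}"

instance
proof
  show "(Basis :: quat set) \<noteq> {}" "finite (Basis :: quat set)"
    by (simp_all add: Basis_quat_def)
next
  fix u v :: quat assume "u \<in> Basis" "v \<in> Basis"
  then show "inner u v = (if u = v then 1 else 0)"
    unfolding Basis_quat_def by (elim insertE emptyE) (simp_all add: inner_quat_def)
next
  fix x :: quat
  show "(\<forall>u\<in>Basis. inner x u = 0) \<longleftrightarrow> x = 0"
    unfolding quat_eq_iff [of x] by (auto simp: Basis_quat_def inner_quat_def)
qed

end

lemma DIM_quat [simp]: "DIM(quat) = 4"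
  by (simp add: Basis_quat_def)


section \<open>A common interface for the three division algebras\<close>

text \<open>
  The class serves only to state definitions once for \<^typ>\<open>real\<close>, \<^typ>\<open>complex\<close> and
  \<^typ>\<open>quat\<close>. The parameter $\beta$ is \<open>DIM('f)\<close>, and since the bases are orthonormal,
  \<^const>\<open>lborel\<close> on a matrix type over \<open>'f\<close> is Lebesgue measure in
  the real components of the entries.
\<close>

class conj_div_algebra = real_normed_div_algebra + euclidean_space +
  fixes hconj :: "'a \<Rightarrow> 'a"
  assumes hconj_eq: "hconj x = (2 * inner x 1) *\<^sub>R 1 - x"
    and hconj_mult: "hconj (x * y) = hconj y * hconj x"
    and mult_hconj: "x * hconj x = (norm x)\<^sup>2 *\<^sub>R 1"

instantiation real :: conj_div_algebra
begin

definition hconj_real :: "real \<Rightarrow> real" where "hconj_real x = x"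

instance
  by standard (simp_all add: hconj_real_def power2_eq_square)

end

instantiation complex :: conj_div_algebra
begin

definition hconj_complex :: "complex \<Rightarrow> complex" where "hconj_complex = cnj"

instance
proof
  fix x y :: complex
  show "hconj x = (2 * inner x 1) *\<^sub>R 1 - x" "hconj (x * y) = hconj y * hconj x"
    by (simp_all add: hconj_complex_def inner_complex_def complex_eq_iff)
  show "x * hconj x = (norm x)\<^sup>2 *\<^sub>R 1"
    unfolding hconj_complex_def complex_norm_square [symmetric] by (simp add: scaleR_conv_of_real)
qed

end

instantiation quat :: conj_div_algebra
begin

definition hconj_quat :: "quat \<Rightarrow> quat" where
  "hconj_quat x = Quat (qre x) (- qim1 x) (- qim2 x) (- qim3 x)"

instance
proof
  fix x y :: quat
  show "hconj x = (2 * inner x 1) *\<^sub>R 1 - x" "hconj (x * y) = hconj y * hconj x"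
    by (simp_all add: hconj_quat_def inner_quat_def quat_eq_iff)
  show "x * hconj x = (norm x)\<^sup>2 *\<^sub>R 1"
    by (simp add: hconj_quat_def norm_quat_def inner_quat_def quat_eq_iff)
qed

end

definition re_part :: "'f::conj_div_algebra \<Rightarrow> real" where
  "re_part x = inner x 1"

lemma re_part_simps [simp]: "re_part x = x" "re_part z = Re z" "re_part q = qre q"
  by (simp_all add: re_part_def inner_complex_def inner_quat_def)


section \<open>Hermitian and positive definite matrices\<close>

definition adjoint_mat :: "'f::conj_div_algebra ^ 'n ^ 'm \<Rightarrow> 'f ^ 'm ^ 'n" where
  "adjoint_mat A = (\<chi> i j. hconj (A $ j $ i))"

text \<open>The trace of a Hermitian matrix is real, so \<^const>\<open>re_part\<close> only changes its type.\<close>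

definition real_trace :: "'f::conj_div_algebra ^ 'n ^ 'n \<Rightarrow> real" where
  "real_trace A = re_part (trace A)"

definition hermitian :: "'f::conj_div_algebra ^ 'n ^ 'n \<Rightarrow> bool" where
  "hermitian A \<longleftrightarrow> adjoint_mat A = A"

definition pos_def :: "('f::conj_div_algebra ^ 'n ^ 'n) set" where
  "pos_def = {A. hermitian A \<and>
     (\<forall>x. x \<noteq> 0 \<longrightarrow> (\<exists>r>0. (\<Sum>i\<in>UNIV. hconj (x $ i) * (A *v x) $ i) = of_real r))}"

text \<open>
  The product of the eigenvalues of a Hermitian matrix, counted with multiplicity. All
  (right) eigenvalues of such a matrix are real, and the multiplicity of $\lambda$ is the
  dimension over \<open>'f\<close> of its eigenspace, a right \<open>'f\<close>-module; the
  function \<^const>\<open>dim\<close> is the dimension over the reals, which is $\beta$ times as large.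
\<close>

definition eigenspace :: "'f::conj_div_algebra ^ 'n ^ 'n \<Rightarrow> real \<Rightarrow> ('f ^ 'n) set" where
  "eigenspace A l = {v. A *v v = l *\<^sub>R v}"

definition eig_prod :: "'f::conj_div_algebra ^ 'n ^ 'n \<Rightarrow> real" where
  "eig_prod A =
     (\<Prod>l | \<exists>v\<in>eigenspace A l. v \<noteq> 0. l ^ (dim (eigenspace A l) div DIM('f)))"

text \<open>
  The reference measure for densities of Hermitian matrices: independent coordinates are
  the real diagonal entries \<open>d i\<close> and the entries \<open>u (i, j)\<close> with \<open>i < j\<close>; the order on the
  index type only says which entries lie above the diagonal. The measure is carried by the
  Hermitian matrices inside the type of all square matrices.
\<close>

definition herm_of_coords ::
    "('n \<Rightarrow> real) \<times> ('n \<times> 'n \<Rightarrow> 'f) \<Rightarrow> 'f::conj_div_algebra ^ 'n::{finite,wellorder} ^ 'n::_" where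
  "herm_of_coords = (\<lambda>(d, u). \<chi> i j.
     if i = j then of_real (d i) else if i < j then u (i, j) else hconj (u (j, i)))"

definition herm_lborel :: "('f::conj_div_algebra ^ 'n::{finite,wellorder} ^ 'n::_) measure" where
  "herm_lborel = distr
     (Pi\<^sub>M UNIV (\<lambda>_. lborel) \<Otimes>\<^sub>M Pi\<^sub>M {(i, j). i < j} (\<lambda>_. lborel)) borel herm_of_coords"

text \<open>\<^const>\<open>distr\<close> is only meaningful for a measurable map.\<close>

lemma continuous_on_hconj: "continuous_on S (hconj :: 'f::conj_div_algebra \<Rightarrow> 'f)"
  unfolding hconj_eq by (intro continuous_intros)

lemma measurable_herm_of_coords:
  "(herm_of_coords :: _ \<Rightarrow> 'f::conj_div_algebra ^ 'n::{finite,wellorder} ^ 'n::_) \<in> borel_measurable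
     (Pi\<^sub>M UNIV (\<lambda>_. lborel) \<Otimes>\<^sub>M Pi\<^sub>M {(i, j). i < j} (\<lambda>_. lborel))"
    (is "_ \<in> borel_measurable ?P")
proof -
  have *: "(\<lambda>w. herm_of_coords w $ i $ j :: 'f) \<in> borel_measurable ?P" for i j :: 'n
  proof -
    have "(\<lambda>w. fst w i) \<in> borel_measurable ?P"
      using measurable_compose[OF measurable_fst
          measurable_component_singleton[of i UNIV "\<lambda>_. lborel :: real measure"]] by simp
    then have d: "(\<lambda>w. of_real (fst w i) :: 'f) \<in> borel_measurable ?P"
      by (rule borel_measurable_continuous_on[rotated]) (intro continuous_intros)
    have u: "(\<lambda>w. snd w (k, l) :: 'f) \<in> borel_measurable ?P" if "k < l" for k l :: 'n
      using measurable_compose[OF measurable_snd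
          measurable_component_singleton[of "(k, l)" _ "\<lambda>_. lborel :: 'f measure"]] that
      by simp
    have c: "(\<lambda>w. hconj (snd w (k, l)) :: 'f) \<in> borel_measurable ?P" if "k < l" for k l :: 'n
      by (rule borel_measurable_continuous_on[OF continuous_on_hconj u[OF that]])
    consider "i = j" | "i < j" | "j < i" by fastforce
    then show ?thesis
    proof cases
      case 1
      then show ?thesis using d by (simp add: herm_of_coords_def case_prod_unfold)
    next
      case 2
      then have "i \<noteq> j" by auto
      with 2 show ?thesis using u by (simp add: herm_of_coords_def case_prod_unfold)
    next
      case 3
      then have "\<not> i < j" "i \<noteq> j" by auto
      with 3 show ?thesis using c by (simp add: herm_of_coords_def case_prod_unfold)
    qed
  qed
  have "(\<lambda>w. herm_of_coords w \<bullet> b) \<in> borel_measurable ?P"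
    if "b \<in> Basis" for b :: "(('f, 'n) vec, 'n) vec"
  proof -
    from that obtain i j c where b: "b = axis i (axis j c)"
      by (auto simp: Basis_vec_def)
    show ?thesis
      unfolding b inner_axis by (intro borel_measurable_inner * borel_measurable_const)
  qed
  then show ?thesis
    by (subst borel_measurable_euclidean_space) auto
qed


section \<open>The densities\<close>

definition mv_gamma :: "nat \<Rightarrow> nat \<Rightarrow> real \<Rightarrow> real" where
  "mv_gamma \<beta> p a = pi powr (real p * (real p - 1) * real \<beta> / 4) *
     (\<Prod>i=1..p. Gamma (a - (real i - 1) * real \<beta> / 2))"

definition matrix_T_density :: "real \<Rightarrow> 'f::conj_div_algebra ^ 'n ^ 'm \<Rightarrow> real" where
  "matrix_T_density \<nu> X =
     (let \<beta> = real DIM('f); m = real CARD('m); n = real CARD('n) in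
       mv_gamma DIM('f) 1 (\<beta> * (\<nu> + m * n) / 2) /
         (pi powr (\<beta> * m * n / 2) * mv_gamma DIM('f) 1 (\<beta> * \<nu> / 2)) *
       (1 + real_trace (X ** adjoint_mat X)) powr (- (\<beta> * (\<nu> + m * n) / 2)))"

text \<open>The density is extended by 0 to square matrices that are not positive definite.\<close>

definition matrix_beta2_density ::
    "real \<Rightarrow> nat \<Rightarrow> 'f::conj_div_algebra ^ 'n ^ 'n \<Rightarrow> real" where
  "matrix_beta2_density \<nu> p F =
     (let \<beta> = real DIM('f); m = real p; n = real CARD('n) in
       if F \<in> pos_def then
         mv_gamma DIM('f) 1 (\<beta> * (\<nu> + m * n) / 2) /
           (mv_gamma DIM('f) 1 (\<beta> * \<nu> / 2) * mv_gamma DIM('f) CARD('n) (\<beta> * m / 2)) *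
         eig_prod F powr (\<beta> * (m - n + 1) / 2 - 1) *
         (1 + real_trace F) powr (- (\<beta> * (\<nu> + m * n) / 2))
       else 0)"

end

theory Submission
  imports Defs
begin

text \<open>
  The density of \<open>T\<close> depends on \<open>T\<close> only through \<open>F = T\<^sup>* T\<close>, so it suffices to push
  Lebesgue measure forward along \<open>T \<mapsto> T\<^sup>* T\<close>. This is done by induction on the number of
  columns. A unitary map rotates the first column \<open>x\<close> to \<open>\<bar>x\<bar> e\<^sub>r\<close>; with \<open>t = \<bar>x\<bar>\<^sup>2\<close> and
  \<open>a\<close> the \<open>r\<close>-th row of the remaining columns, the first row of \<open>F\<close> is \<open>(t, \<surd>t a)\<close>, and the Schur
  complement of \<open>t\<close> in \<open>F\<close> is the Gram matrix of the other columns with their \<open>r\<close>-th row deleted,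
  to which the induction hypothesis applies. The exponent of the determinant is the same at every stage,
  because \<open>m - n\<close> does not change, and the determinant is \<open>t\<close> times that of the Schur complement.

  Over the quaternions there is no determinant polynomial to work with. Instead
  \<^const>\<open>eig_prod\<close> is read off from the Gaussian integral of the quadratic form of \<open>A\<close>, which
  equals \<open>(\<pi>\<^sup>n / \<bar>A\<bar>)\<close> to the power \<open>\<beta>/2\<close> by the spectral theorem; integrating out one
  coordinate gives the Schur complement formula, and measurability comes for free.
\<close>

section \<open>Product measures on vectors\<close>

text \<open>Dimensions are types, so an induction on the number of columns cannot shrink the
  matrices. It runs over index sets instead, \<open>S\<close> for the live columns and
  \<open>R\<close> for the live rows: \<open>pad\<close> puts Lebesgue measure on live coordinates
  and point masses on the others, and the dead part of a square matrix is filled by the identity.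
  \<open>S\<close> grows by indices smaller than all old ones, so a new index \<open>s\<close> adds
  exactly the coordinates \<open>(s, j)\<close> above the diagonal. Integrals of arbitrary functions
  into \<open>ennreal\<close> are compared. This avoids integrability questions, and almost sure
  positive definiteness of the Gram matrix is a by-product: the weight on the other side vanishes
  off the cone. A column with k live rows contributes pi^(beta k/2) / Gamma(beta k/2), the constant
  in the law of its squared length. The product over k = m, ..., m-n+1 is pi^(beta m n/2) divided by
  the multivariate gamma function, and this power of pi cancels the one in the density of T.\<close>

lemma borel_measurable_vec_nth [measurable (raw)]:
  fixes f :: "'w \<Rightarrow> 'a::euclidean_space ^ 'i"
  assumes [measurable]: "f \<in> borel_measurable M"
  shows "(\<lambda>x. f x $ i) \<in> borel_measurable M"
  by (rule borel_measurable_continuous_on[OF _ assms, of "\<lambda>x. x $ i"]) (intro continuous_intros)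

lemma borel_measurable_vec_lambda [measurable (raw)]:
  fixes f :: "'w \<Rightarrow> 'i::finite \<Rightarrow> 'a::euclidean_space"
  assumes [measurable]: "\<And>i. (\<lambda>x. f x i) \<in> borel_measurable M"
  shows "(\<lambda>x. \<chi> i. f x i) \<in> borel_measurable M"
proof (subst borel_measurable_euclidean_space, intro ballI)
  fix b :: "'a ^ 'i" assume "b \<in> Basis"
  then obtain i c where b: "b = axis i c" by (auto simp: Basis_vec_def)
  show "(\<lambda>x. (\<chi> i. f x i) \<bullet> b) \<in> borel_measurable M"
    unfolding b inner_axis by simp
qed

definition vec_upd :: "'a ^ 'i \<Rightarrow> 'i \<Rightarrow> 'a \<Rightarrow> 'a ^ 'i::finite" where
  "vec_upd x s y = (\<chi> i. if i = s then y else x $ i)"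

lemma vec_upd_nth [simp]: "vec_upd x s y $ i = (if i = s then y else x $ i)"
  by (simp add: vec_upd_def)

lemma borel_measurable_vec_upd [measurable (raw)]:
  fixes f :: "'w \<Rightarrow> 'a::euclidean_space ^ 'i"
  assumes [measurable]: "f \<in> borel_measurable M" "g \<in> borel_measurable M"
  shows "(\<lambda>x. vec_upd (f x) s (g x)) \<in> borel_measurable M"
proof -
  have [measurable]: "(\<lambda>x. if i = s then g x else f x $ i) \<in> borel_measurable M" for i
    by (cases "i = s") auto
  show ?thesis unfolding vec_upd_def by measurable
qed

text \<open>What Fubini needs, with Borel sets fixed so that measurability goals do not depend on
  the measure. The locale is closed under \<open>pad\<close>, so columns, which are vectors of
  scalars, can in turn serve as the coordinates of a matrix.\<close>

locale borel_sigma_finite = sigma_finite_measure N for N :: "'a::euclidean_space measure" +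
  assumes sets_N [measurable_cong, simp]: "sets N = sets borel"

lemma borel_sigma_finite_lborel: "borel_sigma_finite lborel"
  by standard auto

text \<open>An image of a sigma-finite measure can fail to be sigma-finite. A measurable left
  inverse \<open>g\<close> transports a countable cover of finite measure: the preimage under
  \<open>f\<close> of the preimage of \<open>a\<close> under \<open>g\<close> is \<open>a\<close>
  again.\<close>

lemma sigma_finite_measure_distr_inj:
  assumes "sigma_finite_measure M" and f [measurable]: "f \<in> M \<rightarrow>\<^sub>M N"
    and g [measurable]: "g \<in> N \<rightarrow>\<^sub>M M" and gf: "\<And>x. x \<in> space M \<Longrightarrow> g (f x) = x"
  shows "sigma_finite_measure (distr M N f)"
proof -
  interpret sigma_finite_measure M by fact
  obtain A where A: "countable A" "A \<subseteq> sets M" "\<Union>A = space M" "\<forall>a\<in>A. emeasure M a \<noteq> \<infinity>"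
    using sigma_finite_countable by blast
  define B where "B a = g -` a \<inter> space N" for a
  have B: "B a \<in> sets N" if "a \<in> A" for a
    using A that unfolding B_def by (intro measurable_sets[OF g]) auto
  show ?thesis
  proof (standard, intro exI[of _ "B ` A"] conjI ballI)
    show "countable (B ` A)" using A by auto
    show "B ` A \<subseteq> sets (distr M N f)" using B by auto
    have "\<exists>a\<in>A. x \<in> B a" if "x \<in> space N" for x
      using measurable_space[OF g that] A(3) that by (auto simp: B_def)
    then show "\<Union>(B ` A) = space (distr M N f)"
      by (auto simp: B_def)
    fix b assume "b \<in> B ` A"
    then obtain a where a: "a \<in> A" "b = B a" by auto
    have "a \<subseteq> space M" using A(2) a(1) by (meson sets.sets_into_space subsetD)
    moreover have "f x \<in> B a \<longleftrightarrow> x \<in> a" if "x \<in> space M" for x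
      using that measurable_space[OF f that] gf[OF that] by (simp add: B_def)
    ultimately have "f -` B a \<inter> space M = a"
      by blast
    then show "emeasure (distr M N f) b \<noteq> \<infinity>"
      using a A B by (simp add: emeasure_distr)
  qed
qed

definition pad :: "'a::euclidean_space measure \<Rightarrow> 'i::finite set \<Rightarrow> 'a ^ 'i \<Rightarrow> ('a ^ 'i) measure" where
  "pad N S a = distr (Pi\<^sub>M UNIV (\<lambda>i. if i \<in> S then N else return borel (a $ i))) borel vec_lambda"

lemma sets_pad [measurable_cong, simp]: "sets (pad N S a) = sets borel"
  by (simp add: pad_def)

lemma space_pad [simp]: "space (pad N S a) = UNIV"
  by (simp add: pad_def)

context borel_sigma_finite
begin

lemma product_sigma_finite_pad:
  "product_sigma_finite (\<lambda>i. if i \<in> S then N else return borel (a $ i))"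
proof (rule product_sigma_finite.intro)
  show "sigma_finite_measure (if i \<in> S then N else return borel (a $ i))" for i
    using sigma_finite_measure_axioms prob_space_imp_sigma_finite[OF prob_space_return[of "a $ i" borel]]
    by simp
qed

lemma sets_pad_PiM:
  "sets (Pi\<^sub>M J (\<lambda>i. if i \<in> S then N else return borel (a $ i))) = sets (Pi\<^sub>M J (\<lambda>_. borel))"
  by (rule sets_PiM_cong) simp_all

lemma measurable_vec_lambda_PiM:
  "vec_lambda \<in> borel_measurable (Pi\<^sub>M UNIV (\<lambda>_. borel :: 'a measure))"
proof -
  have "(\<lambda>x. \<chi> i. x i) \<in> borel_measurable (Pi\<^sub>M UNIV (\<lambda>_. borel :: 'a measure))"
    by measurable
  then show ?thesis by simp
qed

lemma measurable_vec_lambda_pad: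
  "vec_lambda \<in> borel_measurable (Pi\<^sub>M UNIV (\<lambda>i. if i \<in> S then N else return borel (a $ i)))"
  using measurable_vec_lambda_PiM unfolding measurable_cong_sets[OF sets_pad_PiM refl] .

lemma borel_sigma_finite_pad: "borel_sigma_finite (pad N S a)"
proof -
  let ?M = "\<lambda>i. if i \<in> S then N else return borel (a $ i)"
  interpret product_sigma_finite ?M by (rule product_sigma_finite_pad)
  have "(\<lambda>x. \<lambda>i\<in>UNIV. x $ i) \<in> borel \<rightarrow>\<^sub>M Pi\<^sub>M UNIV (\<lambda>_. borel :: 'a measure)"
    by (intro measurable_restrict) measurable
  then have "vec_nth \<in> borel \<rightarrow>\<^sub>M Pi\<^sub>M UNIV ?M"
    by (simp add: restrict_UNIV measurable_cong_sets[OF refl sets_pad_PiM])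
  then have "sigma_finite_measure (pad N S a)"
    unfolding pad_def
    by (intro sigma_finite_measure_distr_inj[where g = vec_nth] sigma_finite
        measurable_vec_lambda_pad) (simp_all add: vec_lambda_inverse)
  then show ?thesis
    by (simp add: borel_sigma_finite_def borel_sigma_finite_axioms_def)
qed

lemma nn_integral_pad_empty:
  assumes [measurable]: "f \<in> borel_measurable borel"
  shows "(\<integral>\<^sup>+x. f x \<partial>pad N {} a) = f a"
proof -
  have "Pi\<^sub>M UNIV (\<lambda>i. return borel (a $ i)) = return (Pi\<^sub>M UNIV (\<lambda>_. borel :: 'a measure)) (restrict (vec_nth a) UNIV)"
    by (rule PiM_return) auto
  then show ?thesis
    using measurable_vec_lambda_PiM
    by (simp add: pad_def nn_integral_distr nn_integral_return space_PiM restrict_UNIV)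
qed

text \<open>The recursion behind every later induction over \<open>S\<close>: the two product
  measures differ only in the factor at \<open>s\<close>, and \<open>vec_upd\<close> overwrites that
  coordinate.\<close>

lemma nn_integral_pad_insert:
  assumes s: "s \<notin> S" and [measurable]: "f \<in> borel_measurable borel"
  shows "(\<integral>\<^sup>+x. f x \<partial>pad N (insert s S) a) = (\<integral>\<^sup>+x. \<integral>\<^sup>+y. f (vec_upd x s y) \<partial>N \<partial>pad N S a)"
proof -
  let ?M = "\<lambda>S i. if i \<in> S then N else return borel (a $ i)"
  let ?J = "UNIV - {s}"
  have U: "UNIV = insert s ?J" by auto
  have J: "Pi\<^sub>M ?J (?M (insert s S)) = Pi\<^sub>M ?J (?M S)"
    by (rule PiM_cong) auto
  have *: "(\<integral>\<^sup>+x. g (vec_lambda x) \<partial>Pi\<^sub>M UNIV (?M T)) =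
     (\<integral>\<^sup>+x. \<integral>\<^sup>+y. g (vec_lambda (x(s := y))) \<partial>(?M T s) \<partial>Pi\<^sub>M ?J (?M T))"
    if [measurable]: "g \<in> borel_measurable borel" for g :: "_ \<Rightarrow> ennreal" and T
  proof -
    interpret product_sigma_finite "?M T" by (rule product_sigma_finite_pad)
    have "(\<lambda>x. g (vec_lambda x)) \<in> borel_measurable (Pi\<^sub>M (insert s ?J) (?M T))"
      using measurable_compose[OF measurable_vec_lambda_pad that] by (simp add: U[symmetric])
    from product_nn_integral_insert[OF _ _ this] show ?thesis
      by (simp add: U[symmetric])
  qed
  have [measurable]: "(\<lambda>x. \<integral>\<^sup>+y. f (vec_upd x s y) \<partial>N) \<in> borel_measurable borel"
    by measurable
  have upd: "vec_upd (vec_lambda (x(s := z))) s y = vec_lambda (x(s := y))" for x :: "'b \<Rightarrow> 'a" and y z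
    by (simp add: vec_eq_iff)
  have "(\<integral>\<^sup>+x. f x \<partial>pad N (insert s S) a) = (\<integral>\<^sup>+x. f (vec_lambda x) \<partial>Pi\<^sub>M UNIV (?M (insert s S)))"
    unfolding pad_def by (subst nn_integral_distr[OF measurable_vec_lambda_pad]) auto
  also have "\<dots> = (\<integral>\<^sup>+x. \<integral>\<^sup>+y. f (vec_lambda (x(s := y))) \<partial>N \<partial>Pi\<^sub>M ?J (?M S))"
    using *[of f "insert s S"] by (simp only: J) simp
  \<comment> \<open>A dummy integral over the point mass at \<open>s\<close> is inserted. By
    \<open>upd\<close> the integrand does not depend on \<open>z\<close>, and the mass is 1.\<close>
  also have "\<dots> = (\<integral>\<^sup>+x. \<integral>\<^sup>+z. \<integral>\<^sup>+y. f (vec_upd (vec_lambda (x(s := z))) s y) \<partial>N \<partial>(?M S s) \<partial>Pi\<^sub>M ?J (?M S))"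
    unfolding upd using s by (simp add: prob_space.emeasure_space_1[OF prob_space_return])
  also have "\<dots> = (\<integral>\<^sup>+x. \<integral>\<^sup>+y. f (vec_upd (vec_lambda x) s y) \<partial>N \<partial>Pi\<^sub>M UNIV (?M S))"
    by (subst *[of "\<lambda>x. \<integral>\<^sup>+y. f (vec_upd x s y) \<partial>N" S]) simp_all
  also have "\<dots> = (\<integral>\<^sup>+x. \<integral>\<^sup>+y. f (vec_upd x s y) \<partial>N \<partial>pad N S a)"
    unfolding pad_def by (subst nn_integral_distr[OF measurable_vec_lambda_pad]) auto
  finally show ?thesis .
qed

lemma Fubini:
  assumes "borel_sigma_finite L" and [measurable]: "case_prod f \<in> borel_measurable (borel \<Otimes>\<^sub>M borel)"
  shows "(\<integral>\<^sup>+x. \<integral>\<^sup>+y. f x y \<partial>L \<partial>N) = (\<integral>\<^sup>+y. \<integral>\<^sup>+x. f x y \<partial>N \<partial>L)"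
proof -
  interpret L: borel_sigma_finite L by fact
  interpret P: pair_sigma_finite N L ..
  show ?thesis
    by (rule P.Fubini'[symmetric]) measurable
qed

end

text \<open>Lebesgue measure is determined by the volumes of boxes. The basis vectors are the
  \<open>axis i c\<close>, so a box of vectors is a product of boxes and its volume a double
  product.\<close>

lemma lborel_eq_pad: "lborel = pad lborel UNIV a"
  for a :: "'a::euclidean_space ^ 'i"
proof (rule lborel_eqI)
  interpret product_sigma_finite "\<lambda>_::'i. lborel :: 'a measure" by standard
  fix l u :: "'a ^ 'i" assume lu: "\<And>b. b \<in> Basis \<Longrightarrow> l \<bullet> b \<le> u \<bullet> b"
  have lu': "l $ i \<bullet> c \<le> u $ i \<bullet> c" if "c \<in> Basis" for i c
    using lu[of "axis i c"] that by (auto simp: inner_axis Basis_vec_def)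
  have box: "vec_lambda -` box l u = Pi\<^sub>E UNIV (\<lambda>i. box (l $ i) (u $ i))"
    by (auto simp: box_def Basis_vec_def inner_axis)
  have prod: "(\<Prod>b\<in>Basis. (u - l) \<bullet> b) = (\<Prod>i\<in>UNIV. \<Prod>c\<in>Basis. (u $ i - l $ i) \<bullet> c)"
  proof -
    have B: "(Basis :: ('a ^ 'i) set) = (\<lambda>(i, c). axis i c) ` (UNIV \<times> Basis)"
      by (auto simp: Basis_vec_def)
    have inj: "inj_on (\<lambda>(i, c). axis i c :: 'a ^ 'i) (UNIV \<times> Basis)"
      by (auto simp: inj_on_def axis_eq_axis)
    have "(\<Prod>b\<in>Basis. (u - l) \<bullet> b) = (\<Prod>(i, c)\<in>UNIV \<times> Basis. (u - l) \<bullet> axis i c)"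
      unfolding B by (subst prod.reindex[OF inj]) (simp add: case_prod_unfold)
    then show ?thesis
      by (simp add: prod.cartesian_product inner_axis)
  qed
  have m: "vec_lambda \<in> borel_measurable (Pi\<^sub>M UNIV (\<lambda>_::'i. lborel :: 'a measure))"
    using borel_sigma_finite.measurable_vec_lambda_pad[OF borel_sigma_finite_lborel, of UNIV]
    by simp
  have "emeasure (pad lborel UNIV a) (box l u) =
    emeasure (Pi\<^sub>M UNIV (\<lambda>_::'i. lborel)) (Pi\<^sub>E UNIV (\<lambda>i. box (l $ i) (u $ i)))"
    using m by (simp add: pad_def emeasure_distr box space_PiM)
  also have "\<dots> = (\<Prod>i\<in>UNIV. emeasure lborel (box (l $ i) (u $ i)))"
    by (subst emeasure_PiM) auto
  also have "\<dots> = (\<Prod>b\<in>Basis. (u - l) \<bullet> b)"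
    unfolding prod using lu'
    by (simp add: emeasure_lborel_box_eq prod_ennreal prod_nonneg inner_diff_left)
  finally show "emeasure (pad lborel UNIV a) (box l u) = ennreal (\<Prod>b\<in>Basis. (u - l) \<bullet> b)" .
qed simp

context borel_sigma_finite
begin

lemma nn_integral_pad_eq_0:
  fixes f :: "'a ^ 'i \<Rightarrow> ennreal"
  assumes "finite S" "f \<in> borel_measurable borel" "\<And>x. (\<forall>i. i \<notin> S \<longrightarrow> x $ i = a $ i) \<Longrightarrow> f x = 0"
  shows "(\<integral>\<^sup>+x. f x \<partial>pad N S a) = 0"
  using assms
proof (induction S arbitrary: f rule: finite_induct)
  case empty
  then show ?case by (simp add: nn_integral_pad_empty)
next
  case (insert s S)
  note [measurable] = insert.prems(1)
  have "(\<integral>\<^sup>+x. f x \<partial>pad N (insert s S) a) = (\<integral>\<^sup>+x. \<integral>\<^sup>+y. f (vec_upd x s y) \<partial>N \<partial>pad N S a)"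
    using insert.hyps by (simp add: nn_integral_pad_insert)
  also have "\<dots> = 0"
  proof (rule insert.IH)
    show "(\<integral>\<^sup>+y. f (vec_upd x s y) \<partial>N) = 0" if "\<forall>i. i \<notin> S \<longrightarrow> x $ i = a $ i" for x
      using that insert.prems(2)[of "vec_upd x s _"] by simp
  qed measurable
  finally show ?case .
qed

text \<open>The measure is carried by the affine subspace through \<open>a\<close> in the directions
  of \<open>S\<close>. Identities that hold only there, such as those for norms, may therefore be
  used under the integral.\<close>

lemma AE_pad:
  fixes a :: "'a ^ 'i"
  shows "AE x in pad N S a. \<forall>i. i \<notin> S \<longrightarrow> x $ i = a $ i"
proof -
  have *: "{x. \<not> (\<forall>i. i \<notin> S \<longrightarrow> x $ i = a $ i)} \<in> sets borel"
    by measurable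
  have "emeasure (pad N S a) {x. \<not> (\<forall>i. i \<notin> S \<longrightarrow> x $ i = a $ i)} =
    (\<integral>\<^sup>+x. indicator {x. \<not> (\<forall>i. i \<notin> S \<longrightarrow> x $ i = a $ i)} x \<partial>pad N S a)"
    using * by (intro nn_integral_indicator[symmetric]) simp
  also have "\<dots> = 0"
    by (rule nn_integral_pad_eq_0) (use * in \<open>auto simp: indicator_def\<close>)
  finally show ?thesis
    using * by (intro AE_I'[of "{x. \<not> (\<forall>i. i \<notin> S \<longrightarrow> x $ i = a $ i)}"]) (auto simp: null_sets_def)
qed

lemma nn_integral_pad_cong:
  assumes "\<And>x. (\<And>i. i \<notin> S \<Longrightarrow> x $ i = a $ i) \<Longrightarrow> f x = g x"
  shows "(\<integral>\<^sup>+x. f x \<partial>pad N S a) = (\<integral>\<^sup>+x. g x \<partial>pad N S a)"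
  by (rule nn_integral_cong_AE, rule AE_mp[OF AE_pad]) (use assms in auto)

lemma nn_integral_pad_map:
  fixes f :: "'a ^ 'i \<Rightarrow> ennreal" and \<phi> :: "'i \<Rightarrow> 'b::euclidean_space \<Rightarrow> 'a"
  assumes L: "borel_sigma_finite L" and "finite S" and f: "f \<in> borel_measurable borel"
    and \<phi>: "\<And>i. \<phi> i \<in> borel_measurable borel"
    and NL: "\<And>i h. i \<in> S \<Longrightarrow> h \<in> borel_measurable borel \<Longrightarrow>
      (\<integral>\<^sup>+x. h x \<partial>N) = k * (\<integral>\<^sup>+x. h (\<phi> i x) \<partial>L)"
    and ab: "\<And>i. \<phi> i (b $ i) = a $ i"
  shows "(\<integral>\<^sup>+x. f x \<partial>pad N S a) = k ^ card S * (\<integral>\<^sup>+x. f (\<chi> i. \<phi> i (x $ i)) \<partial>pad L S b)"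
  using \<open>finite S\<close> f NL
proof (induction S arbitrary: f rule: finite_induct)
  case empty
  interpret L: borel_sigma_finite L by fact
  note [measurable] = empty.prems(1) \<phi>
  have "(\<chi> i. \<phi> i (b $ i)) = a" using ab by (simp add: vec_eq_iff)
  then show ?case by (simp add: nn_integral_pad_empty L.nn_integral_pad_empty)
next
  case (insert s S)
  interpret L: borel_sigma_finite L by fact
  note [measurable] = insert.prems(1) \<phi>
  have upd: "vec_upd (\<chi> i. \<phi> i (x $ i)) s (\<phi> s y) = (\<chi> i. \<phi> i (vec_upd x s y $ i))" for x y
    by (simp add: vec_eq_iff)
  have "(\<integral>\<^sup>+x. f x \<partial>pad N (insert s S) a) = (\<integral>\<^sup>+x. \<integral>\<^sup>+y. f (vec_upd x s y) \<partial>N \<partial>pad N S a)"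
    using insert.hyps by (simp add: nn_integral_pad_insert)
  also have "\<dots> = (\<integral>\<^sup>+x. k * \<integral>\<^sup>+y. f (vec_upd x s (\<phi> s y)) \<partial>L \<partial>pad N S a)"
    by (intro nn_integral_cong insert.prems(2)) auto
  also have "\<dots> = k ^ card S * (\<integral>\<^sup>+x. k * \<integral>\<^sup>+y. f (vec_upd (\<chi> i. \<phi> i (x $ i)) s (\<phi> s y)) \<partial>L \<partial>pad L S b)"
    by (intro insert.IH insert.prems(2)) auto
  also have "\<dots> = k ^ card (insert s S) * (\<integral>\<^sup>+x. \<integral>\<^sup>+y. f (\<chi> i. \<phi> i (vec_upd x s y $ i)) \<partial>L \<partial>pad L S b)"
    using insert.hyps unfolding upd by (subst nn_integral_cmult) (auto simp: mult_ac)
  also have "\<dots> = k ^ card (insert s S) * (\<integral>\<^sup>+x. f (\<chi> i. \<phi> i (x $ i)) \<partial>pad L (insert s S) b)"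
    using insert.hyps by (subst L.nn_integral_pad_insert) auto
  finally show ?case .
qed

text \<open>The same with each coordinate assembled from two independent parts. It serves to split
  every column into one entry and the rest; Fubini collects the parts into two separate
  vectors.\<close>

lemma nn_integral_pad_map2:
  fixes f :: "'a ^ 'i \<Rightarrow> ennreal" and \<phi> :: "'b::euclidean_space \<Rightarrow> 'c::euclidean_space \<Rightarrow> 'a"
  assumes L: "borel_sigma_finite L" and K: "borel_sigma_finite K"
    and "finite S" and f: "f \<in> borel_measurable borel"
    and \<phi>: "case_prod \<phi> \<in> borel_measurable (borel \<Otimes>\<^sub>M borel)"
    and NL: "\<And>h. h \<in> borel_measurable borel \<Longrightarrow>
      (\<integral>\<^sup>+x. h x \<partial>N) = (\<integral>\<^sup>+x. \<integral>\<^sup>+y. h (\<phi> x y) \<partial>K \<partial>L)"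
    and ab: "\<And>i. \<phi> (b $ i) (c $ i) = a $ i"
  shows "(\<integral>\<^sup>+x. f x \<partial>pad N S a) = (\<integral>\<^sup>+x. \<integral>\<^sup>+y. f (\<chi> i. \<phi> (x $ i) (y $ i)) \<partial>pad K S c \<partial>pad L S b)"
  using \<open>finite S\<close> f
proof (induction S arbitrary: f rule: finite_induct)
  case empty
  interpret L: borel_sigma_finite L by fact
  interpret K: borel_sigma_finite K by fact
  interpret pK: borel_sigma_finite "pad K {} c" by (rule K.borel_sigma_finite_pad)
  note [measurable] = empty.prems(1) \<phi>
  have "(\<chi> i. \<phi> (b $ i) (c $ i)) = a" using ab by (simp add: vec_eq_iff)
  moreover have "(\<integral>\<^sup>+y. f (\<chi> i. \<phi> (x $ i) (y $ i)) \<partial>pad K {} c) = f (\<chi> i. \<phi> (x $ i) (c $ i))" for x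
    by (intro K.nn_integral_pad_empty) measurable
  ultimately show ?case
    by (simp add: nn_integral_pad_empty L.nn_integral_pad_empty)
next
  case (insert s S)
  interpret L: borel_sigma_finite L by fact
  interpret K: borel_sigma_finite K by fact
  interpret pK: borel_sigma_finite "pad K S c" by (rule K.borel_sigma_finite_pad)
  interpret pK': borel_sigma_finite "pad K (insert s S) c" by (rule K.borel_sigma_finite_pad)
  note [measurable] = insert.prems(1) \<phi>
  have upd: "vec_upd (\<chi> i. \<phi> (x $ i) (y $ i)) s (\<phi> v w) = (\<chi> i. \<phi> (vec_upd x s v $ i) (vec_upd y s w $ i))" for x y v w
    by (simp add: vec_eq_iff)
  have "(\<integral>\<^sup>+x. f x \<partial>pad N (insert s S) a) = (\<integral>\<^sup>+x. \<integral>\<^sup>+y. f (vec_upd x s y) \<partial>N \<partial>pad N S a)"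
    using insert.hyps by (simp add: nn_integral_pad_insert)
  also have "\<dots> = (\<integral>\<^sup>+x. (\<integral>\<^sup>+v. \<integral>\<^sup>+w. f (vec_upd x s (\<phi> v w)) \<partial>K \<partial>L) \<partial>pad N S a)"
    by (intro nn_integral_cong NL) measurable
  also have "\<dots> = (\<integral>\<^sup>+x. \<integral>\<^sup>+y. (\<integral>\<^sup>+v. \<integral>\<^sup>+w. f (vec_upd (\<chi> i. \<phi> (x $ i) (y $ i)) s (\<phi> v w)) \<partial>K \<partial>L) \<partial>pad K S c \<partial>pad L S b)"
    by (intro insert.IH) measurable
  also have "\<dots> = (\<integral>\<^sup>+x. \<integral>\<^sup>+v. \<integral>\<^sup>+y. \<integral>\<^sup>+w. f (\<chi> i. \<phi> (vec_upd x s v $ i) (vec_upd y s w $ i)) \<partial>K \<partial>pad K S c \<partial>L \<partial>pad L S b)"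
    unfolding upd by (intro nn_integral_cong pK.Fubini L) measurable
  also have "\<dots> = (\<integral>\<^sup>+x. \<integral>\<^sup>+v. \<integral>\<^sup>+y. f (\<chi> i. \<phi> (vec_upd x s v $ i) (y $ i)) \<partial>pad K (insert s S) c \<partial>L \<partial>pad L S b)"
    using insert.hyps by (subst K.nn_integral_pad_insert) auto
  also have "\<dots> = (\<integral>\<^sup>+x. \<integral>\<^sup>+y. f (\<chi> i. \<phi> (x $ i) (y $ i)) \<partial>pad K (insert s S) c \<partial>pad L (insert s S) b)"
    using insert.hyps by (subst L.nn_integral_pad_insert) auto
  finally show ?case .
qed

end

section \<open>Affine substitutions and Gaussian integrals\<close>

lemma nn_integral_lborel_affine:
  fixes f :: "'a::euclidean_space \<Rightarrow> ennreal"
  assumes [measurable]: "f \<in> borel_measurable borel" and c: "c \<noteq> 0"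
  shows "(\<integral>\<^sup>+x. f x \<partial>lborel) = ennreal (\<bar>c\<bar> ^ DIM('a)) * (\<integral>\<^sup>+x. f (t + c *\<^sub>R x) \<partial>lborel)"
  by (subst lborel_affine[OF c, of t])
     (simp add: nn_integral_density nn_integral_distr nn_integral_cmult)

lemma nn_integral_pad_lborel_translate:
  fixes f :: "'a::euclidean_space ^ 'i \<Rightarrow> ennreal"
  assumes [measurable]: "f \<in> borel_measurable borel" and t: "\<And>i. i \<notin> S \<Longrightarrow> t $ i = 0"
  shows "(\<integral>\<^sup>+x. f (x + t) \<partial>pad lborel S a) = (\<integral>\<^sup>+x. f x \<partial>pad lborel S a)"
proof -
  interpret borel_sigma_finite "lborel :: 'a measure" by (rule borel_sigma_finite_lborel)
  have "(\<integral>\<^sup>+x. f x \<partial>pad lborel S a) = 1 ^ card S * (\<integral>\<^sup>+x. f (\<chi> i. x $ i + t $ i) \<partial>pad lborel S (a - t))"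
  proof (rule nn_integral_pad_map)
    show "(\<integral>\<^sup>+x. h x \<partial>lborel) = 1 * (\<integral>\<^sup>+x. h (x + t $ i) \<partial>lborel)"
      if [measurable]: "h \<in> borel_measurable borel" for h :: "'a \<Rightarrow> ennreal" and i
      using nn_integral_lborel_affine[OF that, of 1 "t $ i"] by (simp add: add.commute)
  qed (auto simp: borel_sigma_finite_lborel)
  \<comment> \<open>\<open>t\<close> vanishes off \<open>S\<close>, so the point masses do not
    move.\<close>
  moreover have "pad lborel S (a - t) = pad lborel S a"
    unfolding pad_def using t by (intro arg_cong[where f = "\<lambda>M. distr M borel vec_lambda"] PiM_cong) auto
  moreover have "(\<chi> i. x $ i + t $ i) = x + t" for x by (simp add: vec_eq_iff)
  ultimately show ?thesis by simp
qed

lemma nn_integral_pad_lborel_scale: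
  fixes f :: "'a::euclidean_space ^ 'i \<Rightarrow> ennreal"
  assumes [measurable]: "f \<in> borel_measurable borel" and c: "c \<noteq> 0"
  shows "(\<integral>\<^sup>+x. f x \<partial>pad lborel S 0) =
    ennreal (\<bar>c\<bar> ^ (DIM('a) * card S)) * (\<integral>\<^sup>+x. f (c *\<^sub>R x) \<partial>pad lborel S 0)"
proof -
  interpret borel_sigma_finite "lborel :: 'a measure" by (rule borel_sigma_finite_lborel)
  have "(\<integral>\<^sup>+x. f x \<partial>pad lborel S 0) =
    ennreal (\<bar>c\<bar> ^ DIM('a)) ^ card S * (\<integral>\<^sup>+x. f (\<chi> i. c *\<^sub>R x $ i) \<partial>pad lborel S 0)"
  proof (rule nn_integral_pad_map)
    show "(\<integral>\<^sup>+x. h x \<partial>lborel) = ennreal (\<bar>c\<bar> ^ DIM('a)) * (\<integral>\<^sup>+x. h (c *\<^sub>R x) \<partial>lborel)"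
      if [measurable]: "h \<in> borel_measurable borel" for h :: "'a \<Rightarrow> ennreal"
      using nn_integral_lborel_affine[OF that c, of 0] by simp
  qed (auto simp: borel_sigma_finite_lborel)
  moreover have "(\<chi> i. c *\<^sub>R x $ i) = c *\<^sub>R x" for x :: "'a ^ 'i" by (simp add: vec_eq_iff)
  ultimately show ?thesis by (simp add: ennreal_power power_mult)
qed

text \<open>Up to the factor sqrt(pi/l) the integrand is the normal density with mean 0 and variance
  1/(2l).\<close>

lemma nn_integral_gaussian_real:
  assumes "l > 0"
  shows "(\<integral>\<^sup>+x. ennreal (exp (- l * x\<^sup>2)) \<partial>lborel) = ennreal (sqrt (pi / l))"
proof -
  have "prob_space (density lborel (\<lambda>x. ennreal (normal_density 0 (sqrt (1 / (2 * l))) x)))"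
    using assms by (intro prob_space_normal_density) simp
  then have "(\<integral>\<^sup>+x. ennreal (normal_density 0 (sqrt (1 / (2 * l))) x) \<partial>lborel) = 1"
    by (auto dest!: prob_space.emeasure_space_1 simp: emeasure_density)
  moreover have "ennreal (exp (- l * x\<^sup>2)) =
    ennreal (sqrt (pi / l)) * ennreal (normal_density 0 (sqrt (1 / (2 * l))) x)" for x
    using assms by (simp add: normal_density_def ennreal_mult[symmetric] real_sqrt_divide field_simps)
  ultimately show ?thesis by (simp add: nn_integral_cmult)
qed

lemma nn_integral_gaussian:
  assumes "l > 0"
  shows "(\<integral>\<^sup>+x. ennreal (exp (- l * (norm x)\<^sup>2)) \<partial>(lborel :: 'a::euclidean_space measure)) =
    ennreal ((pi / l) powr (DIM('a) / 2))"
proof -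
  have *: "ennreal (exp (- l * (norm x)\<^sup>2)) = (\<Prod>b\<in>Basis. ennreal (exp (- l * (x \<bullet> b)\<^sup>2)))" for x :: 'a
  proof -
    have "(norm x)\<^sup>2 = (\<Sum>b\<in>Basis. (x \<bullet> b)\<^sup>2)"
      unfolding power2_norm_eq_inner by (subst euclidean_inner) (simp add: power2_eq_square)
    then show ?thesis
      by (simp add: exp_sum sum_distrib_left sum_negf[symmetric] prod_ennreal del: sum_negf)
  qed
  have "(\<integral>\<^sup>+x. ennreal (exp (- l * (norm x)\<^sup>2)) \<partial>(lborel :: 'a measure)) =
    (\<Prod>b\<in>(Basis :: 'a set). \<integral>\<^sup>+x. ennreal (exp (- l * x\<^sup>2)) \<partial>lborel)"
    unfolding * by (rule nn_integral_lborel_prod) auto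
  also have "\<dots> = ennreal (sqrt (pi / l) ^ DIM('a))"
    unfolding nn_integral_gaussian_real[OF assms] using assms by (simp add: ennreal_power)
  also have "sqrt (pi / l) ^ DIM('a) = (pi / l) powr (DIM('a) / 2)"
    using assms by (simp add: powr_half_sqrt[symmetric] powr_realpow[symmetric] powr_powr)
  finally show ?thesis .
qed

lemma nn_integral_pad_gaussian:
  fixes l :: "'i::finite \<Rightarrow> real"
  assumes "finite S" "\<And>i. i \<in> S \<Longrightarrow> l i > 0"
  shows "(\<integral>\<^sup>+x. ennreal (exp (- (\<Sum>i\<in>S. l i * (norm (x $ i))\<^sup>2))) \<partial>pad (lborel :: 'a::euclidean_space measure) S a) =
    ennreal (\<Prod>i\<in>S. (pi / l i) powr (DIM('a) / 2))"
  using assms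
proof (induction S rule: finite_induct)
  case empty
  then show ?case
    by (subst borel_sigma_finite.nn_integral_pad_empty[OF borel_sigma_finite_lborel]) auto
next
  case (insert s S)
  have *: "ennreal (exp (- (\<Sum>i\<in>insert s S. l i * (norm (vec_upd x s y $ i))\<^sup>2))) =
    ennreal (exp (- (\<Sum>i\<in>S. l i * (norm (x $ i))\<^sup>2))) * ennreal (exp (- l s * (norm y)\<^sup>2))" for x :: "'a ^ 'i" and y
  proof -
    have "(\<Sum>i\<in>S. l i * (norm (vec_upd x s y $ i))\<^sup>2) = (\<Sum>i\<in>S. l i * (norm (x $ i))\<^sup>2)"
      using insert.hyps by (intro sum.cong) auto
    then show ?thesis
      using insert.hyps by (simp add: ennreal_mult[symmetric] exp_add[symmetric] exp_diff exp_minus divide_inverse mult.commute)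
  qed
  have "(\<integral>\<^sup>+x. ennreal (exp (- (\<Sum>i\<in>insert s S. l i * (norm (x $ i))\<^sup>2))) \<partial>pad (lborel :: 'a measure) (insert s S) a)
    = (\<integral>\<^sup>+x. \<integral>\<^sup>+y. ennreal (exp (- (\<Sum>i\<in>S. l i * (norm (x $ i))\<^sup>2))) * ennreal (exp (- l s * (norm y)\<^sup>2)) \<partial>(lborel :: 'a measure) \<partial>pad lborel S a)"
    using insert.hyps unfolding *[symmetric]
    by (intro borel_sigma_finite.nn_integral_pad_insert[OF borel_sigma_finite_lborel]) auto
  also have "\<dots> = ennreal (\<Prod>i\<in>S. (pi / l i) powr (DIM('a) / 2)) * ennreal ((pi / l s) powr (DIM('a) / 2))"
    using insert by (subst nn_integral_cmult, simp, subst nn_integral_gaussian) (simp_all add: nn_integral_multc)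
  also have "\<dots> = ennreal (\<Prod>i\<in>insert s S. (pi / l i) powr (DIM('a) / 2))"
    using insert by (simp add: ennreal_mult[symmetric] prod_nonneg mult.commute)
  finally show ?case .
qed

section \<open>Isometries and the squared length\<close>

lemma linear_borel_measurable [measurable (raw)]:
  fixes U :: "'a::euclidean_space \<Rightarrow> 'b::euclidean_space"
  assumes "linear U" shows "U \<in> borel_measurable borel"
  by (intro borel_measurable_continuous_onI linear_continuous_on linear_conv_bounded_linear[THEN iffD1] assms)

lemma norm_vec_restrict:
  assumes "\<And>i. i \<notin> R \<Longrightarrow> x $ i = 0"
  shows "(norm x)\<^sup>2 = (\<Sum>i\<in>R. (norm (x $ i))\<^sup>2)"
proof -
  have "(norm x)\<^sup>2 = (\<Sum>i\<in>UNIV. (norm (x $ i))\<^sup>2)"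
    by (simp add: norm_vec_def L2_set_def sum_nonneg)
  also have "\<dots> = (\<Sum>i\<in>R. (norm (x $ i))\<^sup>2)"
    using assms by (intro sum.mono_neutral_right) auto
  finally show ?thesis .
qed

lemma nn_integral_pad_gaussian_norm:
  "(\<integral>\<^sup>+x. ennreal (exp (- (norm x)\<^sup>2)) \<partial>pad lborel R (0 :: 'a::euclidean_space ^ 'i)) =
    ennreal (pi powr (DIM('a) * card R / 2))"
proof -
  interpret borel_sigma_finite "lborel :: 'a measure" by (rule borel_sigma_finite_lborel)
  have "(\<integral>\<^sup>+x. ennreal (exp (- (norm x)\<^sup>2)) \<partial>pad lborel R (0 :: 'a ^ 'i)) =
    (\<integral>\<^sup>+x. ennreal (exp (- (\<Sum>i\<in>R. 1 * (norm (x $ i))\<^sup>2))) \<partial>pad (lborel :: 'a measure) R 0)"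
    by (rule nn_integral_pad_cong) (simp add: norm_vec_restrict[of R])
  also have "\<dots> = ennreal (\<Prod>i\<in>R. (pi / 1) powr (DIM('a) / 2))"
    by (rule nn_integral_pad_gaussian) auto
  also have "(\<Prod>i\<in>R. (pi / 1) powr (DIM('a) / 2)) = pi powr (DIM('a) * card R / 2)"
    by (simp add: powr_realpow[symmetric] powr_powr mult.commute)
  finally show ?thesis .
qed

text \<open>
  Invariance under isometries is the uniqueness argument for Haar measure: pair
  \<open>f (U x)\<close> with a Gaussian in an independent variable \<open>y\<close>, shift \<open>x\<close> by \<open>V y\<close> and
  then \<open>y\<close> by \<open>- U x\<close>, which moves the isometry onto the Gaussian.
\<close>

lemma nn_integral_pad_isometry:
  fixes f :: "'a::euclidean_space ^ 'i \<Rightarrow> ennreal" and U V :: "'a ^ 'i \<Rightarrow> 'a ^ 'i"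
  assumes f [measurable]: "f \<in> borel_measurable borel"
    and U: "linear U" and V: "linear V" and UV: "\<And>x. U (V x) = x" "\<And>x. V (U x) = x"
    and nU: "\<And>x. norm (U x) = norm x"
    and RU: "\<And>x i. (\<And>i. i \<notin> R \<Longrightarrow> x $ i = 0) \<Longrightarrow> i \<notin> R \<Longrightarrow> U x $ i = 0"
    and RV: "\<And>x i. (\<And>i. i \<notin> R \<Longrightarrow> x $ i = 0) \<Longrightarrow> i \<notin> R \<Longrightarrow> V x $ i = 0"
  shows "(\<integral>\<^sup>+x. f (U x) \<partial>pad lborel R 0) = (\<integral>\<^sup>+x. f x \<partial>pad lborel R 0)"
proof -
  interpret L: borel_sigma_finite "lborel :: 'a measure" by (rule borel_sigma_finite_lborel)
  define \<mu> where "\<mu> = pad lborel R (0 :: 'a ^ 'i)"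
  interpret borel_sigma_finite \<mu>
    unfolding \<mu>_def by (rule L.borel_sigma_finite_pad)
  note mu = borel_sigma_finite_axioms
  note [measurable] = linear_borel_measurable[OF U] linear_borel_measurable[OF V]
  define \<phi> :: "'a ^ 'i \<Rightarrow> ennreal" where "\<phi> x = ennreal (exp (- (norm x)\<^sup>2))" for x
  have \<phi> [measurable]: "\<phi> \<in> borel_measurable borel" unfolding \<phi>_def by measurable
  have \<phi>U: "\<phi> (U x) = \<phi> x" for x by (simp add: \<phi>_def nU)
  have \<phi>m: "\<phi> (- x) = \<phi> x" for x by (simp add: \<phi>_def)
  have G: "(\<integral>\<^sup>+x. \<phi> x \<partial>\<mu>) = ennreal (pi powr (DIM('a) * card R / 2))"
    unfolding \<phi>_def \<mu>_def by (rule nn_integral_pad_gaussian_norm)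
  have cong: "(\<integral>\<^sup>+x. g x \<partial>\<mu>) = (\<integral>\<^sup>+x. h x \<partial>\<mu>)"
    if "\<And>x. (\<And>i. i \<notin> R \<Longrightarrow> x $ i = 0) \<Longrightarrow> g x = h x" for g h
    unfolding \<mu>_def by (rule L.nn_integral_pad_cong) (use that in auto)
  have trans: "(\<integral>\<^sup>+x. g (x + t) \<partial>\<mu>) = (\<integral>\<^sup>+x. g x \<partial>\<mu>)"
    if "g \<in> borel_measurable borel" "\<And>i. i \<notin> R \<Longrightarrow> t $ i = 0" for g t
    unfolding \<mu>_def by (rule nn_integral_pad_lborel_translate) (use that in auto)
  have add: "U (x + V y) = U x + y" for x y
    using UV by (simp add: linear_add[OF U])
  have "(\<integral>\<^sup>+x. f (U x) \<partial>\<mu>) * (\<integral>\<^sup>+y. \<phi> y \<partial>\<mu>) = (\<integral>\<^sup>+x. \<integral>\<^sup>+y. f (U x) * \<phi> y \<partial>\<mu> \<partial>\<mu>)"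
    by (simp add: nn_integral_cmult nn_integral_multc)
  also have "\<dots> = (\<integral>\<^sup>+y. \<integral>\<^sup>+x. f (U x) * \<phi> y \<partial>\<mu> \<partial>\<mu>)"
    by (rule Fubini[OF mu]) measurable
  \<comment> \<open>Translation invariance is available only for shifts supported on
    \<open>R\<close>. By \<open>cong\<close> it is enough to take \<open>y\<close> supported there,
    and \<open>RV\<close> keeps \<open>V y\<close> there.\<close>
  also have "\<dots> = (\<integral>\<^sup>+y. \<integral>\<^sup>+x. f (U x + y) * \<phi> y \<partial>\<mu> \<partial>\<mu>)"
  proof (rule cong)
    fix y :: "'a ^ 'i" assume y: "\<And>i. i \<notin> R \<Longrightarrow> y $ i = 0"
    show "(\<integral>\<^sup>+x. f (U x) * \<phi> y \<partial>\<mu>) = (\<integral>\<^sup>+x. f (U x + y) * \<phi> y \<partial>\<mu>)"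
      using trans[of "\<lambda>x. f (U x) * \<phi> y" "V y"] y by (simp add: add RV)
  qed
  also have "\<dots> = (\<integral>\<^sup>+x. \<integral>\<^sup>+y. f (U x + y) * \<phi> y \<partial>\<mu> \<partial>\<mu>)"
    by (rule Fubini[OF mu]) measurable
  also have "\<dots> = (\<integral>\<^sup>+x. \<integral>\<^sup>+y. f y * \<phi> (y - U x) \<partial>\<mu> \<partial>\<mu>)"
  proof (rule cong)
    fix x :: "'a ^ 'i" assume x: "\<And>i. i \<notin> R \<Longrightarrow> x $ i = 0"
    show "(\<integral>\<^sup>+y. f (U x + y) * \<phi> y \<partial>\<mu>) = (\<integral>\<^sup>+y. f y * \<phi> (y - U x) \<partial>\<mu>)"
      using trans[of "\<lambda>y. f y * \<phi> (y - U x)" "U x"] x by (simp add: RU add.commute)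
  qed
  also have "\<dots> = (\<integral>\<^sup>+y. \<integral>\<^sup>+x. f y * \<phi> (y - U x) \<partial>\<mu> \<partial>\<mu>)"
    by (rule Fubini[OF mu]) measurable
  also have "\<dots> = (\<integral>\<^sup>+y. f y * (\<integral>\<^sup>+x. \<phi> x \<partial>\<mu>) \<partial>\<mu>)"
  proof (rule cong)
    fix y :: "'a ^ 'i" assume y: "\<And>i. i \<notin> R \<Longrightarrow> y $ i = 0"
    have "y - U x = - U (x + V (- y))" for x
      using add[of x "- y"] by simp
    then have "\<phi> (y - U x) = \<phi> (x + V (- y))" for x
      by (simp only: \<phi>m \<phi>U)
    moreover have "(\<integral>\<^sup>+x. \<phi> (x + V (- y)) \<partial>\<mu>) = (\<integral>\<^sup>+x. \<phi> x \<partial>\<mu>)"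
      using y by (intro trans RV) auto
    ultimately show "(\<integral>\<^sup>+x. f y * \<phi> (y - U x) \<partial>\<mu>) = f y * (\<integral>\<^sup>+x. \<phi> x \<partial>\<mu>)"
      by (simp add: nn_integral_cmult)
  qed
  also have "\<dots> = (\<integral>\<^sup>+y. f y \<partial>\<mu>) * (\<integral>\<^sup>+x. \<phi> x \<partial>\<mu>)"
    by (simp add: nn_integral_multc)
  finally have "(\<integral>\<^sup>+x. f (U x) \<partial>\<mu>) * ennreal (pi powr (DIM('a) * card R / 2)) =
      (\<integral>\<^sup>+y. f y \<partial>\<mu>) * ennreal (pi powr (DIM('a) * card R / 2))"
    unfolding G .
  then have "ennreal (pi powr (DIM('a) * card R / 2)) * (\<integral>\<^sup>+x. f (U x) \<partial>\<mu>) =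
      ennreal (pi powr (DIM('a) * card R / 2)) * (\<integral>\<^sup>+y. f y \<partial>\<mu>)"
    by (simp only: mult.commute)
  \<comment> \<open>The Gaussian mass is positive and finite, so it may be cancelled in
    \<open>ennreal\<close>.\<close>
  then show ?thesis
    by (subst (asm) ennreal_mult_cancel_left) (simp_all add: \<mu>_def)
qed

lemma nn_integral_powr_from_0:
  assumes "t \<ge> 0" "a > 0"
  shows "(\<integral>\<^sup>+s. ennreal (s powr (a - 1)) * indicator {0<..t} s \<partial>lborel) = ennreal (t powr a / a)"
proof -
  have "(\<integral>\<^sup>+s. ennreal (s powr (a - 1)) * indicator {0..t} s \<partial>lborel) = ennreal (t powr (a - 1 + 1) / (a - 1 + 1))"
    using has_integral_powr_from_0[of "a - 1" t] assms
    by (intro nn_integral_has_integral_lebesgue') auto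
  moreover have "(\<integral>\<^sup>+s. ennreal (s powr (a - 1)) * indicator {0<..t} s \<partial>lborel) =
    (\<integral>\<^sup>+s. ennreal (s powr (a - 1)) * indicator {0..t} s \<partial>lborel)"
    by (rule nn_integral_cong_AE, rule AE_mp[OF AE_lborel_singleton[of 0]], rule AE_I2)
       (simp add: indicator_def)
  ultimately show ?thesis by simp
qed

lemma nn_integral_Gamma:
  assumes "a > 0"
  shows "(\<integral>\<^sup>+s. ennreal (s powr (a - 1) * exp (- s)) * indicator {0<..} s \<partial>lborel) = ennreal (Gamma a)"
proof -
  have "(\<integral>\<^sup>+s. ennreal (s powr (a - 1) / exp s) * indicator {0..} s \<partial>lborel) = ennreal (Gamma a)"
    using Gamma_integral_real[OF assms] by (intro nn_integral_has_integral_lebesgue') auto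
  moreover have "(\<integral>\<^sup>+s. ennreal (s powr (a - 1) * exp (- s)) * indicator {0<..} s \<partial>lborel) =
    (\<integral>\<^sup>+s. ennreal (s powr (a - 1) / exp s) * indicator {0..} s \<partial>lborel)"
    by (rule nn_integral_cong_AE, rule AE_mp[OF AE_lborel_singleton[of 0]], rule AE_I2)
       (simp add: indicator_def exp_minus divide_inverse)
  ultimately show ?thesis by simp
qed

text \<open>The law of the squared length is determined up to a factor by homogeneity, and the
  factor by the Gaussian integral.\<close>

lemma nn_integral_pad_sq_length:
  fixes f :: "real \<Rightarrow> ennreal" and R :: "'i::finite set"
  assumes [measurable]: "f \<in> borel_measurable borel" and R: "R \<noteq> {}"
  defines "h \<equiv> DIM('a) * card R / 2"
  shows "(\<integral>\<^sup>+x. f (\<Sum>i\<in>R. (norm (x $ i))\<^sup>2) \<partial>pad lborel R (0 :: 'a::euclidean_space ^ 'i)) =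
    (\<integral>\<^sup>+t. f t * (ennreal (pi powr h / Gamma h * t powr (h - 1)) * indicator {0<..} t) \<partial>lborel)"
proof -
  interpret L: borel_sigma_finite "lborel :: 'a measure" by (rule borel_sigma_finite_lborel)
  define \<mu> where "\<mu> = pad lborel R (0 :: 'a ^ 'i)"
  have [measurable_cong, simp]: "sets \<mu> = sets borel" and [simp]: "space \<mu> = UNIV"
    by (simp_all add: \<mu>_def)
  define q :: "'a ^ 'i \<Rightarrow> real" where "q x = (\<Sum>i\<in>R. (norm (x $ i))\<^sup>2)" for x
  have [measurable]: "q \<in> borel_measurable borel" unfolding q_def by measurable
  have q0: "q x \<ge> 0" for x unfolding q_def by (simp add: sum_nonneg)
  have h: "h > 0" using R by (simp add: h_def card_gt_0_iff DIM_positive)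
  define V where "V = emeasure \<mu> {x. q x \<le> 1}"
  have gauss: "(\<integral>\<^sup>+x. ennreal (exp (- q x)) \<partial>\<mu>) = ennreal (pi powr h)"
    unfolding h_def \<mu>_def nn_integral_pad_gaussian_norm[symmetric]
    by (rule L.nn_integral_pad_cong) (simp add: norm_vec_restrict[of R] q_def)
  \<comment> \<open>Finiteness of the volume of the unit ball: its indicator is at most e times the
    Gaussian.\<close>
  have "V = (\<integral>\<^sup>+x. indicator {x. q x \<le> 1} x \<partial>\<mu>)" by (simp add: V_def)
  also have "\<dots> \<le> (\<integral>\<^sup>+x. ennreal (exp 1) * ennreal (exp (- q x)) \<partial>\<mu>)"
    by (intro nn_integral_mono) (auto simp: indicator_def ennreal_mult[symmetric] exp_add[symmetric] ennreal_ge_1)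
  also have "\<dots> < \<infinity>" by (simp add: nn_integral_cmult gauss ennreal_mult_less_top)
  finally obtain v where v: "V = ennreal v" "v \<ge> 0" by (cases V) auto
  have pos: "emeasure \<mu> {x. q x \<le> t} = ennreal (t powr h * v)" if "t > 0" for t
  proof -
    have qs: "q (sqrt t *\<^sub>R x) = t * q x" for x
      using that by (simp add: q_def power_mult_distrib sum_distrib_left)
    have "emeasure \<mu> {x. q x \<le> t} = (\<integral>\<^sup>+x. indicator {x. q x \<le> t} x \<partial>\<mu>)" by simp
    also have "\<dots> = ennreal (\<bar>sqrt t\<bar> ^ (DIM('a) * card R)) * (\<integral>\<^sup>+x. indicator {x. q x \<le> t} (sqrt t *\<^sub>R x) \<partial>\<mu>)"
      unfolding \<mu>_def using that by (intro nn_integral_pad_lborel_scale) auto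
    also have "(\<lambda>x. indicator {x. q x \<le> t} (sqrt t *\<^sub>R x) :: ennreal) = indicator {x. q x \<le> 1}"
      using that by (auto simp: indicator_def fun_eq_iff qs)
    also have "(\<integral>\<^sup>+x. indicator {x. q x \<le> 1} x \<partial>\<mu>) = V" by (simp add: V_def)
    also have "\<bar>sqrt t\<bar> ^ (DIM('a) * card R) = t powr h"
      using that by (simp add: powr_half_sqrt[symmetric] powr_realpow[symmetric] powr_powr h_def)
    finally show ?thesis using v by (simp add: ennreal_mult)
  qed
  \<comment> \<open>The set lies in the balls \<open>q x \<le> s\<close> for all positive
    \<open>s\<close>, whose measures tend to 0 because \<open>h\<close> is positive.\<close>
  have neg: "emeasure \<mu> {x. q x \<le> t} = 0" if "t \<le> 0" for t
  proof -
    have "emeasure \<mu> {x. q x \<le> t} \<le> ennreal (s powr h * v)" if "s > 0" for s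
      unfolding pos[OF that, symmetric] using that \<open>t \<le> 0\<close> by (intro emeasure_mono) auto
    moreover have "((\<lambda>s. ennreal (s powr h * v)) \<longlongrightarrow> ennreal (0 powr h * v)) (at_right 0)"
      using h by (intro tendsto_ennrealI tendsto_mult tendsto_const tendsto_powr2 tendsto_ident_at)
        (simp_all add: eventually_at_filter)
    ultimately have "emeasure \<mu> {x. q x \<le> t} \<le> ennreal (0 powr h * v)"
      by (intro tendsto_lowerbound[where F = "at_right (0::real)"])
         (auto intro!: eventually_at_rightI[of 0 1])
    then show ?thesis by simp
  qed
  define \<nu> where "\<nu> = density lborel (\<lambda>t. ennreal (v * h * t powr (h - 1)) * indicator {0<..} t)"
  have \<nu>: "emeasure \<nu> {..t} = (if t > 0 then ennreal (t powr h * v) else 0)" for t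
  proof -
    have "emeasure \<nu> {..t} = (\<integral>\<^sup>+s. ennreal (v * h) * (ennreal (s powr (h - 1)) * indicator {0<..t} s) \<partial>lborel)"
      unfolding \<nu>_def using v h
      by (subst emeasure_density) (auto intro!: nn_integral_cong simp: indicator_def ennreal_mult)
    also have "\<dots> = ennreal (v * h) * (\<integral>\<^sup>+s. ennreal (s powr (h - 1)) * indicator {0<..t} s \<partial>lborel)"
      by (rule nn_integral_cmult) simp
    also have "\<dots> = (if t > 0 then ennreal (t powr h * v) else 0)"
    proof (cases "t > 0")
      case True
      then show ?thesis
        using v h by (simp only: nn_integral_powr_from_0[OF less_imp_le[OF True] h])
          (simp add: ennreal_mult[symmetric] mult.commute)
    qed simp
    finally show ?thesis .
  qed
  have eq: "distr \<mu> borel q = \<nu>"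
  proof (rule measure_eqI_generator_eq[where E = "range (\<lambda>t. {..t})" and \<Omega> = UNIV and A = "\<lambda>n. {..real n}"])
    show "Int_stable (range (\<lambda>t::real. {..t}))"
      by (auto simp: Int_stable_def)
    show "sets (distr \<mu> borel q) = sigma_sets UNIV (range (\<lambda>t::real. {..t}))"
      "sets \<nu> = sigma_sets UNIV (range (\<lambda>t::real. {..t}))"
      by (simp_all add: \<nu>_def borel_eq_atMost)
    have D: "emeasure (distr \<mu> borel q) {..t} = emeasure \<mu> {x. q x \<le> t}" for t
      by (simp add: emeasure_distr vimage_def)
    show "emeasure (distr \<mu> borel q) X = emeasure \<nu> X" if "X \<in> range (\<lambda>t::real. {..t})" for X
      using that pos neg by (auto simp: \<nu> D)
    show "(\<Union>n. {..real n}) = UNIV" using real_arch_simple by auto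
    show "emeasure (distr \<mu> borel q) {..real n} \<noteq> \<infinity>" for n
      unfolding D using pos[of n] neg[of n] by (cases "n = 0") auto
  qed auto
  have int: "(\<integral>\<^sup>+x. g (q x) \<partial>\<mu>) = (\<integral>\<^sup>+t. g t * (ennreal (v * h * t powr (h - 1)) * indicator {0<..} t) \<partial>lborel)"
    if [measurable]: "g \<in> borel_measurable borel" for g :: "real \<Rightarrow> ennreal"
  proof -
    have "(\<integral>\<^sup>+x. g (q x) \<partial>\<mu>) = (\<integral>\<^sup>+t. g t \<partial>distr \<mu> borel q)"
      by (simp add: nn_integral_distr)
    then show ?thesis
      unfolding eq \<nu>_def by (simp add: nn_integral_density mult.commute)
  qed
  \<comment> \<open>The test function exp(-t) determines the ball volume \<open>v\<close>: one side
    is the Gaussian integral, the other a Gamma integral.\<close>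
  have "ennreal (pi powr h) = (\<integral>\<^sup>+t. ennreal (v * h) * (ennreal (t powr (h - 1) * exp (- t)) * indicator {0<..} t) \<partial>lborel)"
    unfolding gauss[symmetric] using v h
    by (subst int[of "\<lambda>t. ennreal (exp (- t))"])
       (auto intro!: nn_integral_cong simp: ennreal_mult[symmetric] mult_ac indicator_def)
  also have "\<dots> = ennreal (v * h * Gamma h)"
    using v h by (subst nn_integral_cmult) (auto simp: nn_integral_Gamma ennreal_mult[symmetric] Gamma_real_pos less_imp_le)
  finally have "pi powr h = v * h * Gamma h"
    using v h by (subst (asm) ennreal_inj) (auto simp: Gamma_real_pos less_imp_le)
  then have "v * h = pi powr h / Gamma h"
    using Gamma_real_pos[OF h] by (simp add: field_simps)
  then show ?thesis
    using int[of f] by (simp add: q_def \<mu>_def)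
qed

section \<open>Spectral theorem\<close>

lemma hconj_simps [simp]:
  fixes x y :: "'f::conj_div_algebra"
  shows "hconj (x + y) = hconj x + hconj y" "hconj (x - y) = hconj x - hconj y"
    "hconj (- x) = - hconj x" "hconj (r *\<^sub>R x) = r *\<^sub>R hconj x" "hconj 0 = (0 :: 'f)"
    "hconj (hconj x) = x" "hconj 1 = (1 :: 'f)" "hconj (of_real r) = (of_real r :: 'f)"
proof -
  have one: "inner (1 :: 'f) 1 = 1" by (simp add: norm_eq_sqrt_inner[symmetric] flip: norm_eq_1)
  show "hconj (x + y) = hconj x + hconj y" "hconj (x - y) = hconj x - hconj y"
    "hconj (- x) = - hconj x" "hconj (r *\<^sub>R x) = r *\<^sub>R hconj x" "hconj 0 = (0 :: 'f)"
    by (simp_all add: hconj_eq inner_add_left inner_diff_left algebra_simps)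
  show "hconj (hconj x) = x" "hconj 1 = (1 :: 'f)" "hconj (of_real r) = (of_real r :: 'f)"
    by (simp_all add: hconj_eq inner_diff_left one of_real_def algebra_simps scaleR_2 flip: scaleR_left.add scaleR_left.diff)
qed

lemma hconj_sum [simp]: "hconj (\<Sum>i\<in>A. f i) = (\<Sum>i\<in>A. hconj (f i :: 'f::conj_div_algebra))"
  by (induction A rule: infinite_finite_induct) auto

lemma norm_hconj [simp]: "norm (hconj x) = norm (x :: 'f::conj_div_algebra)"
proof (cases "x = 0")
  case False
  have "norm x * norm (hconj x) = (norm x)\<^sup>2"
    unfolding norm_mult[symmetric] by (simp add: mult_hconj)
  with False show ?thesis by (simp add: power2_eq_square)
qed simp

lemma hconj_mult_self: "hconj x * x = (norm (x :: 'f::conj_div_algebra))\<^sup>2 *\<^sub>R 1"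
  using mult_hconj[of "hconj x"] by simp

lemma re_part_linear [simp]:
  fixes x y :: "'f::conj_div_algebra"
  shows "re_part (x + y) = re_part x + re_part y" "re_part (x - y) = re_part x - re_part y"
  "re_part (r *\<^sub>R x) = r * re_part x" "re_part (- x) = - re_part x"
  "re_part (0 :: 'f) = 0" "re_part (1 :: 'f) = 1"
  "re_part (hconj x) = re_part x" "re_part (of_real r :: 'f) = r"
proof -
  have one: "inner (1 :: 'f) 1 = 1" by (simp add: norm_eq_sqrt_inner[symmetric] flip: norm_eq_1)
  show "re_part (x + y) = re_part x + re_part y" "re_part (x - y) = re_part x - re_part y"
    "re_part (r *\<^sub>R x) = r * re_part x" "re_part (- x) = - re_part x" "re_part (0 :: 'f) = 0"
    "re_part (1 :: 'f) = 1"
    "re_part (hconj x) = re_part x" "re_part (of_real r :: 'f) = r"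
    by (simp_all add: re_part_def hconj_eq inner_add_left inner_diff_left of_real_def one)
qed

lemma re_part_sum [simp]: "re_part (\<Sum>i\<in>A. f i) = (\<Sum>i\<in>A. re_part (f i :: 'f::conj_div_algebra))"
  by (induction A rule: infinite_finite_induct) auto

lemma hconj_self_iff: "hconj x = x \<longleftrightarrow> x = of_real (re_part (x :: 'f::conj_div_algebra))"
proof
  assume "hconj x = x"
  then have "2 *\<^sub>R x = 2 *\<^sub>R of_real (re_part x)"
    by (simp add: hconj_eq re_part_def of_real_def scaleR_2 algebra_simps flip: scaleR_left.add)
  then show "x = of_real (re_part x)" by simp
qed (metis hconj_simps(8))

text \<open>Polarisation of \<open>hconj z * z = |z|^2\<close>, which covers all three algebras
  without coordinates.\<close>

lemma re_part_hconj_mult: "re_part (hconj x * y) = inner x (y :: 'f::conj_div_algebra)"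
proof -
  have sq: "re_part (hconj z * z) = inner z z" for z :: 'f
    by (simp add: hconj_mult_self power2_norm_eq_inner)
  have "re_part (hconj y * x) = re_part (hconj (hconj x * y))"
    by (simp only: hconj_mult hconj_simps)
  then have "re_part (hconj y * x) = re_part (hconj x * y)"
    by simp
  then show ?thesis
    using sq[of "x + y"] sq[of x] sq[of y]
    by (simp add: algebra_simps inner_add_left inner_add_right inner_commute)
qed

definition hdot :: "'f::conj_div_algebra ^ 'i \<Rightarrow> 'f ^ 'i \<Rightarrow> 'f" where
  "hdot x y = (\<Sum>i\<in>UNIV. hconj (x $ i) * y $ i)"

text \<open>Scalars act on the right, so that they commute with matrices acting on the left even
  over the quaternions. Correspondingly \<open>hdot\<close> is linear in its second argument for
  this action.\<close>

definition rscale :: "'f::conj_div_algebra ^ 'i \<Rightarrow> 'f \<Rightarrow> 'f ^ 'i" where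
  "rscale x q = (\<chi> i. x $ i * q)"

lemma re_part_hdot: "re_part (hdot x y) = inner x y"
  by (simp add: hdot_def inner_vec_def re_part_hconj_mult)

lemma hdot_simps [simp]:
  "hdot (x + y) z = hdot x z + hdot y z" "hdot z (x + y) = hdot z x + hdot z y"
  "hdot (x - y) z = hdot x z - hdot y z" "hdot z (x - y) = hdot z x - hdot z y"
  "hdot (r *\<^sub>R x) z = r *\<^sub>R hdot x z" "hdot z (r *\<^sub>R x) = r *\<^sub>R hdot z x"
  "hdot 0 z = 0" "hdot z 0 = 0"
  "hdot (rscale x q) z = hconj q * hdot x z" "hdot z (rscale x q) = hdot z x * q"
  by (simp_all add: hdot_def rscale_def algebra_simps sum.distrib sum_subtractf
      scaleR_sum_right hconj_mult sum_distrib_left sum_distrib_right)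

lemma hdot_sum [simp]:
  "hdot (\<Sum>i\<in>A. f i) z = (\<Sum>i\<in>A. hdot (f i) z)" "hdot z (\<Sum>i\<in>A. f i) = (\<Sum>i\<in>A. hdot z (f i))"
  by (induction A rule: infinite_finite_induct; simp)+

lemma hconj_hdot: "hconj (hdot x y) = hdot y x"
  by (simp add: hdot_def hconj_mult)

lemma hdot_self: "hdot x x = of_real ((norm x)\<^sup>2)"
  using hconj_hdot[of x x] unfolding hconj_self_iff by (simp add: re_part_hdot power2_norm_eq_inner)

lemma matrix_vector_mult_simps:
  fixes A :: "'f::conj_div_algebra ^ 'n ^ 'm"
  shows "A *v (r *\<^sub>R x) = r *\<^sub>R (A *v x)" "A *v rscale x q = rscale (A *v x) q"
  by (simp_all add: matrix_vector_mult_def rscale_def vec_eq_iff scaleR_sum_right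
      sum_distrib_right mult.assoc)

lemma linear_matrix_vector_mult: "linear ((*v) (A :: 'f::conj_div_algebra ^ 'n ^ 'm))"
  by (rule linearI) (simp_all add: matrix_vector_mult_simps matrix_vector_right_distrib)

lemma hermitian_iff: "hermitian A \<longleftrightarrow> (\<forall>i j. hconj (A $ j $ i) = A $ i $ j)"
  by (simp add: hermitian_def adjoint_mat_def vec_eq_iff)

lemma hdot_hermitian:
  assumes "hermitian A" shows "hdot (A *v x) y = hdot x (A *v y)"
proof -
  have "hdot (A *v x) y = (\<Sum>i\<in>UNIV. \<Sum>j\<in>UNIV. hconj (x $ j) * hconj (A $ i $ j) * y $ i)"
    by (simp add: hdot_def matrix_vector_mult_def sum_distrib_right hconj_mult)
  also have "\<dots> = (\<Sum>i\<in>UNIV. \<Sum>j\<in>UNIV. hconj (x $ j) * (A $ j $ i * y $ i))"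
    using assms by (simp add: hermitian_iff mult.assoc)
  also have "\<dots> = (\<Sum>j\<in>UNIV. \<Sum>i\<in>UNIV. hconj (x $ j) * (A $ j $ i * y $ i))"
    by (rule sum.swap)
  also have "\<dots> = hdot x (A *v y)"
    by (simp add: hdot_def matrix_vector_mult_def sum_distrib_left)
  finally show ?thesis .
qed

lemma inner_hermitian:
  assumes "hermitian A" shows "inner (A *v x) y = inner x (A *v y)"
  using hdot_hermitian[OF assms, of x y] by (metis re_part_hdot)

text \<open>For Hermitian \<open>A\<close> the value of the form is fixed by conjugation, hence
  real, hence equal to its real part. From here on positivity is a question about the real inner
  product.\<close>

lemma pos_def_iff:
  "A \<in> pos_def \<longleftrightarrow> hermitian A \<and> (\<forall>x. x \<noteq> 0 \<longrightarrow> 0 < inner x (A *v x))"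
proof -
  have "(\<exists>r>0. hdot x (A *v x) = of_real r) \<longleftrightarrow> 0 < inner x (A *v x)" if "hermitian A" for x
  proof -
    have "hconj (hdot x (A *v x)) = hdot x (A *v x)"
      using hdot_hermitian[OF that, of x x] by (simp add: hconj_hdot)
    then have "hdot x (A *v x) = of_real (inner x (A *v x))"
      unfolding hconj_self_iff re_part_hdot .
    then show ?thesis
      by (metis of_real_eq_iff)
  qed
  then show ?thesis
    by (auto simp: pos_def_def hdot_def[symmetric])
qed

text \<open>Maximise the Rayleigh quotient on the compact unit sphere of \<open>E\<close>; let
  \<open>l\<close> be the maximum, attained at \<open>v\<close>. Then \<open>B = l - A\<close> is
  positive semidefinite on \<open>E\<close> with \<open>inner v (B v) = 0\<close>, and a
  perturbation of \<open>v\<close> in the direction \<open>B v\<close> forces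
  \<open>B v = 0\<close>.\<close>

lemma hermitian_eigenvector:
  fixes A :: "'f::conj_div_algebra ^ 'n ^ 'n"
  assumes A: "hermitian A" and E: "subspace E" and inv: "\<And>x. x \<in> E \<Longrightarrow> A *v x \<in> E"
    and nz: "x0 \<in> E" "x0 \<noteq> 0"
  obtains v l where "v \<in> E" "norm v = 1" "A *v v = l *\<^sub>R v"
proof -
  define K where "K = sphere 0 1 \<inter> E"
  have "compact K" unfolding K_def using E by (intro compact_Int_closed closed_subspace) auto
  moreover have "x0 /\<^sub>R norm x0 \<in> K"
    using nz subspace_scale[OF E nz(1)] by (simp add: K_def)
  then have "K \<noteq> {}" by auto
  moreover have "continuous_on K (\<lambda>x. inner x (A *v x))"
    using linear_continuous_on[of "(*v) A"] linear_matrix_vector_mult[of A]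
    by (auto intro!: continuous_intros simp: linear_conv_bounded_linear)
  ultimately obtain v where v: "v \<in> K" and max: "\<And>y. y \<in> K \<Longrightarrow> inner y (A *v y) \<le> inner v (A *v v)"
    using continuous_attains_sup by metis
  define l where "l = inner v (A *v v)"
  have vE: "v \<in> E" and nv: "norm v = 1" using v by (auto simp: K_def)
  have le: "inner y (A *v y) \<le> l * (norm y)\<^sup>2" if "y \<in> E" for y
  proof (cases "y = 0")
    case False
    then have "y /\<^sub>R norm y \<in> K" using that subspace_scale[OF E] by (simp add: K_def)
    from max[OF this] have "inner y (A *v y) / (norm y)\<^sup>2 \<le> l"
      by (simp add: l_def matrix_vector_mult_simps power2_eq_square divide_inverse mult_ac)
    then show ?thesis using False by (simp add: field_simps)
  qed simp
  define B where "B x = l *\<^sub>R x - A *v x" for x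
  have BE: "B x \<in> E" if "x \<in> E" for x
    unfolding B_def using that inv by (intro subspace_diff subspace_scale E) auto
  have B0: "inner v (B v) = 0"
    using nv by (simp add: B_def inner_diff_right l_def power2_norm_eq_inner[symmetric])
  have psd: "0 \<le> inner y (B y)" if "y \<in> E" for y
    using le[OF that] by (simp add: B_def inner_diff_right power2_norm_eq_inner)
  have Badd: "B (x + t *\<^sub>R y) = B x + t *\<^sub>R B y" for x y t
    by (simp add: B_def matrix_vector_right_distrib matrix_vector_mult_simps algebra_simps)
  have Bsym: "inner x (B y) = inner (B x) y" for x y
    using inner_hermitian[OF A, of x y] by (simp add: B_def inner_diff_right inner_diff_left)
  define y where "y = B v"
  have yE: "y \<in> E" unfolding y_def using BE vE by simp
  define a where "a = inner y y"
  define b where "b = inner y (B y)"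
  have a0: "a \<ge> 0" by (simp add: a_def)
  have b0: "b \<ge> 0" unfolding b_def by (rule psd[OF yE])
  have quad: "0 \<le> 2 * t * a + t\<^sup>2 * b" for t
  proof -
    have "v + t *\<^sub>R y \<in> E" using vE yE E by (intro subspace_add subspace_scale)
    from psd[OF this] have "0 \<le> inner (v + t *\<^sub>R y) (B (v + t *\<^sub>R y))" .
    also have "\<dots> = inner v (B v) + t * inner v (B y) + t * inner y (B v) + t * t * inner y (B y)"
      by (simp add: Badd inner_add_left inner_add_right algebra_simps)
    also have "inner v (B y) = a"
      by (simp add: Bsym[of v] a_def y_def)
    also have "inner y (B v) = a"
      by (simp add: a_def y_def)
    finally show ?thesis by (simp add: B0 b_def power2_eq_square mult.commute)
  qed
  have "a = 0"
  proof (rule ccontr)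
    assume "a \<noteq> 0"
    with a0 have "a > 0" by simp
    \<comment> \<open>\<open>t = - c\<close> makes \<open>2 * t * a + t\<^sup>2 * b\<close>
      negative; the 1 in the denominator guards against \<open>b = 0\<close>.\<close>
    define c where "c = a / (b + 1)"
    have ac: "a = c * (b + 1)" and "c > 0"
      using b0 \<open>a > 0\<close> by (simp_all add: c_def)
    have "0 \<le> 2 * (- c) * a + (- c)\<^sup>2 * b" by (rule quad)
    also have "\<dots> = c\<^sup>2 * (- 2 - b)"
      unfolding ac by (simp add: algebra_simps power2_eq_square)
    also have "\<dots> < 0" using \<open>c > 0\<close> b0 by (intro mult_pos_neg) auto
    finally show False by simp
  qed
  then have "B v = 0" by (simp add: a_def y_def)
  then have "A *v v = l *\<^sub>R v" by (simp add: B_def)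
  with vE nv show ?thesis by (rule that)
qed

text \<open>The next eigenvector is sought in the orthogonal complement \<open>E\<close> of those
  found so far, which is invariant because \<open>A\<close> is Hermitian. It is nonzero by a real
  dimension count: the earlier vectors times the basis scalars are at most
  \<open>card I * DIM('f)\<close> in number.\<close>

lemma hermitian_orthonormal_eigenvectors:
  fixes A :: "'f::conj_div_algebra ^ 'n ^ 'n"
  assumes A: "hermitian A" and "finite I"
  shows "\<exists>(w :: 'n \<Rightarrow> 'f ^ 'n) l. (\<forall>i\<in>I. A *v w i = l i *\<^sub>R w i) \<and>
    (\<forall>i\<in>I. \<forall>j\<in>I. hdot (w i) (w j) = (if i = j then 1 else 0))"
  using \<open>finite I\<close>
proof (induction I rule: finite_induct)
  case (insert s I)
  then obtain w :: "'n \<Rightarrow> 'f ^ 'n" and l where w: "\<And>i. i \<in> I \<Longrightarrow> A *v w i = l i *\<^sub>R w i"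
    "\<And>i j. i \<in> I \<Longrightarrow> j \<in> I \<Longrightarrow> hdot (w i) (w j) = (if i = j then 1 else 0)"
    by blast
  define E where "E = {x. \<forall>i\<in>I. hdot (w i) x = 0}"
  have E: "subspace E" by (auto simp: E_def subspace_def)
  have inv: "A *v x \<in> E" if "x \<in> E" for x
    using that by (auto simp: E_def hdot_hermitian[OF A, symmetric] w)
  define S where "S = (\<lambda>(i, b). rscale (w i) b) ` (I \<times> Basis)"
  have "card I < CARD('n)"
    using insert.hyps by (intro psubset_card_mono) auto
  have "dim (span S) \<le> card S"
    unfolding dim_span S_def using insert.hyps by (intro dim_le_card') auto
  also have "card S \<le> card I * DIM('f)"
    unfolding S_def using insert.hyps by (intro order.trans[OF card_image_le]) (auto simp: card_cartesian_product)
  also have "\<dots> < DIM('f ^ 'n)"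
    using \<open>card I < CARD('n)\<close> by simp
  finally have "dim S < DIM('f ^ 'n)" by simp
  then obtain x0 where x0: "x0 \<noteq> 0" "\<And>y. y \<in> span S \<Longrightarrow> orthogonal x0 y"
    using orthogonal_to_subspace_exists by blast
  \<comment> \<open>The real inner products of \<open>x0\<close> with \<open>rscale (w i) b\<close>,
    for \<open>b\<close> in the basis, are the real components of
    \<open>hdot (w i) x0\<close>.\<close>
  have "hdot (w i) x0 = 0" if "i \<in> I" for i
  proof -
    have "inner (hdot (w i) x0) b = 0" if "b \<in> Basis" for b
    proof -
      have "rscale (w i) b \<in> span S"
        unfolding S_def using \<open>i \<in> I\<close> that by (intro span_base) auto
      then have "inner (rscale (w i) b) x0 = 0"
        using x0(2) by (metis orthogonal_def inner_commute)
      then show ?thesis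
        by (simp add: re_part_hdot[symmetric] re_part_hconj_mult inner_commute)
    qed
    then show ?thesis using euclidean_all_zero_iff by blast
  qed
  then have "x0 \<in> E" by (simp add: E_def)
  from hermitian_eigenvector[OF A E inv this x0(1)] obtain v k
    where v: "v \<in> E" "norm v = 1" "A *v v = k *\<^sub>R v" .
  have vw: "hdot (w i) v = 0" "hdot v (w i) = 0" if "i \<in> I" for i
    using v(1) that hconj_hdot[of "w i" v] by (auto simp: E_def)
  show ?case
  proof (intro exI[of _ "w(s := v)"] exI[of _ "l(s := k)"] conjI ballI)
    show "A *v (w(s := v)) i = (l(s := k)) i *\<^sub>R (w(s := v)) i" if "i \<in> insert s I" for i
      using that v w by auto
    show "hdot ((w(s := v)) i) ((w(s := v)) j) = (if i = j then 1 else 0)"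
      if "i \<in> insert s I" "j \<in> insert s I" for i j
      using that v w vw hdot_self[of v] by auto
  qed
qed auto

lemma dim_coordinate_subspace:
  "dim {z :: 'f::euclidean_space ^ 'n. \<forall>i. i \<notin> J \<longrightarrow> z $ i = 0} = DIM('f) * card J"
proof -
  define d where "d = (\<lambda>(i, b). axis i b :: 'f ^ 'n) ` (J \<times> Basis)"
  have "{z :: 'f ^ 'n. \<forall>i. i \<notin> J \<longrightarrow> z $ i = 0} = {z. \<forall>b\<in>Basis. b \<notin> d \<longrightarrow> z \<bullet> b = 0}"
  proof (intro set_eqI iffI CollectI allI ballI impI; (elim CollectE)?)
    fix z b :: "'f ^ 'n" assume z: "\<forall>i. i \<notin> J \<longrightarrow> z $ i = 0" and b: "b \<in> Basis" "b \<notin> d"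
    from b obtain i c where "b = axis i c" "c \<in> Basis" "i \<notin> J" by (auto simp: Basis_vec_def d_def)
    with z show "z \<bullet> b = 0" by (simp add: inner_axis)
  next
    fix z :: "'f ^ 'n" and i assume z: "\<forall>b\<in>Basis. b \<notin> d \<longrightarrow> z \<bullet> b = 0" and i: "i \<notin> J"
    have "z $ i \<bullet> c = 0" if "c \<in> Basis" for c
    proof -
      have "axis i c \<in> (Basis :: ('f ^ 'n) set)" "axis i c \<notin> d"
        using that i by (auto simp: Basis_vec_def d_def axis_eq_axis)
      with z have "z \<bullet> axis i c = 0" by blast
      then show ?thesis by (simp add: inner_axis)
    qed
    then show "z $ i = 0" using euclidean_all_zero_iff by blast
  qed
  also have "dim \<dots> = card d"
    by (rule dim_substandard) (auto simp: d_def Basis_vec_def)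
  also have "card d = DIM('f) * card J"
  proof -
    have "inj_on (\<lambda>(i, b). axis i b :: 'f ^ 'n) (J \<times> Basis)"
      by (auto simp: inj_on_def axis_eq_axis)
    then show ?thesis by (simp add: d_def card_image card_cartesian_product)
  qed
  finally show ?thesis .
qed

text \<open>\<open>W\<close> is the unitary change to an eigenbasis. It carries coordinate subspaces
  onto eigenspaces, so the real dimension of an eigenspace is \<open>DIM('f)\<close> times the
  number of indices with that eigenvalue; grouping equal eigenvalues gives the product
  formula.\<close>

lemma pos_def_diagonalise:
  fixes A :: "'f::conj_div_algebra ^ 'n ^ 'n"
  assumes A: "A \<in> pos_def"
  obtains l :: "'n \<Rightarrow> real" and W :: "'f ^ 'n \<Rightarrow> 'f ^ 'n"
  where "\<And>i. l i > 0" "linear W" "bij W" "\<And>z. norm (W z) = norm z"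
    "\<And>z. A *v W z = W (\<chi> i. l i *\<^sub>R z $ i)" "eig_prod A = (\<Prod>i\<in>UNIV. l i)"
    "\<And>z. inner (W z) (A *v W z) = (\<Sum>i\<in>UNIV. l i * (norm (z $ i))\<^sup>2)"
proof -
  have hA: "hermitian A" and pA: "\<And>x. x \<noteq> 0 \<Longrightarrow> 0 < inner x (A *v x)"
    using A by (auto simp: pos_def_iff)
  obtain w :: "'n \<Rightarrow> 'f ^ 'n" and l where w: "\<And>i. A *v w i = l i *\<^sub>R w i"
    "\<And>i j. hdot (w i) (w j) = (if i = j then 1 else 0)"
    using hermitian_orthonormal_eigenvectors[OF hA, of UNIV] by auto
  have w1: "inner (w i) (w i) = 1" for i
    using arg_cong[OF w(2)[of i i], of re_part] by (simp add: re_part_hdot)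
  have l: "l i > 0" for i
    using pA[of "w i"] w1[of i] by (cases "w i = 0") (auto simp: w)
  define W where "W z = (\<Sum>i\<in>UNIV. rscale (w i) (z $ i))" for z
  have W: "linear W"
    by (rule linearI)
       (simp_all add: W_def rscale_def vec_eq_iff sum.distrib algebra_simps scaleR_sum_right)
  have WW: "hdot (W z) (W y) = hdot z y" for z y
  proof -
    have "hdot (W z) (W y) = (\<Sum>i\<in>UNIV. \<Sum>j\<in>UNIV. hconj (z $ i) * hdot (w i) (w j) * y $ j)"
      unfolding W_def hdot_sum(1) unfolding hdot_sum(2) by (simp add: mult.assoc)
    also have "\<dots> = (\<Sum>i\<in>UNIV. \<Sum>j\<in>UNIV. if i = j then hconj (z $ i) * y $ j else 0)"
      by (intro sum.cong) (auto simp: w)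
    also have "\<dots> = hdot z y" by (simp add: hdot_def)
    finally show ?thesis .
  qed
  have iW: "inner (W z) (W y) = inner z y" for z y
    using WW[of z y] by (metis re_part_hdot)
  have nW: "norm (W z) = norm z" for z
    by (simp add: norm_eq_sqrt_inner iW)
  have inj: "inj W"
    unfolding linear_injective_0[OF W] by (metis nW norm_eq_zero)
  then have bij: "bij W"
    using linear_injective_imp_surjective[OF W] by (auto simp: bij_def)
  have AW: "A *v W z = W (\<chi> i. l i *\<^sub>R z $ i)" for z
  proof -
    have "A *v W z = (\<Sum>i\<in>UNIV. A *v rscale (w i) (z $ i))"
      unfolding W_def by (rule linear_sum[OF linear_matrix_vector_mult])
    then show ?thesis
      by (simp add: W_def matrix_vector_mult_simps w) (simp add: rscale_def)
  qed
  have eig: "eigenspace A k = W ` {z. \<forall>i. i \<notin> {i. l i = k} \<longrightarrow> z $ i = 0}" for k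
  proof -
    have "W z \<in> eigenspace A k \<longleftrightarrow> (\<forall>i. l i \<noteq> k \<longrightarrow> z $ i = 0)" for z
    proof -
      have "W z \<in> eigenspace A k \<longleftrightarrow> W (\<chi> i. l i *\<^sub>R z $ i) = W (k *\<^sub>R z)"
        by (simp add: eigenspace_def AW linear_scale[OF W])
      also have "\<dots> \<longleftrightarrow> (\<forall>i. l i *\<^sub>R z $ i = k *\<^sub>R z $ i)"
        unfolding inj_eq[OF inj] by (simp add: vec_eq_iff)
      finally show ?thesis by auto
    qed
    then show ?thesis
      using bij by (auto simp: bij_def surj_def image_iff) metis
  qed
  have dim: "dim (eigenspace A k) div DIM('f) = card {i. l i = k}" for k
  proof -
    have "dim (eigenspace A k) = dim {z :: 'f ^ 'n. \<forall>i. i \<notin> {i. l i = k} \<longrightarrow> z $ i = 0}"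
      unfolding eig by (rule dim_image_eq[OF W]) (use inj in \<open>auto intro: inj_on_subset\<close>)
    then show ?thesis
      unfolding dim_coordinate_subspace by simp
  qed
  have vals: "{k. \<exists>v\<in>eigenspace A k. v \<noteq> 0} = range l"
  proof (intro set_eqI iffI)
    fix k assume "k \<in> {k. \<exists>v\<in>eigenspace A k. v \<noteq> 0}"
    then obtain z where "\<forall>i. i \<notin> {i. l i = k} \<longrightarrow> z $ i = 0" "W z \<noteq> 0" unfolding eig by auto
    then show "k \<in> range l"
      using linear_0[OF W] by (cases "z = 0") (auto simp: vec_eq_iff)
  next
    fix k assume "k \<in> range l"
    then obtain i where "k = l i" by auto
    then have "w i \<in> eigenspace A k" "w i \<noteq> 0" using w1[of i] by (auto simp: eigenspace_def w)
    then show "k \<in> {k. \<exists>v\<in>eigenspace A k. v \<noteq> 0}" by auto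
  qed
  have "eig_prod A = (\<Prod>k\<in>range l. k ^ card {i. l i = k})"
    by (simp add: eig_prod_def vals dim)
  also have "\<dots> = (\<Prod>k\<in>range l. \<Prod>i\<in>{i. l i = k}. l i)"
    by (intro prod.cong) auto
  also have "\<dots> = (\<Prod>i\<in>UNIV. l i)"
    using prod.image_gen[of UNIV l l] by simp
  finally have ep: "eig_prod A = (\<Prod>i\<in>UNIV. l i)" .
  have q: "inner (W z) (A *v W z) = (\<Sum>i\<in>UNIV. l i * (norm (z $ i))\<^sup>2)" for z
    unfolding AW iW by (simp add: inner_vec_def power2_norm_eq_inner)
  show ?thesis
    using that[OF l W bij nW AW ep q] .
qed

section \<open>Gaussian integrals and Schur complements\<close>

lemma borel_measurable_hconj [measurable (raw)]:
  fixes f :: "'w \<Rightarrow> 'f::conj_div_algebra"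
  assumes "f \<in> borel_measurable M" shows "(\<lambda>x. hconj (f x)) \<in> borel_measurable M"
  by (rule borel_measurable_continuous_on[OF continuous_on_hconj assms])

lemma borel_measurable_matrix_vector_mult [measurable (raw)]:
  fixes f :: "'w \<Rightarrow> 'f::conj_div_algebra ^ 'n ^ 'm"
  assumes [measurable]: "f \<in> borel_measurable M" "g \<in> borel_measurable M"
  shows "(\<lambda>x. f x *v g x) \<in> borel_measurable M"
  unfolding matrix_vector_mult_def by measurable

definition gauss :: "'f::conj_div_algebra ^ 'n ^ 'n \<Rightarrow> ennreal" where
  "gauss A = (\<integral>\<^sup>+x. ennreal (exp (- inner x (A *v x))) \<partial>lborel)"

lemma borel_measurable_gauss [measurable]:
  "(gauss :: 'f::conj_div_algebra ^ 'n ^ 'n \<Rightarrow> ennreal) \<in> borel_measurable borel"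
proof -
  interpret borel_sigma_finite "lborel :: ('f ^ 'n) measure" by (rule borel_sigma_finite_lborel)
  show ?thesis unfolding gauss_def[abs_def] by measurable
qed

lemma gauss_pos_def:
  fixes A :: "'f::conj_div_algebra ^ 'n ^ 'n"
  assumes "A \<in> pos_def"
  shows "eig_prod A > 0" "gauss A = ennreal ((pi ^ CARD('n) / eig_prod A) powr (DIM('f) / 2))"
proof -
  interpret L: borel_sigma_finite "lborel :: 'f measure" by (rule borel_sigma_finite_lborel)
  obtain l :: "'n \<Rightarrow> real" and W :: "'f ^ 'n \<Rightarrow> 'f ^ 'n" where
    l: "\<And>i. l i > 0" and W: "linear W" "bij W" "\<And>z. norm (W z) = norm z"
    "\<And>z. A *v W z = W (\<chi> i. l i *\<^sub>R z $ i)" "eig_prod A = (\<Prod>i\<in>UNIV. l i)"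
    "\<And>z. inner (W z) (A *v W z) = (\<Sum>i\<in>UNIV. l i * (norm (z $ i))\<^sup>2)"
    by (rule pos_def_diagonalise[OF assms]) (rule that; assumption)
  show "eig_prod A > 0" unfolding W(5) by (rule prod_pos) (simp add: l)
  have "gauss A = (\<integral>\<^sup>+x. ennreal (exp (- inner x (A *v x))) \<partial>pad lborel UNIV 0)"
    unfolding gauss_def lborel_eq_pad[of "0 :: 'f ^ 'n"] ..
  also have "\<dots> = (\<integral>\<^sup>+z. ennreal (exp (- inner (W z) (A *v W z))) \<partial>pad lborel UNIV 0)"
  proof (rule nn_integral_pad_isometry[symmetric, of "\<lambda>x. ennreal (exp (- inner x (A *v x)))" W "inv W"])
    show "linear (inv W)" using W by (intro inj_linear_imp_inv_linear) (auto simp: bij_def)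
    show "W (inv W x) = x" "inv W (W x) = x" for x
      using W(2) by (simp_all add: bij_def surj_f_inv_f)
    show "(\<lambda>x. ennreal (exp (- inner x (A *v x)))) \<in> borel_measurable borel" by measurable
    show "linear W" "norm (W x) = norm x" for x by (fact W)+
  qed simp_all
  also have "\<dots> = ennreal (\<Prod>i\<in>UNIV. (pi / l i) powr (DIM('f) / 2))"
    unfolding W(6) by (rule nn_integral_pad_gaussian) (auto simp: l)
  also have "(\<Prod>i\<in>UNIV. (pi / l i) powr (DIM('f) / 2)) = (\<Prod>i\<in>UNIV. pi / l i) powr (DIM('f) / 2)"
    using l by (subst prod_powr_distrib) (simp_all add: less_imp_le)
  also have "(\<Prod>i\<in>UNIV. pi / l i) = pi ^ CARD('n) / eig_prod A"
    by (simp add: W(5) prod_dividef)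
  finally show "gauss A = ennreal ((pi ^ CARD('n) / eig_prod A) powr (DIM('f) / 2))" .
qed

lemma eig_prod_eq_gauss:
  fixes A :: "'f::conj_div_algebra ^ 'n ^ 'n"
  assumes "A \<in> pos_def"
  shows "eig_prod A = pi ^ CARD('n) * enn2real (gauss A) powr (- 2 / DIM('f))"
proof -
  have "eig_prod A > 0" by (rule gauss_pos_def[OF assms])
  then show ?thesis
    by (simp add: gauss_pos_def(2)[OF assms] powr_powr powr_minus DIM_positive)
qed

text \<open>By homogeneity it suffices to test unit vectors. The matrices with a unit vector where
  the form is nonpositive are the projection of a closed set along the compact sphere, hence closed;
  the Hermitian matrices are closed too.\<close>

lemma sets_pos_def [measurable]: "(pos_def :: ('f::conj_div_algebra ^ 'n ^ 'n) set) \<in> sets borel"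
proof -
  let ?T = "{(x, A :: 'f ^ 'n ^ 'n). inner x (A *v x) \<le> 0}"
  have "closed ?T"
    unfolding case_prod_unfold matrix_vector_mult_def
    by (intro closed_Collect_le continuous_intros)
  then have c1: "closed {A. \<exists>x. x \<in> sphere 0 1 \<and> (x, A) \<in> ?T}"
    by (intro closed_compact_projection) auto
  have c2: "closed {A :: 'f ^ 'n ^ 'n. hermitian A}"
  proof -
    have "continuous_on UNIV (\<lambda>A :: 'f ^ 'n ^ 'n. hconj (A $ j $ i))" for i j
      unfolding hconj_eq by (intro continuous_intros)
    then show ?thesis
      unfolding hermitian_iff by (intro closed_Collect_all closed_Collect_eq continuous_intros)
  qed
  have eq: "pos_def = {A. hermitian A} - {A. \<exists>x. x \<in> sphere 0 1 \<and> (x, A) \<in> ?T}"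
  proof (intro set_eqI iffI)
    fix A :: "'f ^ 'n ^ 'n" assume "A \<in> pos_def"
    then have "hermitian A" and pos: "0 < inner x (A *v x)" if "x \<noteq> 0" for x
      using that by (auto simp: pos_def_iff)
    moreover have "0 < inner x (A *v x)" if "x \<in> sphere 0 1" for x
      using that by (intro pos) auto
    ultimately show "A \<in> {A. hermitian A} - {A. \<exists>x. x \<in> sphere 0 1 \<and> (x, A) \<in> ?T}"
      using \<open>A \<in> pos_def\<close> by (force simp: pos_def_iff)
  next
    fix A :: "'f ^ 'n ^ 'n" assume A: "A \<in> {A. hermitian A} - {A. \<exists>x. x \<in> sphere 0 1 \<and> (x, A) \<in> ?T}"
    have "0 < inner x (A *v x)" if "x \<noteq> 0" for x
    proof -
      have "\<forall>y\<in>sphere 0 1. 0 < inner y (A *v y)"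
        using A by (auto simp: not_le)
      moreover have "x /\<^sub>R norm x \<in> sphere 0 1"
        using that by simp
      ultimately have "0 < inner (x /\<^sub>R norm x) (A *v (x /\<^sub>R norm x))"
        by blast
      then show ?thesis
        using that by (simp add: matrix_vector_mult_simps zero_less_mult_iff)
    qed
    with A show "A \<in> pos_def" by (simp add: pos_def_iff)
  qed
  show ?thesis
    unfolding eq by (intro sets.Diff borel_closed c1 c2)
qed

text \<open>Evaluate the form at the unit vector of index \<open>s\<close>. Pivots are thus
  positive, and the weight vanishes where a pivot is not.\<close>

lemma pos_def_diagonal:
  fixes A :: "'f::conj_div_algebra ^ 'n ^ 'n"
  assumes "A \<in> pos_def" "A $ s $ s = of_real t"
  shows "t > 0"
proof -
  have "axis s (1 :: 'f) \<noteq> 0" by (simp add: axis_eq_0_iff)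
  then have "0 < inner (axis s 1) (A *v axis s 1)"
    using assms(1) by (auto simp: pos_def_iff)
  also have "inner (axis s 1) (A *v axis s 1) = inner 1 ((A *v axis s 1) $ s)"
    by (simp add: inner_axis')
  also have "(A *v axis s 1) $ s = (\<Sum>j\<in>UNIV. if j = s then A $ s $ j else 0)"
    unfolding matrix_vector_mult_def vec_lambda_beta by (rule sum.cong) (auto simp: axis_def)
  also have "\<dots> = of_real t" by (simp add: assms(2))
  finally show ?thesis
    using re_part_linear(8)[where ?'f = 'f, of t] by (simp add: re_part_def inner_commute)
qed

text \<open>\<open>G\<close> is the Schur complement of the pivot \<open>t\<close> in
  \<open>F\<close>, kept at full size with row and column \<open>s\<close> of the identity;
  \<open>v\<close> is the pivot row off the diagonal.\<close>

locale schur_complement =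
  fixes F G :: "'f::conj_div_algebra ^ 'n ^ 'n" and s :: 'n and t :: real and v :: "'n \<Rightarrow> 'f"
  assumes F: "F $ s $ s = of_real t" "\<And>j. j \<noteq> s \<Longrightarrow> F $ s $ j = v j"
      "\<And>j. j \<noteq> s \<Longrightarrow> F $ j $ s = hconj (v j)"
    and G: "G $ s $ s = 1" "\<And>j. j \<noteq> s \<Longrightarrow> G $ s $ j = 0" "\<And>j. j \<noteq> s \<Longrightarrow> G $ j $ s = 0"
    and FG: "\<And>i j. i \<noteq> s \<Longrightarrow> j \<noteq> s \<Longrightarrow> F $ i $ j = G $ i $ j + (hconj (v i) * v j) /\<^sub>R t"
begin

lemma hermitian_schur: "hermitian F \<longleftrightarrow> hermitian G"
proof -
  have "hconj (F $ j $ i) = F $ i $ j \<longleftrightarrow> hconj (G $ j $ i) = G $ i $ j" for i j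
    by (cases "i = s"; cases "j = s") (auto simp: F G FG hconj_mult)
  then show ?thesis by (simp add: hermitian_iff)
qed

text \<open>\<open>lin\<close> and \<open>rest\<close> are the parts of the completed square that do
  not involve the coordinate \<open>s\<close>: the pivot row applied to \<open>x\<close>, and the
  quadratic form of the remaining block of \<open>G\<close>.\<close>

definition "lin x = (\<Sum>j\<in>UNIV - {s}. v j * x $ j)"
definition "rest x = (\<Sum>i\<in>UNIV - {s}. inner (x $ i) (\<Sum>j\<in>UNIV - {s}. G $ i $ j * x $ j))"

lemma upd [simp]: "lin (vec_upd x s a) = lin x" "rest (vec_upd x s a) = rest x"
  by (simp_all add: lin_def rest_def)

lemma mult_row: "(A *v x) $ i = A $ i $ s * x $ s + (\<Sum>j\<in>UNIV - {s}. A $ i $ j * x $ j)"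
  for A :: "'f ^ 'n ^ 'n"
  by (simp add: matrix_vector_mult_def sum.remove[of UNIV s])

lemma inner_row: "inner x y = inner (x $ s) (y $ s) + (\<Sum>i\<in>UNIV - {s}. inner (x $ i) (y $ i))"
  for x y :: "'f ^ 'n"
  by (simp add: inner_vec_def sum.remove[of UNIV s])

lemma form_G: "inner x (G *v x) = (norm (x $ s))\<^sup>2 + rest x"
  by (simp add: inner_row mult_row G rest_def power2_norm_eq_inner)

text \<open>Completing the square in the coordinate \<open>s\<close>; the rank-one difference
  between \<open>F\<close> and \<open>G\<close> is what the square absorbs.\<close>

lemma form_F:
  assumes "t \<noteq> 0"
  shows "inner x (F *v x) = t * (norm (x $ s + lin x /\<^sub>R t))\<^sup>2 + rest x"
proof -
  define y where "y = x $ s + lin x /\<^sub>R t"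
  have ty: "t *\<^sub>R y = t *\<^sub>R x $ s + lin x" using assms by (simp add: y_def scaleR_add_right)
  have s: "(F *v x) $ s = t *\<^sub>R y"
    unfolding ty by (simp add: mult_row F lin_def) (simp add: of_real_def)
  have i: "(F *v x) $ i = hconj (v i) * y + (\<Sum>j\<in>UNIV - {s}. G $ i $ j * x $ j)" if "i \<noteq> s" for i
    using that by (simp add: mult_row F FG y_def lin_def algebra_simps sum.distrib scaleR_sum_right sum_distrib_left)
  \<comment> \<open>For the real inner product, left multiplication by \<open>hconj b\<close> is
    adjoint to left multiplication by \<open>b\<close>.\<close>
  have move: "inner a (hconj b * y) = inner (b * a) y" for a b
    by (simp add: re_part_hconj_mult[symmetric] hconj_mult mult.assoc)
  have "inner x (F *v x) = inner (x $ s) (t *\<^sub>R y) + inner (lin x) y + rest x"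
    by (simp add: inner_row s i inner_add_right sum.distrib move rest_def lin_def inner_sum_left)
  also have "inner (x $ s) (t *\<^sub>R y) + inner (lin x) y = inner (t *\<^sub>R y) y"
  proof -
    have "inner (t *\<^sub>R y) y = inner (t *\<^sub>R x $ s + lin x) y" by (simp only: ty)
    then show ?thesis by (simp add: inner_add_left)
  qed
  finally show ?thesis by (simp add: y_def power2_norm_eq_inner)
qed

text \<open>Applied to \<open>F\<close> with \<open>c = lin / t\<close> and to \<open>G\<close> with
  \<open>c = 0\<close>, so that both definiteness conditions reduce to the same condition on
  \<open>rest\<close>.\<close>

lemma positive_iff_rest:
  fixes c :: "'f ^ 'n \<Rightarrow> 'f"
  assumes "r > 0" and c: "\<And>x a. c (vec_upd x s a) = c x" "c 0 = 0"
  shows "(\<forall>x. x \<noteq> 0 \<longrightarrow> 0 < r * (norm (x $ s + c x))\<^sup>2 + rest x) \<longleftrightarrow>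
    (\<forall>x. x \<noteq> 0 \<longrightarrow> x $ s = 0 \<longrightarrow> 0 < rest x)"
proof (intro iffI allI impI)
  fix x :: "'f ^ 'n" assume *: "\<forall>x. x \<noteq> 0 \<longrightarrow> 0 < r * (norm (x $ s + c x))\<^sup>2 + rest x" and x: "x \<noteq> 0" "x $ s = 0"
  from x obtain i where "x $ i \<noteq> 0" "i \<noteq> s" by (metis vec_eq_iff zero_index)
  \<comment> \<open>This value of the coordinate \<open>s\<close> annihilates the square, and
    \<open>rest\<close> does not see the change.\<close>
  then have "vec_upd x s (- c x) \<noteq> 0" by (auto simp: vec_eq_iff)
  with * have "0 < r * (norm (vec_upd x s (- c x) $ s + c (vec_upd x s (- c x))))\<^sup>2 + rest (vec_upd x s (- c x))"
    by blast
  then show "0 < rest x" by (simp add: c)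
next
  fix x :: "'f ^ 'n" assume *: "\<forall>x. x \<noteq> 0 \<longrightarrow> x $ s = 0 \<longrightarrow> 0 < rest x" and x: "x \<noteq> 0"
  show "0 < r * (norm (x $ s + c x))\<^sup>2 + rest x"
  \<comment> \<open>If only the coordinate \<open>s\<close> of \<open>x\<close> is nonzero,
    positivity comes from the square, otherwise from \<open>rest\<close>.\<close>
  proof (cases "vec_upd x s 0 = 0")
    case True
    then have "c x = 0" "rest x = 0"
      using c(1)[of x 0] c(2) upd(2)[of x 0] by (auto simp: rest_def)
    moreover have "x $ s \<noteq> 0"
    proof
      assume "x $ s = 0"
      then have "vec_upd x s 0 = x" by (simp add: vec_eq_iff)
      with True x show False by simp
    qed
    ultimately show ?thesis using \<open>r > 0\<close> by simp
  next
    case False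
    then have "0 < rest x" using *[rule_format, of "vec_upd x s 0"] by simp
    moreover have "0 \<le> r * (norm (x $ s + c x))\<^sup>2" using \<open>r > 0\<close> by simp
    ultimately show ?thesis by linarith
  qed
qed

lemma pos_def_schur:
  assumes "t > 0" shows "F \<in> pos_def \<longleftrightarrow> G \<in> pos_def"
proof -
  have "(\<forall>x. x \<noteq> 0 \<longrightarrow> 0 < inner x (F *v x)) \<longleftrightarrow> (\<forall>x. x \<noteq> 0 \<longrightarrow> x $ s = 0 \<longrightarrow> 0 < rest x)"
    using positive_iff_rest[of t "\<lambda>x. lin x /\<^sub>R t"] assms by (simp add: form_F lin_def[of 0])
  moreover have "(\<forall>x. x \<noteq> 0 \<longrightarrow> 0 < inner x (G *v x)) \<longleftrightarrow> (\<forall>x. x \<noteq> 0 \<longrightarrow> x $ s = 0 \<longrightarrow> 0 < rest x)"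
    using positive_iff_rest[of 1 "\<lambda>x. 0"] by (simp add: form_G)
  ultimately show ?thesis
    by (simp add: pos_def_iff hermitian_schur)
qed

text \<open>Integrate the coordinate \<open>s\<close> first. A translation removes
  \<open>lin\<close>, leaving (pi/t)^(beta/2) for \<open>F\<close> and pi^(beta/2) for
  \<open>G\<close>; the integral of \<open>exp (- rest x)\<close> is common to both.\<close>

lemma gauss_schur:
  assumes "t > 0" shows "gauss F = ennreal ((1 / t) powr (DIM('f) / 2)) * gauss G"
proof -
  interpret L: borel_sigma_finite "lborel :: 'f measure" by (rule borel_sigma_finite_lborel)
  let ?P = "pad lborel (UNIV - {s}) (0 :: 'f ^ 'n)"
  have U: "UNIV = insert s (UNIV - {s})" by auto
  have [measurable]: "rest \<in> borel_measurable borel" "lin \<in> borel_measurable borel"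
    unfolding rest_def lin_def by measurable
  have split: "gauss A = (\<integral>\<^sup>+x. \<integral>\<^sup>+a. ennreal (exp (- inner (vec_upd x s a) (A *v vec_upd x s a))) \<partial>lborel \<partial>?P)" for A :: "'f ^ 'n ^ 'n"
    unfolding gauss_def by (subst lborel_eq_pad[of 0], subst U, subst L.nn_integral_pad_insert) auto
  have "gauss F = (\<integral>\<^sup>+x. \<integral>\<^sup>+a. ennreal (exp (- rest x)) * ennreal (exp (- t * (norm (lin x /\<^sub>R t + 1 *\<^sub>R a))\<^sup>2)) \<partial>lborel \<partial>?P)"
    using assms unfolding split by (simp add: form_F ennreal_mult[symmetric] exp_add[symmetric] add.commute)
  also have "\<dots> = (\<integral>\<^sup>+x. ennreal (exp (- rest x)) * (\<integral>\<^sup>+a. ennreal (exp (- t * (norm a)\<^sup>2)) \<partial>(lborel :: 'f measure)) \<partial>?P)"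
  proof (intro nn_integral_cong)
    fix x :: "'f ^ 'n"
    show "(\<integral>\<^sup>+a. ennreal (exp (- rest x)) * ennreal (exp (- t * (norm (lin x /\<^sub>R t + 1 *\<^sub>R a))\<^sup>2)) \<partial>lborel)
      = ennreal (exp (- rest x)) * (\<integral>\<^sup>+a. ennreal (exp (- t * (norm a)\<^sup>2)) \<partial>(lborel :: 'f measure))"
      by (subst nn_integral_lborel_affine[of "\<lambda>a. ennreal (exp (- t * (norm a)\<^sup>2))" 1 "lin x /\<^sub>R t"])
         (simp_all add: nn_integral_cmult)
  qed
  also have "\<dots> = ennreal ((pi / t) powr (DIM('f) / 2)) * (\<integral>\<^sup>+x. ennreal (exp (- rest x)) \<partial>?P)"
    unfolding nn_integral_gaussian[OF assms] by (subst nn_integral_multc) (auto simp: mult.commute)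
  also have "ennreal ((pi / t) powr (DIM('f) / 2)) = ennreal ((1 / t) powr (DIM('f) / 2)) * ennreal (pi powr (DIM('f) / 2))"
    using assms by (simp add: ennreal_mult[symmetric] powr_mult[symmetric])
  finally have F: "gauss F = ennreal ((1 / t) powr (DIM('f) / 2)) * (ennreal (pi powr (DIM('f) / 2)) * (\<integral>\<^sup>+x. ennreal (exp (- rest x)) \<partial>?P))"
    by (simp add: mult.assoc)
  have "gauss G = (\<integral>\<^sup>+x. \<integral>\<^sup>+a. ennreal (exp (- rest x)) * ennreal (exp (- 1 * (norm a)\<^sup>2)) \<partial>(lborel :: 'f measure) \<partial>?P)"
    unfolding split by (simp add: form_G ennreal_mult[symmetric] exp_add[symmetric] add.commute)
  also have "\<dots> = ennreal (pi powr (DIM('f) / 2)) * (\<integral>\<^sup>+x. ennreal (exp (- rest x)) \<partial>?P)"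
    by (subst nn_integral_cmult, simp, subst nn_integral_gaussian)
       (auto simp: mult.commute nn_integral_multc)
  finally show ?thesis by (simp add: F)
qed

text \<open>Both Gaussian integrals are expressed by eigenvalue products, and the power beta/2 is
  injective on positive reals.\<close>

lemma eig_prod_schur:
  assumes "F \<in> pos_def" shows "eig_prod F = t * eig_prod G"
proof -
  have t: "t > 0" using assms F(1) by (rule pos_def_diagonal)
  have G: "G \<in> pos_def" using pos_def_schur[OF t] assms by simp
  define b where "b = real DIM('f) / 2"
  have b: "b > 0" by (simp add: b_def DIM_positive)
  note eF = gauss_pos_def[OF assms] and eG = gauss_pos_def[OF G]
  have "ennreal ((pi ^ CARD('n) / eig_prod F) powr b) = ennreal ((1 / t) powr b * (pi ^ CARD('n) / eig_prod G) powr b)"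
    using gauss_schur[OF t] eF(2) eG(2) by (simp add: b_def ennreal_mult)
  then have "(pi ^ CARD('n) / eig_prod F) powr b = (pi ^ CARD('n) / (t * eig_prod G)) powr b"
    using t eG(1) by (simp add: powr_mult[symmetric])
  then have "((pi ^ CARD('n) / eig_prod F) powr b) powr (1 / b) = ((pi ^ CARD('n) / (t * eig_prod G)) powr b) powr (1 / b)"
    by simp
  then have "pi ^ CARD('n) / eig_prod F = pi ^ CARD('n) / (t * eig_prod G)"
    using b t eF(1) eG(1) by (simp add: powr_powr)
  then show ?thesis
    using t eF(1) eG(1) by (simp add: field_simps)
qed

end

section \<open>Rotating the first column\<close>

text \<open>With the truncation to \<open>R\<close> inside the inner product, the Gram identities
  below hold for every vector and not merely almost everywhere for
  \<open>pad lborel R 0\<close>.\<close>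

definition res :: "'i set \<Rightarrow> 'f::conj_div_algebra ^ 'i::finite \<Rightarrow> 'f ^ 'i" where
  "res R x = (\<chi> i. if i \<in> R then x $ i else 0)"

lemma res_nth [simp]: "res R x $ i = (if i \<in> R then x $ i else 0)"
  by (simp add: res_def)

lemma borel_measurable_res [measurable (raw)]:
  fixes f :: "'w \<Rightarrow> 'f::conj_div_algebra ^ 'i"
  assumes [measurable]: "f \<in> borel_measurable M"
  shows "(\<lambda>x. res R (f x)) \<in> borel_measurable M"
proof -
  have [measurable]: "(\<lambda>x. if i \<in> R then f x $ i else 0) \<in> borel_measurable M" for i
    by (cases "i \<in> R") simp_all
  show ?thesis unfolding res_def by measurable
qed

lemma borel_measurable_hdot [measurable (raw)]:
  fixes f :: "'w \<Rightarrow> 'f::conj_div_algebra ^ 'i"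
  assumes [measurable]: "f \<in> borel_measurable M" "g \<in> borel_measurable M"
  shows "(\<lambda>x. hdot (f x) (g x)) \<in> borel_measurable M"
  unfolding hdot_def by measurable

lemma hdot_res_self: "hdot (res R x) x = of_real (\<Sum>i\<in>R. (norm (x $ i))\<^sup>2)"
proof -
  have "hdot (res R x) x = (\<Sum>i\<in>R. of_real ((norm (x $ i))\<^sup>2))"
    unfolding hdot_def by (rule sum.mono_neutral_cong_right)
      (auto simp: hconj_mult_self of_real_def power2_eq_square)
  then show ?thesis by simp
qed

lemma norm_res: "norm (res R x) = sqrt (\<Sum>i\<in>R. (norm (x $ i))\<^sup>2)"
proof -
  have "(norm (res R x))\<^sup>2 = (\<Sum>i\<in>R. (norm (res R x $ i))\<^sup>2)"
    by (rule norm_vec_restrict) simp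
  then show ?thesis by (metis (no_types, lifting) norm_ge_zero real_sqrt_unique res_nth sum.cong)
qed

text \<open>Splitting off row \<open>r\<close> of two columns; the product
  \<open>hconj a * b\<close> becomes the rank-one term of \<open>bord\<close>.\<close>

lemma hdot_res_upd:
  assumes "r \<in> R"
  shows "hdot (res R (vec_upd y r a)) (vec_upd z r b) = hconj a * b + hdot (res (R - {r}) y) z"
proof -
  have "(\<Sum>i\<in>UNIV - {r}. hconj (res R (vec_upd y r a) $ i) * vec_upd z r b $ i) =
    (\<Sum>i\<in>UNIV - {r}. hconj (res (R - {r}) y $ i) * z $ i)"
    by (rule sum.cong) auto
  then show ?thesis
    using assms by (simp add: hdot_def sum.remove[of UNIV r])
qed

text \<open>
  A quasi-reflection \<open>y \<mapsto> y - w a \<langle>w, y\<rangle>\<close> with \<open>w = e - v\<close> maps \<open>e\<close> to \<open>v\<close> iff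
  \<open>a\<close> is the inverse of \<open>\<langle>w, e\<rangle>\<close>; it is then automatically unitary. Over the quaternions
  \<open>a\<close> need not be real, so that Householder reflections would not suffice.
\<close>

lemma exists_rotation:
  fixes x :: "'f::conj_div_algebra ^ 'm"
  assumes r: "r \<in> R"
  obtains U V :: "'f ^ 'm \<Rightarrow> 'f ^ 'm"
  where "linear U" "linear V" "\<And>y. U (V y) = y" "\<And>y. V (U y) = y" "\<And>y. norm (U y) = norm y"
    "\<forall>y. (\<forall>i. i \<notin> R \<longrightarrow> y $ i = 0) \<longrightarrow> (\<forall>i. i \<notin> R \<longrightarrow> U y $ i = 0)"
    "\<forall>y. (\<forall>i. i \<notin> R \<longrightarrow> y $ i = 0) \<longrightarrow> (\<forall>i. i \<notin> R \<longrightarrow> V y $ i = 0)"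
    "\<And>y z. hdot (res R (U y)) (U z) = hdot (res R y) z"
    "\<And>y. hdot (res R x) (U y) = norm (res R x) *\<^sub>R y $ r"
proof -
  define e :: "'f ^ 'm" where "e = axis r 1"
  define v where "v = res R x /\<^sub>R norm (res R x)"
  have xv: "res R x = norm (res R x) *\<^sub>R v"
    by (cases "res R x = 0") (simp_all add: v_def)
  have he: "hdot e y = y $ r" for y
  proof -
    have "hdot e y = (\<Sum>i\<in>UNIV. if i = r then y $ i else 0)"
      unfolding hdot_def e_def by (rule sum.cong) (auto simp: axis_def)
    then show ?thesis by simp
  qed
  have er: "e $ r = 1" by (simp add: e_def axis_def)
  have "inner e e = re_part (e $ r)" using he[of e] re_part_hdot[of e e] by simp
  then have ne: "norm e = 1" by (simp add: norm_eq_sqrt_inner er)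
  show ?thesis
  proof (cases "res R x = 0 \<or> v = e")
    case True
    \<comment> \<open>Nothing has to be rotated, and the identity map serves.\<close>
    then have "hdot (res R x) y = norm (res R x) *\<^sub>R y $ r" for y
      using xv he[of y] by (metis hdot_simps(5,7) norm_zero scaleR_zero_left)
    then show ?thesis
      by (intro that[of "\<lambda>x. x" "\<lambda>x. x"]) (auto simp: linear_iff)
  next
    case False
    then have nv: "norm v = 1" by (simp add: v_def)
    have vR: "v $ i = 0" if "i \<notin> R" for i using that by (simp add: v_def)
    define w where "w = e - v"
    have wR: "w $ i = 0" if "i \<notin> R" for i using that r vR by (auto simp: w_def e_def axis_def)
    define \<omega> where "\<omega> = hdot w e"
    have hve: "hdot v e = hconj (v $ r)"
      using he[of v] hconj_hdot[of e v] by simp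
    have hee: "hdot e e = 1" by (simp add: hdot_self ne)
    have hvv: "hdot v v = 1" by (simp add: hdot_self nv)
    have \<omega>: "\<omega> = 1 - hconj (v $ r)" by (simp add: \<omega>_def w_def hve hee er)
    \<comment> \<open>Here it matters that \<open>e\<close> and \<open>v\<close> are both unit
      vectors. Unitarity rests on this identity, and it also shows that \<open>\<omega> = 0\<close>
      would force \<open>w = 0\<close>.\<close>
    have ww: "hdot w w = \<omega> + hconj \<omega>"
      unfolding \<omega> by (simp add: w_def hve hee hvv he er)
    have \<omega>0: "\<omega> \<noteq> 0"
    proof
      assume "\<omega> = 0"
      then have "hdot w w = 0" by (simp add: ww)
      then have "w = 0" by (simp add: hdot_self)
      then show False using False by (simp add: w_def)
    qed
    define a where "a = inverse \<omega>"
    have a: "a * \<omega> = 1" "\<omega> * a = 1" using \<omega>0 by (simp_all add: a_def)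
    have ha: "hconj a * hconj \<omega> = 1" "hconj \<omega> * hconj a = 1"
      using arg_cong[OF a(2), of hconj] arg_cong[OF a(1), of hconj] by (simp_all add: hconj_mult)
    \<comment> \<open>In \<open>\<omega> + hconj \<omega>\<close> the left factor \<open>a\<close>
      cancels the first summand and the right factor \<open>hconj a\<close> the second, so
      commutativity is not involved.\<close>
    have k1: "a * (hdot w w * hconj a) = a + hconj a"
      unfolding ww using a ha by (simp add: algebra_simps flip: mult.assoc)
    have k2: "hconj a * (hdot w w * a) = a + hconj a"
      unfolding ww using a ha by (simp add: algebra_simps flip: mult.assoc)
    define U where "U y = y - rscale w (a * hdot w y)" for y
    define V where "V y = y - rscale w (hconj a * hdot w y)" for y
    have lin: "linear U" "linear V"
      by (rule linearI; simp add: U_def V_def rscale_def vec_eq_iff algebra_simps)+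
    have UV: "U (V y) = y" for y
    proof -
      have "U (V y) = y - rscale w ((hconj a + a - a * (hdot w w * hconj a)) * hdot w y)"
        by (simp add: U_def V_def) (simp add: rscale_def vec_eq_iff algebra_simps)
      then show ?thesis by (simp add: k1 rscale_def vec_eq_iff)
    qed
    have VU: "V (U y) = y" for y
    proof -
      have "V (U y) = y - rscale w ((a + hconj a - hconj a * (hdot w w * a)) * hdot w y)"
        by (simp add: U_def V_def) (simp add: rscale_def vec_eq_iff algebra_simps)
      then show ?thesis by (simp add: k2 rscale_def vec_eq_iff)
    qed
    have UU: "hdot (U y) (U z) = hdot y z" for y z
    proof -
      have "hdot (U y) (U z) = hdot y z + hdot y w * (hconj a * (hdot w w * a) - a - hconj a) * hdot w z"
        by (simp add: U_def hconj_mult hconj_hdot) (simp add: algebra_simps)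
      then show ?thesis by (simp add: k2)
    qed
    have nU: "norm (U y) = norm y" for y
      using UU[of y y] by (metis norm_eq_sqrt_inner re_part_hdot)
    have suppU: "U y $ i = 0" "V y $ i = 0" if "\<And>i. i \<notin> R \<Longrightarrow> y $ i = 0" "i \<notin> R" for y i
      using that wR by (simp_all add: U_def V_def rscale_def)
    have wres: "hdot w (res R y) = hdot w y" for y
      unfolding hdot_def by (rule sum.cong) (auto simp: wR)
    have resU: "res R (U y) = U (res R y)" for y
      by (simp add: U_def wres vec_eq_iff rscale_def wR)
    have "U e = e - rscale w 1"
      unfolding U_def \<omega>_def[symmetric] a(1) ..
    then have Ue: "U e = v"
      by (simp add: w_def vec_eq_iff rscale_def)
    have x: "hdot (res R x) (U y) = norm (res R x) *\<^sub>R y $ r" for y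
    proof -
      have "hdot v (U y) = y $ r" using UU[of e y] by (simp add: Ue he)
      then show ?thesis by (subst xv) simp
    qed
    show ?thesis
      by (rule that[of U V]) (simp_all add: lin UV VU nU suppU resU UU x)
  qed
qed

section \<open>Coordinates of Hermitian matrices and bordering\<close>

definition put_row :: "'n set \<Rightarrow> 'n \<Rightarrow> 'f ^ 'n \<Rightarrow> 'f ^ ('n \<times> 'n) \<Rightarrow> 'f ^ ('n::finite \<times> 'n)" where
  "put_row T s v u = (\<chi> p. if fst p = s \<and> snd p \<in> T then v $ snd p else u $ p)"

lemma borel_measurable_put_row [measurable (raw)]:
  fixes v :: "'w \<Rightarrow> 'f::euclidean_space ^ 'n"
  assumes [measurable]: "v \<in> borel_measurable M" "u \<in> borel_measurable M"
  shows "(\<lambda>x. put_row T s (v x) (u x)) \<in> borel_measurable M"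
proof -
  have [measurable]: "(\<lambda>x. if fst p = s \<and> snd p \<in> T then v x $ snd p else u x $ p) \<in> borel_measurable M" for p
    by (cases "fst p = s"; cases "snd p \<in> T") simp_all
  show ?thesis unfolding put_row_def by measurable
qed

text \<open>Row \<open>s\<close> of the coordinates indexed by pairs is repackaged as a vector
  indexed by columns, to be matched with the vector \<open>a\<close> formed by row \<open>r\<close>
  of the remaining columns of T.\<close>

lemma nn_integral_pad_row:
  fixes f :: "'f::euclidean_space ^ ('n::finite \<times> 'n) \<Rightarrow> ennreal"
  assumes "finite T" and A: "\<And>j. (s, j) \<notin> A" and f: "f \<in> borel_measurable borel"
  shows "(\<integral>\<^sup>+u. f u \<partial>pad lborel (A \<union> {s} \<times> T) 0) =
    (\<integral>\<^sup>+v. \<integral>\<^sup>+u. f (put_row T s v u) \<partial>pad lborel A 0 \<partial>pad lborel T 0)"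
  using \<open>finite T\<close> f
proof (induction T arbitrary: f rule: finite_induct)
  case empty
  interpret L: borel_sigma_finite "lborel :: 'f measure" by (rule borel_sigma_finite_lborel)
  show ?case
    using empty by (subst L.nn_integral_pad_empty) (simp_all add: put_row_def)
next
  case (insert t T)
  interpret L: borel_sigma_finite "lborel :: 'f measure" by (rule borel_sigma_finite_lborel)
  interpret A: borel_sigma_finite "pad lborel A (0 :: 'f ^ ('n \<times> 'n))" by (rule L.borel_sigma_finite_pad)
  note [measurable] = insert.prems
  have upd: "vec_upd (put_row T s v u) (s, t) y = put_row (insert t T) s (vec_upd v t y) u" for v :: "'f ^ 'n" and u y
    by (auto simp: put_row_def vec_eq_iff)
  have st: "(s, t) \<notin> A \<union> {s} \<times> T" using A insert.hyps by simp
  have eq: "A \<union> {s} \<times> insert t T = insert (s, t) (A \<union> {s} \<times> T)" by auto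
  have "(\<integral>\<^sup>+u. f u \<partial>pad lborel (A \<union> {s} \<times> insert t T) 0) =
    (\<integral>\<^sup>+w. \<integral>\<^sup>+y. f (vec_upd w (s, t) y) \<partial>lborel \<partial>pad lborel (A \<union> {s} \<times> T) 0)"
    unfolding eq by (rule L.nn_integral_pad_insert[OF st]) measurable
  also have "\<dots> = (\<integral>\<^sup>+v. \<integral>\<^sup>+u. \<integral>\<^sup>+y. f (vec_upd (put_row T s v u) (s, t) y) \<partial>lborel \<partial>pad lborel A 0 \<partial>pad lborel T 0)"
    by (rule insert.IH) measurable
  also have "\<dots> = (\<integral>\<^sup>+v. \<integral>\<^sup>+y. \<integral>\<^sup>+u. f (put_row (insert t T) s (vec_upd v t y) u) \<partial>pad lborel A 0 \<partial>lborel \<partial>pad lborel T 0)"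
    unfolding upd by (intro nn_integral_cong A.Fubini borel_sigma_finite_lborel) measurable
  also have "\<dots> = (\<integral>\<^sup>+v. \<integral>\<^sup>+u. f (put_row (insert t T) s v u) \<partial>pad lborel A 0 \<partial>pad lborel (insert t T) 0)"
    by (rule L.nn_integral_pad_insert[OF insert.hyps(2), symmetric]) measurable
  finally show ?case .
qed

definition pd_weight :: "real \<Rightarrow> 'f::conj_div_algebra ^ 'n ^ 'n \<Rightarrow> ennreal" where
  "pd_weight e F = (if F \<in> pos_def then ennreal (eig_prod F powr e) else 0)"

lemma borel_measurable_pd_weight [measurable]:
  "(pd_weight e :: 'f::conj_div_algebra ^ 'n ^ 'n \<Rightarrow> ennreal) \<in> borel_measurable borel"
proof -
  have "pd_weight e = (\<lambda>F :: 'f ^ 'n ^ 'n. if F \<in> pos_def then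
      ennreal ((pi ^ CARD('n) * enn2real (gauss F) powr (- 2 / DIM('f))) powr e) else 0)"
    by (auto simp: pd_weight_def fun_eq_iff eig_prod_eq_gauss)
  then show ?thesis by simp
qed

definition prs :: "'n::order set \<Rightarrow> ('n \<times> 'n) set" where
  "prs S = {(i, j). i \<in> S \<and> j \<in> S \<and> i < j}"

text \<open>Outside the index set \<open>S\<close> all matrices below are padded by the identity matrix.\<close>

definition gram :: "'m set \<Rightarrow> 'n set \<Rightarrow> 'f ^ 'm ^ 'n \<Rightarrow> 'f::conj_div_algebra ^ 'n::finite ^ 'n" where
  "gram R S X = (\<chi> i j. if i \<in> S \<and> j \<in> S then hdot (res R (X $ i)) (X $ j) else if i = j then 1 else 0)"

definition herm_mat :: "'n::{finite,linorder} set \<Rightarrow> real ^ 'n::_ \<Rightarrow> 'f ^ ('n \<times> 'n) \<Rightarrow> 'f::conj_div_algebra ^ 'n::_ ^ 'n::_" where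
  "herm_mat S d u = (\<chi> i j. if i \<in> S \<and> j \<in> S then
      (if i = j then of_real (d $ i) else if i < j then u $ (i, j) else hconj (u $ (j, i)))
     else if i = j then 1 else 0)"

lemma borel_measurable_matrix_iff:
  fixes f :: "'w \<Rightarrow> 'f::euclidean_space ^ 'n ^ 'm"
  assumes "\<And>i j. (\<lambda>x. f x $ i $ j) \<in> borel_measurable M"
  shows "f \<in> borel_measurable M"
proof -
  have "(\<lambda>x. \<chi> i j. f x $ i $ j) \<in> borel_measurable M"
    using assms by measurable
  then show ?thesis by simp
qed

lemma borel_measurable_gram [measurable (raw)]:
  fixes X :: "'w \<Rightarrow> 'f::conj_div_algebra ^ 'm ^ 'n"
  assumes [measurable]: "X \<in> borel_measurable M"
  shows "(\<lambda>x. gram R S (X x)) \<in> borel_measurable M"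
proof (rule borel_measurable_matrix_iff)
  show "(\<lambda>x. gram R S (X x) $ i $ j) \<in> borel_measurable M" for i j
    by (cases "i \<in> S \<and> j \<in> S"; cases "i = j") (simp_all add: gram_def)
qed

lemma borel_measurable_herm_mat [measurable (raw)]:
  fixes u :: "'w \<Rightarrow> 'f::conj_div_algebra ^ ('n::{finite,linorder} \<times> 'n::_)"
  assumes [measurable]: "d \<in> borel_measurable M" "u \<in> borel_measurable M"
  shows "(\<lambda>x. herm_mat S (d x) (u x)) \<in> borel_measurable M"
proof (rule borel_measurable_matrix_iff)
  fix i j :: 'n
  consider "i = j" | "i < j" | "j < i" by fastforce
  then show "(\<lambda>x. herm_mat S (d x) (u x) $ i $ j) \<in> borel_measurable M"
    by cases (cases "i \<in> S \<and> j \<in> S"; simp add: herm_mat_def)+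
qed

text \<open>The Gram matrix of columns of which column \<open>s\<close> is \<open>sqrt t\<close>
  times the unit vector of index \<open>r\<close>, while the others have the entries of
  \<open>a\<close> in row \<open>r\<close> and Gram matrix \<open>G\<close> in the remaining rows.
  It inverts the formation of the Schur complement.\<close>

definition bord :: "'n set \<Rightarrow> 'n \<Rightarrow> real \<Rightarrow> 'f ^ 'n \<Rightarrow> 'f ^ 'n ^ 'n \<Rightarrow> 'f::conj_div_algebra ^ 'n::finite ^ 'n" where
  "bord S s t a G = (\<chi> i j.
     if i = s then (if j = s then of_real t else if j \<in> S then sqrt t *\<^sub>R a $ j else 0)
     else if j = s then (if i \<in> S then sqrt t *\<^sub>R hconj (a $ i) else 0)
     else if i \<in> S \<and> j \<in> S then G $ i $ j + hconj (a $ i) * a $ j else if i = j then 1 else 0)"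

lemma borel_measurable_bord [measurable (raw)]:
  fixes a :: "'w \<Rightarrow> 'f::conj_div_algebra ^ 'n"
  assumes [measurable]: "t \<in> borel_measurable M" "a \<in> borel_measurable M" "G \<in> borel_measurable M"
  shows "(\<lambda>x. bord S s (t x) (a x) (G x)) \<in> borel_measurable M"
proof (rule borel_measurable_matrix_iff)
  show "(\<lambda>x. bord S s (t x) (a x) (G x) $ i $ j) \<in> borel_measurable M" for i j
    by (cases "i = s"; cases "j = s"; cases "i \<in> S"; cases "j \<in> S"; cases "i = j") (simp_all add: bord_def)
qed

text \<open>The pivot row is \<open>sqrt t\<close> times \<open>a\<close>, so division by
  \<open>t\<close> in the Schur correction leaves exactly
  \<open>hconj (a $ i) * a $ j\<close>.\<close>

lemma schur_complement_bord:
  assumes "t > 0" "s \<notin> S" "\<And>i j. \<not> (i \<in> S \<and> j \<in> S) \<Longrightarrow> G $ i $ j = (if i = j then 1 else 0)"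
  shows "schur_complement (bord S s t a G) G s t (\<lambda>j. if j \<in> S then sqrt t *\<^sub>R a $ j else 0)"
proof (rule schur_complement.intro)
  have G: "G $ i $ j = (if i = j then 1 else 0)" if "i \<notin> S \<or> j \<notin> S" for i j
    using assms(3)[of i j] that by simp
  show "bord S s t a G $ s $ s = of_real t" by (simp add: bord_def)
  show "bord S s t a G $ s $ j = (if j \<in> S then sqrt t *\<^sub>R a $ j else 0)" if "j \<noteq> s" for j
    using that by (simp add: bord_def)
  show "bord S s t a G $ j $ s = hconj (if j \<in> S then sqrt t *\<^sub>R a $ j else 0)" if "j \<noteq> s" for j
    using that by (simp add: bord_def)
  show "G $ s $ s = 1" using G[of s s] assms(2) by simp
  show "G $ s $ j = 0" "G $ j $ s = 0" if "j \<noteq> s" for j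
    using G[of s j] G[of j s] assms(2) that by simp_all
  show "bord S s t a G $ i $ j = G $ i $ j +
      (hconj (if i \<in> S then sqrt t *\<^sub>R a $ i else 0) * (if j \<in> S then sqrt t *\<^sub>R a $ j else 0)) /\<^sub>R t"
    if "i \<noteq> s" "j \<noteq> s" for i j
  proof (cases "i \<in> S \<and> j \<in> S")
    case True
    have "sqrt t * sqrt t = t" using assms(1) by simp
    then show ?thesis
      using True that assms(1) by (simp add: bord_def)
  next
    case False
    then show ?thesis
      using that G[of i j] by (auto simp: bord_def)
  qed
qed

lemma pd_weight_bord:
  assumes "t > 0" "s \<notin> S" "\<And>i j. \<not> (i \<in> S \<and> j \<in> S) \<Longrightarrow> G $ i $ j = (if i = j then 1 else 0)"
  shows "pd_weight e (bord S s t a G) = ennreal (t powr e) * pd_weight e G"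
proof -
  interpret schur_complement "bord S s t a G" G s t "\<lambda>j. if j \<in> S then sqrt t *\<^sub>R a $ j else 0"
    using assms by (rule schur_complement_bord)
  show ?thesis
  proof (cases "bord S s t a G \<in> pos_def")
    case True
    then have "G \<in> pos_def" using pos_def_schur[OF \<open>t > 0\<close>] by simp
    then show ?thesis
      using True \<open>t > 0\<close> gauss_pos_def(1)[of G]
      by (simp add: pd_weight_def eig_prod_schur powr_mult ennreal_mult)
  next
    case False
    then show ?thesis
      using pos_def_schur[OF \<open>t > 0\<close>] by (simp add: pd_weight_def)
  qed
qed

lemma hdot_res_commute: "hdot (res R y) x = hconj (hdot (res R x) y)"
proof -
  have "hdot (res R y) x = hdot y (res R x)"
    unfolding hdot_def by (rule sum.cong) auto
  then show ?thesis unfolding hconj_hdot .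
qed

abbreviation lam :: "'m::finite set \<Rightarrow> ('f::conj_div_algebra ^ 'm) measure" where
  "lam R \<equiv> pad lborel R 0"

lemma borel_sigma_finite_lam: "borel_sigma_finite (lam R)"
  by (rule borel_sigma_finite.borel_sigma_finite_pad[OF borel_sigma_finite_lborel])

text \<open>The column \<open>x\<close> stays fixed and \<open>U\<close>, which sends the unit
  vector of index \<open>r\<close> to the direction of \<open>x\<close>, is applied to all other
  columns. This preserves their measure and mutual inner products, and turns the inner product of
  \<open>x\<close> with a column into the length of \<open>x\<close> times the entry of that column
  in row \<open>r\<close>. Row \<open>r\<close> is then split off as \<open>a\<close>.\<close>

lemma nn_integral_gram_rotate:
  fixes x :: "'f::conj_div_algebra ^ 'm" and g :: "'f ^ 'n ^ 'n \<Rightarrow> ennreal"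
  assumes g [measurable]: "g \<in> borel_measurable borel" and r: "r \<in> R" and s: "s \<notin> S"
  shows "(\<integral>\<^sup>+Y. g (gram R (insert s S) (vec_upd Y s x)) \<partial>pad (lam R) S 0) =
    (\<integral>\<^sup>+a. \<integral>\<^sup>+Y. g (bord S s (\<Sum>k\<in>R. (norm (x $ k))\<^sup>2) a (gram (R - {r}) S Y))
      \<partial>pad (lam (R - {r})) S 0 \<partial>pad lborel S 0)"
proof -
  interpret L: borel_sigma_finite "lborel :: 'f measure" by (rule borel_sigma_finite_lborel)
  interpret R: borel_sigma_finite "lam R :: ('f ^ 'm) measure" by (rule borel_sigma_finite_lam)
  interpret R': borel_sigma_finite "lam (R - {r}) :: ('f ^ 'm) measure" by (rule borel_sigma_finite_lam)
  have R: "R = insert r (R - {r})" using r by auto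
  obtain U V :: "'f ^ 'm \<Rightarrow> 'f ^ 'm"
    where U: "linear U" "linear V" "\<And>y. U (V y) = y" "\<And>y. V (U y) = y" "\<And>y. norm (U y) = norm y"
      "\<forall>y. (\<forall>i. i \<notin> R \<longrightarrow> y $ i = 0) \<longrightarrow> (\<forall>i. i \<notin> R \<longrightarrow> U y $ i = 0)"
      "\<forall>y. (\<forall>i. i \<notin> R \<longrightarrow> y $ i = 0) \<longrightarrow> (\<forall>i. i \<notin> R \<longrightarrow> V y $ i = 0)"
      "\<And>y z. hdot (res R (U y)) (U z) = hdot (res R y) z"
      "\<And>y. hdot (res R x) (U y) = norm (res R x) *\<^sub>R y $ r"
    by (rule exists_rotation[OF r, of x]) (rule that; assumption)
  have [measurable]: "U \<in> borel_measurable borel" by (rule linear_borel_measurable[OF U(1)])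
  have eq: "gram R (insert s S) (vec_upd (\<chi> i. U ((\<chi> i. vec_upd (Y $ i) r (a $ i)) $ i)) s x) =
    bord S s (\<Sum>k\<in>R. (norm (x $ k))\<^sup>2) a (gram (R - {r}) S Y)" for Y and a :: "'f ^ 'n"
  proof -
    have x: "hdot (res R (U y)) x = norm (res R x) *\<^sub>R hconj (y $ r)" for y
      unfolding hdot_res_commute[of R "U y"] U(9) by simp
    show ?thesis
      using s by (simp add: vec_eq_iff gram_def bord_def hdot_res_self U(8,9) x hdot_res_upd[OF r] norm_res
          add.commute)
  qed
  have "(\<integral>\<^sup>+Y. g (gram R (insert s S) (vec_upd Y s x)) \<partial>pad (lam R) S 0) =
    1 ^ card S * (\<integral>\<^sup>+Y. g (gram R (insert s S) (vec_upd (\<chi> i. U (Y $ i)) s x)) \<partial>pad (lam R) S 0)"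
  proof (rule R.nn_integral_pad_map)
    show "(\<integral>\<^sup>+y. h y \<partial>lam R) = 1 * (\<integral>\<^sup>+y. h (U y) \<partial>lam R)" if h: "h \<in> borel_measurable borel" for h :: "'f ^ 'm \<Rightarrow> ennreal"
    proof -
      have "(\<integral>\<^sup>+y. h (U y) \<partial>lam R) = (\<integral>\<^sup>+y. h y \<partial>lam R)"
        by (rule nn_integral_pad_isometry[where V = V]) (use U h in blast)+
      then show ?thesis by simp
    qed
    show "U (0 $ i) = 0 $ i" for i using linear_0[OF U(1)] by simp
  qed (simp_all add: R.borel_sigma_finite_axioms)
  also have "\<dots> = (\<integral>\<^sup>+Y. g (gram R (insert s S) (vec_upd (\<chi> i. U (Y $ i)) s x)) \<partial>pad (lam R) S 0)"
    by simp
  also have "\<dots> = (\<integral>\<^sup>+a. \<integral>\<^sup>+Y. g (gram R (insert s S) (vec_upd (\<chi> i. U ((\<chi> i. vec_upd (Y $ i) r (a $ i)) $ i)) s x))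
      \<partial>pad (lam (R - {r})) S 0 \<partial>pad lborel S 0)"
  proof (rule R.nn_integral_pad_map2)
    show "(\<integral>\<^sup>+y. h y \<partial>lam R) = (\<integral>\<^sup>+a. \<integral>\<^sup>+y. h (vec_upd y r a) \<partial>lam (R - {r}) \<partial>lborel)"
      if [measurable]: "h \<in> borel_measurable borel" for h :: "'f ^ 'm \<Rightarrow> ennreal"
    proof -
      have "(\<integral>\<^sup>+y. h y \<partial>lam R) = (\<integral>\<^sup>+y. \<integral>\<^sup>+a. h (vec_upd y r a) \<partial>lborel \<partial>lam (R - {r}))"
        by (subst R, rule L.nn_integral_pad_insert) simp_all
      also have "\<dots> = (\<integral>\<^sup>+a. \<integral>\<^sup>+y. h (vec_upd y r a) \<partial>lam (R - {r}) \<partial>lborel)"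
        by (rule R'.Fubini[OF borel_sigma_finite_lborel]) measurable
      finally show ?thesis .
    qed
    show "vec_upd (0 $ i) r (0 $ i) = (0 :: 'f ^ 'm ^ 'n) $ i" for i
      by (simp add: vec_eq_iff)
    show "(\<lambda>(a :: 'f, y :: 'f ^ 'm). vec_upd y r a) \<in> borel_measurable (borel \<Otimes>\<^sub>M borel)"
      by measurable
  qed (simp_all add: borel_sigma_finite_lborel R'.borel_sigma_finite_axioms)
  finally show ?thesis unfolding eq .
qed

text \<open>The same kind of matrix as \<open>bord\<close>, but in the linear coordinates of the
  reference measure: \<open>v\<close> is the pivot row itself, \<open>sqrt t\<close> times
  \<open>a\<close>.\<close>

definition herm_join :: "'n::{finite,linorder} set \<Rightarrow> 'n \<Rightarrow> real \<Rightarrow> 'f ^ 'n::_ \<Rightarrow> real ^ 'n::_ \<Rightarrow> 'f ^ ('n \<times> 'n)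
    \<Rightarrow> 'f::conj_div_algebra ^ 'n::_ ^ 'n::_" where
  "herm_join S s t v d u = herm_mat (insert s S) (vec_upd d s t)
(put_row S s v u)"

lemma borel_measurable_herm_join [measurable (raw)]:
  fixes u :: "'w \<Rightarrow> 'f::conj_div_algebra ^ ('n::{finite,linorder} \<times> 'n::_)"
  assumes [measurable]: "t \<in> borel_measurable M" "v \<in> borel_measurable M"
    "d \<in> borel_measurable M" "u \<in> borel_measurable M"
  shows "(\<lambda>x. herm_join S s (t x) (v x) (d x) (u x)) \<in> borel_measurable M"
  unfolding herm_join_def by measurable

text \<open>As \<open>s\<close> is smaller than every element of \<open>S\<close>, the new
  off-diagonal coordinates are the pairs \<open>(s, j)\<close>, a single unconjugated row.\<close>

lemma nn_integral_herm_mat_insert: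
  fixes f :: "'f::conj_div_algebra ^ 'n::{finite,linorder} ^ 'n::_ \<Rightarrow> ennreal"
  assumes [measurable]: "f \<in> borel_measurable borel" and s: "\<And>j. j \<in> S \<Longrightarrow> s < j"
  shows "(\<integral>\<^sup>+d. \<integral>\<^sup>+u. f (herm_mat (insert s S) d u) \<partial>pad lborel (prs (insert s S)) 0 \<partial>pad lborel (insert s S) 0) =
    (\<integral>\<^sup>+t. \<integral>\<^sup>+v. \<integral>\<^sup>+d. \<integral>\<^sup>+u. f (herm_join S s t v d u) \<partial>pad lborel (prs S) 0 \<partial>pad lborel S 0 \<partial>pad lborel S 0 \<partial>lborel)"
proof -
  interpret L: borel_sigma_finite "lborel :: 'f measure" by (rule borel_sigma_finite_lborel)
  interpret LR: borel_sigma_finite "lborel :: real measure" by (rule borel_sigma_finite_lborel)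
  interpret P: borel_sigma_finite "pad lborel (prs S) (0 :: 'f ^ ('n \<times> 'n))" by (rule L.borel_sigma_finite_pad)
  interpret P': borel_sigma_finite "pad lborel (prs (insert s S)) (0 :: 'f ^ ('n \<times> 'n))" by (rule L.borel_sigma_finite_pad)
  interpret S: borel_sigma_finite "pad lborel S (0 :: real ^ 'n::_)" by (rule LR.borel_sigma_finite_pad)
  interpret SF: borel_sigma_finite "pad lborel S (0 :: 'f ^ 'n::_)" by (rule L.borel_sigma_finite_pad)
  have sS: "s \<notin> S" using s by auto
  have prs: "prs (insert s S) = prs S \<union> {s} \<times> S"
    using s by (auto simp: prs_def dest: less_asym)
  have sp: "(s, j) \<notin> prs S" for j using sS by (simp add: prs_def)
  have "(\<integral>\<^sup>+d. \<integral>\<^sup>+u. f (herm_mat (insert s S) d u) \<partial>pad lborel (prs (insert s S)) 0 \<partial>pad lborel (insert s S) 0) =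
     (\<integral>\<^sup>+d. \<integral>\<^sup>+t. \<integral>\<^sup>+u. f (herm_mat (insert s S) (vec_upd d s t) u) \<partial>pad lborel (prs (insert s S)) 0 \<partial>lborel \<partial>pad lborel S 0)"
    by (rule LR.nn_integral_pad_insert[OF sS]) measurable
  also have "\<dots> = (\<integral>\<^sup>+d. \<integral>\<^sup>+t. \<integral>\<^sup>+v. \<integral>\<^sup>+u. f (herm_join S s t v d u)
      \<partial>pad lborel (prs S) 0 \<partial>pad lborel S 0 \<partial>lborel \<partial>pad lborel S 0)"
    unfolding prs herm_join_def by (intro nn_integral_cong nn_integral_pad_row sp) simp_all
  also have "\<dots> = (\<integral>\<^sup>+t. \<integral>\<^sup>+d. \<integral>\<^sup>+v. \<integral>\<^sup>+u. f (herm_join S s t v d u)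
      \<partial>pad lborel (prs S) 0 \<partial>pad lborel S 0 \<partial>pad lborel S 0 \<partial>lborel)"
    by (rule S.Fubini[OF borel_sigma_finite_lborel]) measurable
  also have "\<dots> = (\<integral>\<^sup>+t. \<integral>\<^sup>+v. \<integral>\<^sup>+d. \<integral>\<^sup>+u. f (herm_join S s t v d u)
      \<partial>pad lborel (prs S) 0 \<partial>pad lborel S 0 \<partial>pad lborel S 0 \<partial>lborel)"
    by (intro nn_integral_cong S.Fubini SF.borel_sigma_finite_axioms) measurable
  finally show ?thesis .
qed

text \<open>For fixed \<open>t\<close> and \<open>v\<close>, passing between the block of
  \<open>F\<close> and its Schur complement is a translation of the coordinates \<open>d\<close> and
  \<open>u\<close>, so its Jacobian is 1.\<close>

lemma bord_herm_mat_shift: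
  fixes v :: "'f::conj_div_algebra ^ 'n::{finite,linorder}"
  assumes t: "t > 0" and s: "\<And>j. j \<in> S \<Longrightarrow> s < j"
  shows "bord S s t ((1 / sqrt t) *\<^sub>R v)
      (herm_mat S (d - (\<chi> i. if i \<in> S then (norm (v $ i))\<^sup>2 / t else 0))
        (u - (\<chi> p. if p \<in> prs S then (hconj (v $ fst p) * v $ snd p) /\<^sub>R t else 0))) =
    herm_join S s t v d u" (is "bord S s t ?a ?G = ?H")
proof -
  have sS: "s \<notin> S" using s by auto
  have sq: "sqrt t * sqrt t = t" "sqrt t \<noteq> 0" using t by auto
  have a: "hconj (?a $ i) * ?a $ j = (hconj (v $ i) * v $ j) /\<^sub>R t" for i j
    using sq(1) by (simp add: divide_inverse flip: inverse_mult_distrib)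
  have "bord S s t ?a ?G $ i $ j = ?H $ i $ j" for i j
  proof (cases "i = s \<or> j = s")
    case True
    then show ?thesis
      using s sS sq(2) by (auto simp: bord_def herm_join_def herm_mat_def put_row_def dest: less_asym)
  next
    case False
    show ?thesis
    proof (cases "i \<in> S \<and> j \<in> S")
      case S: True
      have B: "bord S s t ?a ?G $ i $ j = ?G $ i $ j + (hconj (v $ i) * v $ j) /\<^sub>R t"
        using False S unfolding a[symmetric] by (simp add: bord_def)
      consider "i = j" | "i < j" | "j < i" by fastforce
      then show ?thesis
      proof cases
        case 1
        then show ?thesis
          using False S unfolding B
          by (simp add: herm_mat_def herm_join_def hconj_mult_self of_real_def divide_inverse mult.commute
              flip: scaleR_left.add)
      next
        case 2
        then have "i \<noteq> j" by auto
        then show ?thesis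
          using False S 2 unfolding B
          by (simp add: herm_mat_def herm_join_def put_row_def prs_def)
      next
        case 3
        then have "\<not> i < j" "i \<noteq> j" by auto
        then show ?thesis
          using False S 3 unfolding B
          by (simp add: herm_mat_def herm_join_def put_row_def prs_def hconj_mult)
      qed
    next
      case notS: False
      then show ?thesis
        using False by (auto simp: bord_def herm_join_def herm_mat_def)
    qed
  qed
  then show ?thesis by (simp add: vec_eq_iff)
qed

text \<open>Translate by the Schur correction. The weight of the whole matrix is
  \<open>t powr e\<close> times that of the complement, which accounts for the factor
  outside.\<close>

lemma nn_integral_schur_shift:
  fixes g :: "'f::conj_div_algebra ^ 'n::{finite,linorder} ^ 'n::_ \<Rightarrow> ennreal"
  assumes [measurable]: "g \<in> borel_measurable borel" and t: "t > 0" and s: "\<And>j. j \<in> S \<Longrightarrow> s < j"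
  shows "(\<integral>\<^sup>+d. \<integral>\<^sup>+u. g (bord S s t ((1 / sqrt t) *\<^sub>R v) (herm_mat S d u)) * pd_weight e (herm_mat S d u)
      \<partial>pad lborel (prs S) 0 \<partial>pad lborel S 0) =
    ennreal (t powr (- e)) * (\<integral>\<^sup>+d. \<integral>\<^sup>+u. g (herm_join S s t v d u) * pd_weight e (herm_join S s t v d u)
      \<partial>pad lborel (prs S) 0 \<partial>pad lborel S 0)"
proof -
  interpret L: borel_sigma_finite "lborel :: 'f measure" by (rule borel_sigma_finite_lborel)
  interpret P: borel_sigma_finite "pad lborel (prs S) (0 :: 'f ^ ('n \<times> 'n))" by (rule L.borel_sigma_finite_pad)
  have sS: "s \<notin> S" using s by auto
  define \<tau> where "\<tau> = (\<chi> i. if i \<in> S then (norm (v $ i))\<^sup>2 / t else 0)"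
  define \<sigma> where "\<sigma> = (\<chi> p. if p \<in> prs S then (hconj (v $ fst p) * v $ snd p) /\<^sub>R t else 0)"
  define k where "k d u = g (bord S s t ((1 / sqrt t) *\<^sub>R v) (herm_mat S d u)) * pd_weight e (herm_mat S d u)" for d u
  have [measurable]: "case_prod k \<in> borel_measurable (borel \<Otimes>\<^sub>M borel)"
    unfolding k_def case_prod_unfold by measurable
  have k: "k (d - \<tau>) (u - \<sigma>) = ennreal (t powr (- e)) * (g (herm_join S s t v d u) * pd_weight e (herm_join S s t v d u))" for d u
  proof -
    have B: "bord S s t ((1 / sqrt t) *\<^sub>R v) (herm_mat S (d - \<tau>) (u - \<sigma>)) = herm_join S s t v d u"
      unfolding \<tau>_def \<sigma>_def by (rule bord_herm_mat_shift[OF t s])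
    have "pd_weight e (herm_join S s t v d u) = ennreal (t powr e) * pd_weight e (herm_mat S (d - \<tau>) (u - \<sigma>))"
      unfolding B[symmetric]
      by (rule pd_weight_bord[OF t sS]) (auto simp: herm_mat_def)
    moreover have "ennreal (t powr (- e)) * ennreal (t powr e) = 1"
      using t by (simp add: ennreal_mult[symmetric] powr_add[symmetric])
    then have "ennreal (t powr (- e)) * (a * (ennreal (t powr e) * b)) = a * b" for a b :: ennreal
      by (metis mult.assoc mult.commute mult_1)
    ultimately show ?thesis
      unfolding k_def B by simp
  qed
  have "(\<integral>\<^sup>+d. \<integral>\<^sup>+u. k d u \<partial>pad lborel (prs S) 0 \<partial>pad lborel S 0) =
    (\<integral>\<^sup>+d. \<integral>\<^sup>+u. k (d + - \<tau>) u \<partial>pad lborel (prs S) 0 \<partial>pad lborel S 0)"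
    by (rule nn_integral_pad_lborel_translate[symmetric]) (simp_all add: \<tau>_def)
  also have "\<dots> = (\<integral>\<^sup>+d. \<integral>\<^sup>+u. k (d + - \<tau>) (u + - \<sigma>) \<partial>pad lborel (prs S) 0 \<partial>pad lborel S 0)"
    by (intro nn_integral_cong nn_integral_pad_lborel_translate[symmetric]) (simp_all add: \<sigma>_def)
  also have "\<dots> = (\<integral>\<^sup>+d. \<integral>\<^sup>+u. ennreal (t powr (- e)) * (g (herm_join S s t v d u) * pd_weight e (herm_join S s t v d u))
      \<partial>pad lborel (prs S) 0 \<partial>pad lborel S 0)"
    by (simp add: k)
  also have "\<dots> = ennreal (t powr (- e)) * (\<integral>\<^sup>+d. \<integral>\<^sup>+u. g (herm_join S s t v d u) * pd_weight e (herm_join S s t v d u)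
      \<partial>pad lborel (prs S) 0 \<partial>pad lborel S 0)"
    by (simp add: nn_integral_cmult)
  finally show ?thesis unfolding k_def .
qed

text \<open>Start of the induction: with no live columns every padded matrix is the
  identity.\<close>

lemma pd_weight_mat_1: "pd_weight e (mat 1) = 1"
proof -
  have "hermitian (mat 1 :: 'a ^ 'b ^ 'b)" by (simp add: hermitian_iff mat_def)
  then have pd: "mat 1 \<in> (pos_def :: ('a ^ 'b ^ 'b) set)"
    by (simp add: pos_def_iff)
  have "{l. \<exists>v\<in>eigenspace (mat 1 :: 'a ^ 'b ^ 'b) l. v \<noteq> 0} = {1}"
  proof (intro set_eqI iffI)
    fix l assume "l \<in> {l. \<exists>v\<in>eigenspace (mat 1 :: 'a ^ 'b ^ 'b) l. v \<noteq> 0}"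
    then obtain v :: "'a ^ 'b" where "1 *\<^sub>R v = l *\<^sub>R v" "v \<noteq> 0" by (auto simp: eigenspace_def)
    then show "l \<in> {1}" unfolding scaleR_cancel_right by simp
  next
    fix l :: real assume "l \<in> {1}"
    moreover obtain i :: 'b where True by simp
    ultimately show "l \<in> {l. \<exists>v\<in>eigenspace (mat 1 :: 'a ^ 'b ^ 'b) l. v \<noteq> 0}"
      by (auto simp: eigenspace_def intro!: exI[of _ "axis i 1"] simp: axis_eq_0_iff)
  qed
  then have "eig_prod (mat 1 :: 'a ^ 'b ^ 'b) = 1"
    by (simp add: eig_prod_def)
  with pd show ?thesis by (simp add: pd_weight_def)
qed

section \<open>The law of the Gram matrix\<close>

text \<open>The constant in the law of the squared length in real dimension N = beta k: half the
  area of the unit sphere, or N/2 times the volume of the unit ball.\<close>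

definition ball_const :: "nat \<Rightarrow> nat \<Rightarrow> real" where
  "ball_const \<beta> k = pi powr (real \<beta> * real k / 2) / Gamma (real \<beta> * real k / 2)"

text \<open>One factor per column; each column already treated has used up one row.\<close>

definition wishart_const :: "nat \<Rightarrow> nat \<Rightarrow> nat \<Rightarrow> real" where
  "wishart_const \<beta> k p = (\<Prod>i<p. ball_const \<beta> (k - i))"

lemma ball_const_pos: "\<beta> > 0 \<Longrightarrow> k > 0 \<Longrightarrow> ball_const \<beta> k > 0"
  by (simp add: ball_const_def Gamma_real_pos)

lemma wishart_const_pos: "\<beta> > 0 \<Longrightarrow> p \<le> k \<Longrightarrow> wishart_const \<beta> k p > 0"
  unfolding wishart_const_def by (rule prod_pos) (auto intro!: ball_const_pos)

lemma wishart_const_Suc: "wishart_const \<beta> (Suc k) (Suc p) = ball_const \<beta> (Suc k) * wishart_const \<beta> k p"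
  unfolding wishart_const_def prod.lessThan_Suc_shift by simp

text \<open>The Gamma values at beta(k-i)/2 for i < p cancel. The exponents beta(k-i)/2 of pi add up
  to beta k p/2 - beta p(p-1)/4, and \<open>mv_gamma\<close> supplies the missing term.\<close>

lemma wishart_const_mv_gamma:
  assumes "\<beta> > 0" "p \<le> k"
  shows "wishart_const \<beta> k p * mv_gamma \<beta> p (real \<beta> * real k / 2) = pi powr (real \<beta> * real k * real p / 2)"
  using assms(2)
proof (induction p)
  case 0
  then show ?case by (simp add: wishart_const_def mv_gamma_def)
next
  case (Suc p)
  define b where "b = real \<beta>"
  define x where "x = b * real (k - p) / 2"
  define P where "P = (\<Prod>i=1..p. Gamma (b * real k / 2 - (real i - 1) * b / 2))"
  have "x > 0" using assms(1) Suc.prems by (simp add: x_def b_def)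
  then have G: "Gamma x > 0" by (rule Gamma_real_pos)
  have x: "b * real k / 2 - (real (Suc p) - 1) * b / 2 = x"
    using Suc.prems by (simp add: x_def of_nat_diff field_simps)
  have gS: "mv_gamma \<beta> (Suc p) (b * real k / 2) = pi powr ((real p + 1) * real p * b / 4) * (P * Gamma x)"
    using x by (simp add: mv_gamma_def P_def b_def add.commute)
  have g: "mv_gamma \<beta> p (b * real k / 2) = pi powr (real p * (real p - 1) * b / 4) * P"
    by (simp add: mv_gamma_def P_def b_def)
  have "(real p + 1) * real p * b / 4 = real p * (real p - 1) * b / 4 + real p * b / 2"
    by (simp add: field_simps)
  then have gg: "mv_gamma \<beta> (Suc p) (b * real k / 2) =
      mv_gamma \<beta> p (b * real k / 2) * pi powr (real p * b / 2) * Gamma x"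
    by (simp only: gS g powr_add mult_ac)
  have "wishart_const \<beta> k (Suc p) = wishart_const \<beta> k p * (pi powr x / Gamma x)"
    by (simp add: wishart_const_def ball_const_def x_def b_def)
  then have "wishart_const \<beta> k (Suc p) * mv_gamma \<beta> (Suc p) (b * real k / 2) =
      (wishart_const \<beta> k p * mv_gamma \<beta> p (b * real k / 2)) * (pi powr x * pi powr (real p * b / 2))"
    unfolding gg using G by (simp add: field_simps)
  also have "wishart_const \<beta> k p * mv_gamma \<beta> p (b * real k / 2) = pi powr (b * real k * real p / 2)"
    using Suc by (simp add: b_def)
  also have "pi powr (b * real k * real p / 2) * (pi powr x * pi powr (real p * b / 2)) =
      pi powr (b * real k * real (Suc p) / 2)"
    using Suc.prems by (simp add: x_def of_nat_diff field_simps flip: powr_add)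
  finally show ?case by (simp add: b_def)
qed

section \<open>The induction over columns\<close>

text \<open>The image of Lebesgue measure under the Gram map has density a constant times a power of
  the determinant. \<open>R\<close> must vary in the induction, since each column costs a
  row.\<close>

lemma nn_integral_gram:
  fixes g :: "'f::conj_div_algebra ^ 'n::{finite,linorder} ^ 'n::_ \<Rightarrow> ennreal" and R :: "'m::finite set"
  assumes "finite S" "g \<in> borel_measurable borel" "card S \<le> card R"
    "e = real DIM('f) * (real (card R) - real (card S) + 1) / 2 - 1"
  shows "(\<integral>\<^sup>+X. g (gram R S X) \<partial>pad (lam R) S 0) = ennreal (wishart_const DIM('f) (card R) (card S)) *
    (\<integral>\<^sup>+d. \<integral>\<^sup>+u. g (herm_mat S d u) * pd_weight e (herm_mat S d u) \<partial>pad lborel (prs S) 0 \<partial>pad lborel S 0)"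
  using assms
proof (induction S arbitrary: g R rule: finite_linorder_min_induct)
  case empty
  interpret L: borel_sigma_finite "lborel :: 'f measure" by (rule borel_sigma_finite_lborel)
  interpret LR: borel_sigma_finite "lborel :: real measure" by (rule borel_sigma_finite_lborel)
  interpret R: borel_sigma_finite "lam R :: ('f ^ 'm) measure" by (rule borel_sigma_finite_lam)
  interpret P: borel_sigma_finite "pad lborel (prs {}) (0 :: 'f ^ ('n \<times> 'n))" by (rule L.borel_sigma_finite_pad)
  note [measurable] = empty.prems(1)
  have m: "gram R {} X = mat 1" "herm_mat {} d u = (mat 1 :: 'f ^ 'n::_ ^ 'n::_)" for X d u
    by (simp_all add: gram_def herm_mat_def mat_def)
  have p: "prs {} = ({} :: ('n \<times> 'n) set)" by (simp add: prs_def)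
  show ?case
    unfolding m pd_weight_mat_1 p
    by (simp add: R.nn_integral_pad_empty L.nn_integral_pad_empty LR.nn_integral_pad_empty wishart_const_def
        del: nn_integral_const)
next
  case (insert s S)
  define \<beta> where "\<beta> = real DIM('f)"
  have \<beta>: "\<beta> > 0" by (simp add: \<beta>_def DIM_positive)
  have less: "\<And>j. j \<in> S \<Longrightarrow> s < j" and sS: "s \<notin> S" using insert.hyps by auto
  note [measurable] = insert.prems(1)
  have cS: "card (insert s S) = Suc (card S)" using insert.hyps sS by simp
  then have "R \<noteq> {}" using insert.prems(2) by auto
  then obtain r where r: "r \<in> R" by auto
  define R' where "R' = R - {r}"
  have cR: "card R = Suc (card R')"
    unfolding R'_def using r by (intro card.remove) auto
  have cS': "card S \<le> card R'" using insert.prems(2) cR cS by simp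
  have e: "e = real DIM('f) * (real (card R') - real (card S) + 1) / 2 - 1"
    using insert.prems(3) by (simp add: cS cR)
  define C where "C = wishart_const DIM('f) (card R') (card S)"
  define c where "c = ball_const DIM('f) (card R)"
  have C: "C > 0" unfolding C_def using cS' by (intro wishart_const_pos) (auto simp: DIM_positive)
  have c: "c > 0" unfolding c_def using cR by (intro ball_const_pos) (auto simp: DIM_positive)
  define h where "h = \<beta> * real (card R) / 2"
  interpret L: borel_sigma_finite "lborel :: 'f measure" by (rule borel_sigma_finite_lborel)
  interpret LR: borel_sigma_finite "lborel :: real measure" by (rule borel_sigma_finite_lborel)
  interpret R: borel_sigma_finite "lam R :: ('f ^ 'm) measure" by (rule borel_sigma_finite_lam)
  interpret R': borel_sigma_finite "lam R' :: ('f ^ 'm) measure" by (rule borel_sigma_finite_lam)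
  interpret XR: borel_sigma_finite "pad (lam R) S (0 :: 'f ^ 'm ^ 'n::_)" by (rule R.borel_sigma_finite_pad)
  interpret XR': borel_sigma_finite "pad (lam R') S (0 :: 'f ^ 'm ^ 'n::_)" by (rule R'.borel_sigma_finite_pad)
  interpret P: borel_sigma_finite "pad lborel (prs S) (0 :: 'f ^ ('n \<times> 'n))" by (rule L.borel_sigma_finite_pad)
  interpret S: borel_sigma_finite "pad lborel S (0 :: real ^ 'n::_)" by (rule LR.borel_sigma_finite_pad)
  interpret SF: borel_sigma_finite "pad lborel S (0 :: 'f ^ 'n::_)" by (rule L.borel_sigma_finite_pad)
  \<comment> \<open>The integral over all other columns once the new column has squared length
    \<open>t\<close>; \<open>J\<close> is its counterpart in Hermitian coordinates with pivot
    \<open>t\<close>.\<close>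
  define \<Psi> where "\<Psi> t = (\<integral>\<^sup>+a. \<integral>\<^sup>+Y. g (bord S s t a (gram R' S Y))
      \<partial>pad (lam R') S 0 \<partial>pad lborel S 0)" for t
  have [measurable]: "\<Psi> \<in> borel_measurable borel"
    unfolding \<Psi>_def by measurable
  define J where "J t = (\<integral>\<^sup>+v. \<integral>\<^sup>+d. \<integral>\<^sup>+u. g (herm_join S s t v d u) * pd_weight e (herm_join S s t v d u)
      \<partial>pad lborel (prs S) 0 \<partial>pad lborel S 0 \<partial>pad lborel S 0)" for t
  have [measurable]: "J \<in> borel_measurable borel"
    unfolding J_def by measurable
  have \<Psi>: "\<Psi> t * (ennreal (c * t powr (h - 1)) * indicator {0<..} t) = ennreal (c * C) * J t" for t
  proof (cases "t > 0")
    case True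
    define K where "K a = (\<integral>\<^sup>+d. \<integral>\<^sup>+u. g (bord S s t a (herm_mat S d u)) * pd_weight e (herm_mat S d u)
      \<partial>pad lborel (prs S) 0 \<partial>pad lborel S 0)" for a
    have [measurable]: "K \<in> borel_measurable borel"
      unfolding K_def by measurable
    have K: "K ((1 / sqrt t) *\<^sub>R v) = ennreal (t powr (- e)) * (\<integral>\<^sup>+d. \<integral>\<^sup>+u. g (herm_join S s t v d u) * pd_weight e (herm_join S s t v d u)
      \<partial>pad lborel (prs S) 0 \<partial>pad lborel S 0)" for v
      unfolding K_def by (rule nn_integral_schur_shift[OF insert.prems(1) True less])
    have "\<Psi> t = (\<integral>\<^sup>+a. ennreal C * K a \<partial>pad lborel S 0)"
      unfolding \<Psi>_def K_def C_def
    proof (rule nn_integral_cong)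
      fix a :: "'f ^ 'n::_"
      have [measurable]: "(\<lambda>G. g (bord S s t a G)) \<in> borel_measurable borel" by measurable
      from insert.IH[OF this cS' e]
      show "(\<integral>\<^sup>+Y. g (bord S s t a (gram R' S Y)) \<partial>pad (lam R') S 0) = ennreal (wishart_const DIM('f) (card R') (card S)) *
        (\<integral>\<^sup>+d. \<integral>\<^sup>+u. g (bord S s t a (herm_mat S d u)) * pd_weight e (herm_mat S d u) \<partial>pad lborel (prs S) 0 \<partial>pad lborel S 0)" .
    qed
    \<comment> \<open>Substitution of \<open>v / sqrt t\<close> for \<open>a\<close>, which turns
      row \<open>r\<close> of the other columns into the pivot row of the Gram matrix.\<close>
    also have "\<dots> = ennreal (\<bar>1 / sqrt t\<bar> ^ (DIM('f) * card S)) * (\<integral>\<^sup>+v. ennreal C * K ((1 / sqrt t) *\<^sub>R v) \<partial>pad lborel S 0)"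
      using True by (intro nn_integral_pad_lborel_scale) auto
    also have "(\<integral>\<^sup>+v. ennreal C * K ((1 / sqrt t) *\<^sub>R v) \<partial>pad lborel S 0) =
        (\<integral>\<^sup>+v. ennreal C * (ennreal (t powr (- e)) * (\<integral>\<^sup>+d. \<integral>\<^sup>+u. g (herm_join S s t v d u) * pd_weight e (herm_join S s t v d u)
      \<partial>pad lborel (prs S) 0 \<partial>pad lborel S 0)) \<partial>pad lborel S 0)"
      by (simp only: K)
    also have "\<dots> = ennreal C * (ennreal (t powr (- e)) * J t)"
      unfolding J_def by (subst nn_integral_cmult, measurable, subst nn_integral_cmult, measurable)
    also have "\<bar>1 / sqrt t\<bar> ^ (DIM('f) * card S) = t powr (- (\<beta> * real (card S) / 2))"
      using True by (simp add: powr_half_sqrt[symmetric] powr_realpow[symmetric] powr_powr powr_minus_divide[symmetric] \<beta>_def)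
    finally have \<Psi>t: "\<Psi> t = ennreal (t powr (- (\<beta> * real (card S) / 2))) * (ennreal C * (ennreal (t powr (- e)) * J t))" .
    \<comment> \<open>The factors are the Jacobian of the substitution for \<open>a\<close>, the
      determinant factor, and the density of the squared length. They cancel precisely for this
      exponent \<open>e\<close>.\<close>
    have "t powr (- (\<beta> * real (card S) / 2)) * t powr (- e) * t powr (h - 1) = 1"
    proof -
      have "- (\<beta> * real (card S) / 2) + - e + (h - 1) = 0"
        by (simp add: e h_def cR \<beta>_def[symmetric] field_simps)
      then show ?thesis using True by (simp flip: powr_add)
    qed
    then have const: "ennreal (t powr (- (\<beta> * real (card S) / 2))) * (ennreal C * ennreal (t powr (- e))) * ennreal (c * t powr (h - 1)) = ennreal (c * C)"
      using c C by (simp add: mult_ac flip: ennreal_mult)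
    have "\<Psi> t * ennreal (c * t powr (h - 1)) = ennreal (c * C) * J t"
      unfolding \<Psi>t const[symmetric] by (simp only: mult_ac)
    then show ?thesis using True by simp
  next
    case False
    \<comment> \<open>For a pivot that is not positive both sides vanish, so \<open>J\<close> may be
      integrated over the whole line.\<close>
    have "pd_weight e (herm_join S s t v d u) = 0" for v :: "'f ^ 'n::_" and d u
    proof -
      have "herm_join S s t v d u $ s $ s = of_real t" by (simp add: herm_join_def herm_mat_def)
      then have "herm_join S s t v d u \<notin> pos_def"
        using pos_def_diagonal[of "herm_join S s t v d u" s t] False by auto
      then show ?thesis by (simp add: pd_weight_def)
    qed
    then show ?thesis using False by (simp add: J_def)
  qed
  have "(\<integral>\<^sup>+X. g (gram R (insert s S) X) \<partial>pad (lam R) (insert s S) 0) =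
     (\<integral>\<^sup>+Y. \<integral>\<^sup>+x. g (gram R (insert s S) (vec_upd Y s x)) \<partial>lam R \<partial>pad (lam R) S 0)"
    by (rule R.nn_integral_pad_insert[OF sS]) measurable
  also have "\<dots> = (\<integral>\<^sup>+x. \<integral>\<^sup>+Y. g (gram R (insert s S) (vec_upd Y s x)) \<partial>pad (lam R) S 0 \<partial>lam R)"
    by (rule XR.Fubini[OF R.borel_sigma_finite_axioms]) measurable
  also have "\<dots> = (\<integral>\<^sup>+x. \<Psi> (\<Sum>k\<in>R. (norm (x $ k))\<^sup>2) \<partial>(lam R :: ('f ^ 'm) measure))"
    unfolding \<Psi>_def R'_def by (rule nn_integral_cong, rule nn_integral_gram_rotate[OF insert.prems(1) r sS])
  also have "\<dots> = (\<integral>\<^sup>+t. \<Psi> t * (ennreal (c * t powr (h - 1)) * indicator {0<..} t) \<partial>lborel)"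
    unfolding c_def ball_const_def h_def \<beta>_def
    using nn_integral_pad_sq_length[of \<Psi> R, where 'a = 'f] \<open>R \<noteq> {}\<close> by simp
  also have "\<dots> = ennreal (c * C) * (\<integral>\<^sup>+t. J t \<partial>lborel)"
    unfolding \<Psi> by (rule nn_integral_cmult) measurable
  also have "(\<integral>\<^sup>+t. J t \<partial>lborel) = (\<integral>\<^sup>+d. \<integral>\<^sup>+u. g (herm_mat (insert s S) d u) * pd_weight e (herm_mat (insert s S) d u)
      \<partial>pad lborel (prs (insert s S)) 0 \<partial>pad lborel (insert s S) 0)"
    unfolding J_def
    by (rule nn_integral_herm_mat_insert[of "\<lambda>F. g F * pd_weight e F", symmetric]) (use less in auto)
  also have "c * C = wishart_const DIM('f) (card R) (card (insert s S))"
    by (simp add: c_def C_def cR cS wishart_const_Suc)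
  finally show ?case .
qed

section \<open>Transfer to the reference measures\<close>

text \<open>Functions in a product over \<open>I\<close> are \<open>undefined\<close> off
  \<open>I\<close>, whereas \<open>pad\<close> has the values of \<open>a\<close> there;
  \<open>restrict\<close> reconciles the two conventions.\<close>

lemma nn_integral_PiM_eq_pad:
  fixes f :: "('i::finite \<Rightarrow> 'a::euclidean_space) \<Rightarrow> ennreal" and a :: "'a ^ 'i"
  assumes "finite I" "f \<in> borel_measurable (Pi\<^sub>M I (\<lambda>_. lborel))"
  shows "(\<integral>\<^sup>+x. f x \<partial>Pi\<^sub>M I (\<lambda>_. lborel)) = (\<integral>\<^sup>+x. f (restrict (vec_nth x) I) \<partial>pad lborel I a)"
  using assms
proof (induction I arbitrary: f rule: finite_induct)
  case empty
  interpret L: borel_sigma_finite "lborel :: 'a measure" by (rule borel_sigma_finite_lborel)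
  interpret product_sigma_finite "\<lambda>_::'i. lborel :: 'a measure" by standard
  have "restrict (vec_nth x) {} = (\<lambda>_. undefined)" for x :: "'a ^ 'i" by (simp add: fun_eq_iff)
  then show ?case
    by (simp add: PiM_empty nn_integral_count_space_finite L.nn_integral_pad_empty del: nn_integral_const)
next
  case (insert s I)
  interpret L: borel_sigma_finite "lborel :: 'a measure" by (rule borel_sigma_finite_lborel)
  interpret product_sigma_finite "\<lambda>_::'i. lborel :: 'a measure" by standard
  have [measurable]: "f \<in> borel_measurable (Pi\<^sub>M (insert s I) (\<lambda>_. lborel))" by fact
  have [measurable]: "(\<lambda>(x, y). f (x(s := y))) \<in> borel_measurable (Pi\<^sub>M I (\<lambda>_. lborel) \<Otimes>\<^sub>M lborel)"
    using measurable_compose[OF measurable_add_dim[of s I "\<lambda>_. lborel :: 'a measure"] insert.prems]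
    by (simp add: case_prod_unfold)
  have [measurable]: "(\<lambda>x. restrict (vec_nth x) (insert s I)) \<in> borel \<rightarrow>\<^sub>M Pi\<^sub>M (insert s I) (\<lambda>_. lborel :: 'a measure)"
    by (rule measurable_restrict) simp
  have upd: "(restrict (vec_nth x) I)(s := y) = restrict (vec_nth (vec_upd x s y)) (insert s I)" for x :: "'a ^ 'i" and y
    by (auto simp: fun_eq_iff)
  have "(\<integral>\<^sup>+x. f x \<partial>Pi\<^sub>M (insert s I) (\<lambda>_. lborel)) = (\<integral>\<^sup>+x. \<integral>\<^sup>+y. f (x(s := y)) \<partial>lborel \<partial>Pi\<^sub>M I (\<lambda>_. lborel))"
    using insert.hyps by (rule product_nn_integral_insert) fact
  also have "\<dots> = (\<integral>\<^sup>+x. \<integral>\<^sup>+y. f ((restrict (vec_nth x) I)(s := y)) \<partial>lborel \<partial>pad lborel I a)"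
    by (rule insert.IH) measurable
  also have "\<dots> = (\<integral>\<^sup>+x. f (restrict (vec_nth x) (insert s I)) \<partial>pad lborel (insert s I) a)"
    unfolding upd by (rule L.nn_integral_pad_insert[OF insert.hyps(2), symmetric]) measurable
  finally show ?case .
qed

text \<open>A matrix is stored by rows, but the induction needs columns as coordinates.
  Transposition permutes the basis vectors and so preserves volumes of boxes.\<close>

lemma lborel_transpose:
  "distr lborel borel transpose = (lborel :: ('f::euclidean_space ^ 'n ^ 'm) measure)"
proof (rule lborel_eqI[symmetric])
  have m: "(transpose :: 'f ^ 'm ^ 'n \<Rightarrow> 'f ^ 'n ^ 'm) \<in> borel_measurable lborel"
    unfolding transpose_def[abs_def] by measurable
  fix l u :: "'f ^ 'n ^ 'm" assume lu: "\<And>b. b \<in> Basis \<Longrightarrow> l \<bullet> b \<le> u \<bullet> b"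
  have inner: "transpose x \<bullet> axis i (axis j c) = x \<bullet> axis j (axis i c)" for x :: "'f ^ 'a ^ 'b" and i j c
    by (simp add: inner_axis transpose_def)
  have basis: "(Basis :: ('f ^ 'm ^ 'n) set) = (\<lambda>((j, i), c). axis j (axis i c)) ` (UNIV \<times> Basis)"
    "(Basis :: ('f ^ 'n ^ 'm) set) = (\<lambda>((j, i), c). axis i (axis j c)) ` (UNIV \<times> Basis)"
    by (auto simp: Basis_vec_def image_iff) blast+
  have inj: "inj_on (\<lambda>((j, i), c). axis j (axis i c) :: 'f ^ 'm ^ 'n) (UNIV \<times> Basis)"
    "inj_on (\<lambda>((j, i), c). axis i (axis j c) :: 'f ^ 'n ^ 'm) (UNIV \<times> Basis)"
    by (auto simp: inj_on_def axis_eq_axis)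
  have box: "transpose -` box l u = box (transpose l) (transpose u)"
    unfolding box_def basis by (auto simp: inner)
  have "emeasure (distr lborel borel transpose) (box l u) = emeasure lborel (box (transpose l) (transpose u))"
    using m by (simp add: emeasure_distr box)
  also have "\<dots> = ennreal (\<Prod>b\<in>Basis. (transpose u - transpose l) \<bullet> b)"
  proof -
    have "transpose l \<bullet> b \<le> transpose u \<bullet> b" if "b \<in> Basis" for b
    proof -
      from that obtain i j c where "b = axis j (axis i c)" "c \<in> Basis" unfolding basis by auto
      then show ?thesis using lu[of "axis i (axis j c)"] by (auto simp: inner Basis_vec_def)
    qed
    then show ?thesis by (simp add: emeasure_lborel_box_eq)
  qed
  also have "(\<Prod>b\<in>Basis. (transpose u - transpose l) \<bullet> b) = (\<Prod>b\<in>Basis. (u - l) \<bullet> b)"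
    unfolding basis prod.reindex[OF inj(1)] prod.reindex[OF inj(2)]
    by (rule prod.cong) (auto simp: inner inner_diff_left)
  finally show "emeasure (distr lborel borel transpose) (box l u) = ennreal (\<Prod>b\<in>Basis. (u - l) \<bullet> b)" .
qed simp

lemma borel_measurable_adjoint_mult [measurable]:
  "(\<lambda>X :: 'f::conj_div_algebra ^ 'n ^ 'm. adjoint_mat X ** X) \<in> borel_measurable borel"
  unfolding adjoint_mat_def matrix_matrix_mult_def by measurable

lemma nn_integral_adjoint_mult:
  fixes g :: "'f::conj_div_algebra ^ 'n ^ 'n \<Rightarrow> ennreal"
  assumes [measurable]: "g \<in> borel_measurable borel"
  shows "(\<integral>\<^sup>+X. g (adjoint_mat X ** X) \<partial>(lborel :: ('f ^ 'n ^ 'm) measure)) =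
    (\<integral>\<^sup>+Z. g (gram (UNIV :: 'm set) UNIV Z) \<partial>pad (lam UNIV) UNIV 0)"
proof -
  have m: "(transpose :: 'f ^ 'm ^ 'n \<Rightarrow> 'f ^ 'n ^ 'm) \<in> borel_measurable lborel"
    unfolding transpose_def[abs_def] by measurable
  \<comment> \<open>The product decomposition is applied twice: to the matrix over its columns, then
    to each column over its entries.\<close>
  have "(lborel :: ('f ^ 'm ^ 'n) measure) = pad lborel UNIV 0"
    by (rule lborel_eq_pad)
  also have "(lborel :: ('f ^ 'm) measure) = lam UNIV"
    by (rule lborel_eq_pad)
  finally have L: "(lborel :: ('f ^ 'm ^ 'n) measure) = pad (lam UNIV) UNIV 0" .
  have gram: "adjoint_mat (transpose Z) ** transpose Z = gram UNIV UNIV Z" for Z :: "'f ^ 'm ^ 'n"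
    by (simp add: vec_eq_iff adjoint_mat_def matrix_matrix_mult_def transpose_def gram_def hdot_def)
  have "(\<integral>\<^sup>+X. g (adjoint_mat X ** X) \<partial>(lborel :: ('f ^ 'n ^ 'm) measure)) =
    (\<integral>\<^sup>+Z. g (adjoint_mat (transpose Z) ** transpose Z) \<partial>(lborel :: ('f ^ 'm ^ 'n) measure))"
    unfolding lborel_transpose[symmetric, where 'n = 'n] using m
    by (subst nn_integral_distr) simp_all
  then show ?thesis unfolding gram L .
qed

lemma nn_integral_herm_lborel:
  fixes g :: "'f::conj_div_algebra ^ 'n::{finite,wellorder} ^ 'n::_ \<Rightarrow> ennreal"
  assumes [measurable]: "g \<in> borel_measurable borel"
  shows "(\<integral>\<^sup>+F. g F \<partial>herm_lborel) =
    (\<integral>\<^sup>+d. \<integral>\<^sup>+u. g (herm_mat UNIV d u) \<partial>pad lborel (prs UNIV) 0 \<partial>pad lborel UNIV 0)"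
proof -
  let ?I = "{(i, j). i < j} :: ('n \<times> 'n) set"
  let ?D = "Pi\<^sub>M (UNIV :: 'n set) (\<lambda>_. lborel :: real measure)"
  let ?U = "Pi\<^sub>M ?I (\<lambda>_. lborel :: 'f measure)"
  interpret U: product_sigma_finite "\<lambda>_::'n \<times> 'n. lborel :: 'f measure" by standard
  interpret U: sigma_finite_measure ?U by (rule U.sigma_finite) simp
  note [measurable] = measurable_herm_of_coords[where 'f = 'f and 'n = 'n]
  have gm: "(\<lambda>x. g (herm_of_coords x)) \<in> borel_measurable (?D \<Otimes>\<^sub>M ?U)"
    by measurable
  have I: "?I = prs UNIV" by (simp add: prs_def)
  have eq: "herm_of_coords (restrict (vec_nth d) UNIV, restrict (vec_nth u) ?I) = herm_mat UNIV d u"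
    for d :: "real ^ 'n::_" and u :: "'f ^ ('n \<times> 'n)"
    by (auto simp: vec_eq_iff herm_of_coords_def herm_mat_def)
  have "(\<integral>\<^sup>+F. g F \<partial>herm_lborel) = (\<integral>\<^sup>+x. g (herm_of_coords x) \<partial>(?D \<Otimes>\<^sub>M ?U))"
    unfolding herm_lborel_def by (rule nn_integral_distr) measurable
  also have "\<dots> = (\<integral>\<^sup>+d. \<integral>\<^sup>+u. g (herm_of_coords (d, u)) \<partial>?U \<partial>?D)"
    by (rule U.nn_integral_fst[symmetric]) (rule gm)
  also have "\<dots> = (\<integral>\<^sup>+d. \<integral>\<^sup>+u. g (herm_of_coords (restrict (vec_nth d) UNIV, u)) \<partial>?U \<partial>pad lborel UNIV 0)"
    using gm by (intro nn_integral_PiM_eq_pad) simp_all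
  also have "\<dots> = (\<integral>\<^sup>+d. \<integral>\<^sup>+u. g (herm_of_coords (restrict (vec_nth d) UNIV, restrict (vec_nth u) ?I)) \<partial>pad lborel ?I 0 \<partial>pad lborel UNIV 0)"
    using measurable_compose[OF measurable_Pair1' gm] by (intro nn_integral_cong nn_integral_PiM_eq_pad) (simp_all add: space_PiM)
  finally show ?thesis unfolding eq unfolding I .
qed

text \<open>Cyclicity of the trace fails in general over the quaternions. Here both traces are the
  sum of the squared norms of all entries.\<close>

lemma real_trace_adjoint:
  fixes X :: "'f::conj_div_algebra ^ 'n ^ 'm"
  shows "real_trace (X ** adjoint_mat X) = real_trace (adjoint_mat X ** X)"
proof -
  have "real_trace (X ** adjoint_mat X) = (\<Sum>i\<in>UNIV. \<Sum>j\<in>UNIV. (norm (X $ i $ j))\<^sup>2)"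
    by (simp add: real_trace_def trace_def matrix_matrix_mult_def adjoint_mat_def mult_hconj)
  also have "\<dots> = (\<Sum>j\<in>UNIV. \<Sum>i\<in>UNIV. (norm (X $ i $ j))\<^sup>2)"
    by (rule sum.swap)
  also have "\<dots> = real_trace (adjoint_mat X ** X)"
    by (simp add: real_trace_def trace_def matrix_matrix_mult_def adjoint_mat_def hconj_mult_self)
  finally show ?thesis .
qed

lemma borel_measurable_real_trace [measurable]:
  "(real_trace :: 'f::conj_div_algebra ^ 'n ^ 'n \<Rightarrow> real) \<in> borel_measurable borel"
  unfolding real_trace_def[abs_def] re_part_def trace_def by measurable

lemma distributed_adjoint_mult:
  fixes T :: "'w \<Rightarrow> 'f::conj_div_algebra ^ 'n::{finite,wellorder} ^ 'm"
  assumes mn: "CARD('n) \<le> CARD('m)" and \<nu>: "\<nu> > 0"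
    and T: "distributed M lborel T (\<lambda>X. ennreal (matrix_T_density \<nu> X))"
  shows "distributed M herm_lborel (\<lambda>\<omega>. adjoint_mat (T \<omega>) ** T \<omega>)
    (\<lambda>F. ennreal (matrix_beta2_density \<nu> CARD('m) F))"
proof -
  define \<beta> where "\<beta> = real DIM('f)"
  define m where "m = real CARD('m)"
  define n where "n = real CARD('n)"
  define b where "b = \<beta> * (\<nu> + m * n) / 2"
  define e where "e = \<beta> * (m - n + 1) / 2 - 1"
  define C where "C = wishart_const DIM('f) CARD('m) CARD('n)"
  define K where "K = mv_gamma DIM('f) 1 b / (pi powr (\<beta> * m * n / 2) * mv_gamma DIM('f) 1 (\<beta> * \<nu> / 2))"
  have pos: "\<beta> > 0" "m > 0" "n > 0" by (simp_all add: \<beta>_def m_def n_def DIM_positive)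
  have C: "C > 0" unfolding C_def using mn by (intro wishart_const_pos) (auto simp: DIM_positive)
  \<comment> \<open>\<open>CG\<close> expresses the multivariate gamma value by \<open>C\<close>;
    then \<open>KC\<close> identifies \<open>C * K\<close> with the normalising constant of the
    target density, the powers of pi cancelling.\<close>
  have CG: "C * mv_gamma DIM('f) CARD('n) (\<beta> * m / 2) = pi powr (\<beta> * m * n / 2)"
    unfolding C_def \<beta>_def m_def n_def using mn by (intro wishart_const_mv_gamma) (auto simp: DIM_positive)
  then have G: "mv_gamma DIM('f) CARD('n) (\<beta> * m / 2) = pi powr (\<beta> * m * n / 2) / C"
    using C by (simp add: field_simps)
  have KC: "mv_gamma DIM('f) 1 b / (mv_gamma DIM('f) 1 (\<beta> * \<nu> / 2) * mv_gamma DIM('f) CARD('n) (\<beta> * m / 2)) = C * K"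
    unfolding G K_def by (simp add: mult_ac)
  have "mv_gamma DIM('f) 1 a > 0" if "a > 0" for a
    using that by (simp add: mv_gamma_def Gamma_real_pos)
  then have K: "K > 0"
    using pos \<nu> by (simp add: K_def b_def add_pos_pos)
  \<comment> \<open>The density of T read as a function of its Gram matrix.\<close>
  define k :: "'f ^ 'n::_ ^ 'n::_ \<Rightarrow> ennreal" where "k F = ennreal (K * (1 + real_trace F) powr (- b))" for F
  have [measurable]: "k \<in> borel_measurable borel" unfolding k_def by measurable
  have Td: "ennreal (matrix_T_density \<nu> X) = k (adjoint_mat X ** X)" for X :: "'f ^ 'n::_ ^ 'm"
    unfolding k_def real_trace_adjoint[symmetric]
    by (simp add: matrix_T_density_def Let_def K_def b_def \<beta>_def m_def n_def)
  have Bd: "ennreal (matrix_beta2_density \<nu> CARD('m) F) = ennreal C * (k F * pd_weight e F)" for F :: "'f ^ 'n::_ ^ 'n::_"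
  proof (cases "F \<in> pos_def")
    case True
    have "matrix_beta2_density \<nu> CARD('m) F = (C * K) * eig_prod F powr e * (1 + real_trace F) powr (- b)"
      using True unfolding KC[symmetric]
      by (simp add: matrix_beta2_density_def Let_def b_def \<beta>_def m_def n_def e_def)
    then show ?thesis
      using True C K by (simp add: k_def pd_weight_def mult_ac flip: ennreal_mult)
  qed (simp add: matrix_beta2_density_def pd_weight_def)
  have sets: "sets (herm_lborel :: ('f ^ 'n::_ ^ 'n::_) measure) = sets borel"
    by (simp add: herm_lborel_def)
  note [measurable_cong] = sets
  have Tm: "T \<in> measurable M lborel" using T by (rule distributed_measurable)
  then have [measurable]: "T \<in> borel_measurable M" by simp
  have Bm: "(\<lambda>F. ennreal (matrix_beta2_density \<nu> CARD('m) F)) \<in> borel_measurable (herm_lborel :: ('f ^ 'n::_ ^ 'n::_) measure)"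
    unfolding Bd by measurable
  have Ym: "(\<lambda>\<omega>. adjoint_mat (T \<omega>) ** T \<omega>) \<in> measurable M herm_lborel"
    by measurable
  have "distr M herm_lborel (\<lambda>\<omega>. adjoint_mat (T \<omega>) ** T \<omega>) =
    density herm_lborel (\<lambda>F. ennreal (matrix_beta2_density \<nu> CARD('m) F))" (is "?L = ?R")
  proof (rule measure_eqI)
    fix A assume "A \<in> sets ?L"
    then have [measurable]: "A \<in> sets borel" by (simp add: sets)
    have "emeasure ?L A = (\<integral>\<^sup>+\<omega>. indicator A (adjoint_mat (T \<omega>) ** T \<omega>) \<partial>M)"
      using Ym by (subst nn_integral_indicator[symmetric], simp add: sets, subst nn_integral_distr)
        (simp_all add: sets)
    also have "\<dots> = (\<integral>\<^sup>+X. ennreal (matrix_T_density \<nu> X) * indicator A (adjoint_mat X ** X)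
        \<partial>(lborel :: ('f ^ 'n::_ ^ 'm) measure))"
      by (rule distributed_nn_integral[OF T, where g = "\<lambda>X. indicator A (adjoint_mat X ** X)", symmetric]) measurable
    also have "\<dots> = (\<integral>\<^sup>+Z. k (gram UNIV UNIV Z) * indicator A (gram UNIV UNIV Z) \<partial>pad (lam (UNIV :: 'm set)) UNIV 0)"
      unfolding Td by (rule nn_integral_adjoint_mult) measurable
    also have "\<dots> = ennreal C * (\<integral>\<^sup>+d. \<integral>\<^sup>+u. k (herm_mat UNIV d u) * indicator A (herm_mat UNIV d u) * pd_weight e (herm_mat UNIV d u)
        \<partial>pad lborel (prs UNIV) 0 \<partial>pad lborel UNIV 0)"
      unfolding C_def
      by (rule nn_integral_gram[where g = "\<lambda>F. k F * indicator A F"])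
         (use mn in \<open>simp_all add: e_def \<beta>_def m_def n_def\<close>)
    also have "\<dots> = ennreal C * (\<integral>\<^sup>+F. k F * indicator A F * pd_weight e F \<partial>herm_lborel)"
      by (subst nn_integral_herm_lborel) (simp_all add: borel_measurable_pd_weight)
    also have "\<dots> = (\<integral>\<^sup>+F. ennreal (matrix_beta2_density \<nu> CARD('m) F) * indicator A F \<partial>herm_lborel)"
      unfolding Bd by (subst nn_integral_cmult[symmetric]) (simp_all add: mult_ac)
    also have "\<dots> = emeasure ?R A"
      using Bm by (simp add: emeasure_density sets)
    finally show "emeasure ?L A = emeasure ?R A" .
  qed (simp add: sets)
  then show ?thesis
    using Bm Ym by (simp add: distributed_def)
qed

theorem theorem3p3:
  fixes \<nu> :: real and M :: "'w measure"
    and T\<^sub>1 :: "'w \<Rightarrow> real ^ 'n::{finite,wellorder} ^ 'm"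
    and T\<^sub>2 :: "'w \<Rightarrow> complex ^ 'n::_ ^ 'm"
    and T\<^sub>4 :: "'w \<Rightarrow> quat ^ 'n::_ ^ 'm"
  assumes "CARD('m) > CARD('n)" and "\<nu> > 0" and "prob_space M"
  shows
    "(distributed M lborel T\<^sub>1 (\<lambda>X. ennreal (matrix_T_density \<nu> X)) \<longrightarrow>
      distributed M herm_lborel (\<lambda>\<omega>. adjoint_mat (T\<^sub>1 \<omega>) ** T\<^sub>1 \<omega>)
        (\<lambda>F. ennreal (matrix_beta2_density \<nu> CARD('m) F))) \<and>
     (distributed M lborel T\<^sub>2 (\<lambda>X. ennreal (matrix_T_density \<nu> X)) \<longrightarrow>
      distributed M herm_lborel (\<lambda>\<omega>. adjoint_mat (T\<^sub>2 \<omega>) ** T\<^sub>2 \<omega>)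
        (\<lambda>F. ennreal (matrix_beta2_density \<nu> CARD('m) F))) \<and>
     (distributed M lborel T\<^sub>4 (\<lambda>X. ennreal (matrix_T_density \<nu> X)) \<longrightarrow>
      distributed M herm_lborel (\<lambda>\<omega>. adjoint_mat (T\<^sub>4 \<omega>) ** T\<^sub>4 \<omega>)
        (\<lambda>F. ennreal (matrix_beta2_density \<nu> CARD('m) F)))"
  using assms by (simp add: distributed_adjoint_mult less_imp_le)

end
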